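(* The iterated monodromy group $\mathcal{I} := \operatorname{IMG}(z^2+i)$ of the quadratic polynomial $z^2+i$ has subexponential growth. (Explicitly, $\mathcal{I}$ is the subgroup $\langle \sigma,\alpha,\beta\rangle \le \operatorname{Aut}(T^{(2)})$ of the automorphism group of the infinite binary rooted tree, where $\sigma$ is the swap and $\alpha,\beta$ are defined by $\alpha=(\sigma,\beta)$ and $\beta=(\alpha,1)$.)
   Context: **Tree automorphisms.** $T^{(2)}$ is the infinite binary rooted tree, with vertices the finite words over $\{\mathsf{L},\mathsf{R}\}$. The root has two subtrees $T_{\mathsf L}$ and $T_{\mathsf R}$ below it (words beginning with $\mathsf L$, respectively $\mathsf R$), each identified with $T^{(2)}$ by deleting the first letter. For $\alpha_{\mathsf L},\alpha_{\mathsf R}\in\operatorname{Aut}(T^{(2)})$, the pair $(\alpha_{\mathsf L},\alpha_{\mathsf R})$ denotes the automorphism that preserves both subtrees and acts on $T_{\mathsf L}$ as $\alpha_{\mathsf L}$ and on $T_{\mathsf R}$ as $\alpha_{\mathsf R}$. The swap $\sigma$ is the involution interchanging $T_{\mathsf L}$ and $T_{\mathsf R}$ via these identifications (it changes only the first letter of each nonempty word), so $\sigma(\alpha_{\mathsf L},\alpha_{\mathsf R})\sigma^{-1}=(\alpha_{\mathsf R},\alpha_{\mathsf L})$. A recursive system such as $\alpha=(\sigma,\beta)$, $\beta=(\alpha,1)$ has a unique solution in $\operatorname{Aut}(T^{(2)})$. **Iterated monodromy group.** Let $f(z)=z^2+c$ and let $\mathcal{O}=\{f^n(0): n\ge 1\}$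 be its critical orbit; for $c=i$ it is $\{i,-1+i,-i\}$. Put $X=\mathbb{C}\setminus\overline{\mathcal{O}}$. Then $f^{-1}(X)\subseteq X$ and $f:f^{-1}(X)\to X$ is a two-sheeted covering map. Fix a base point $*\in X$. The set $f^{-s}( * )$ has $2^s$ elements, and the disjoint union of these sets over $s\ge 0$ forms the vertices of an infinite binary rooted tree, identified with $T^{(2)}$, in which a point $x$ at level $s$ is joined to its parent $f(x)$ at level $s-1$. The class of a loop $\gamma$ in $\pi_1(X,* )$ acts on level $s$ by sending $x\in f^{-s}( * )$ to the endpoint of the lift of $\gamma$ under $f^s$ starting at $x$. These actions are compatible with the tree structure, and $\operatorname{IMG}(f)$ is the image of $\pi_1(X,* )$ in $\operatorname{Aut}(T^{(2)})$; it is well defined up to conjugation in $\operatorname{Aut}(T^{(2)})$. For $f(z)=z^2+i$ it is known (Bartholdi–Grigorchuk–Nekrashevych) that, up to this conjugation, $\operatorname{IMG}(f)=\langle\sigma,\alpha,\beta\rangle$ with $\alpha=(\sigma,\beta)$, $\beta=(\alpha,1)$. **Growth.** For a group $G$ with finite generating set $\Sigma$ and a weight function $\tilde\ell:\Sigma\to\mathbb{R}^+$ (strictly positive), the length of a word $x_1^{\varepsilon_1}\cdots x_k^{\varepsilon_k}$ with $x_j\in\Sigma$, $\varepsilon_j=\pm1$, is $\sum_j\tilde\ell(x_j)$, and $\ell(g)$ is the minimal length of a word representing $g\in G$. Let $\operatorname{gr}(r)=\#\{g\in G:\ell(g)\le r\}$. The growth rate $\lambda=\lim_{r\to\infty}\operatorname{gr}(r)^{1/r}$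 exists. $G$ has subexponential growth if $\lambda\le 1$ and exponential growth if $\lambda>1$; which case holds does not depend on $\Sigma$ and $\tilde\ell$. *)

theory Defs
  imports "HOL-Analysis.Analysis" "HOL-Algebra.Generated_Groups"
begin

section \<open>Automorphisms of the infinite binary rooted tree\<close>

text \<open>
  Vertices are the finite words over two letters. The root is the empty word and the parent of
  a nonempty word is obtained by deleting its \<^emph>\<open>last\<close> letter, so that the subtree below a word
  consists of its extensions.
\<close>

datatype letter = Lft | Rgt

definition tree_automorphism :: "(letter list \<Rightarrow> letter list) \<Rightarrow> bool" where
  "tree_automorphism g \<longleftrightarrow>
     bij g \<and> (\<forall>w. length (g w) = length w) \<and> (\<forall>w. g (butlast w) = butlast (g w))"

definition Aut_T :: "(letter list \<Rightarrow> letter list) monoid" where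
  "Aut_T = \<lparr>carrier = {g. tree_automorphism g}, mult = (\<circ>), one = id\<rparr>"

fun pair_aut :: "(letter list \<Rightarrow> letter list) \<Rightarrow> (letter list \<Rightarrow> letter list) \<Rightarrow> letter list \<Rightarrow> letter list"
  where
    "pair_aut a b [] = []"
  | "pair_aut a b (Lft # w) = Lft # a w"
  | "pair_aut a b (Rgt # w) = Rgt # b w"

fun swap_aut :: "letter list \<Rightarrow> letter list" where
  "swap_aut [] = []"
| "swap_aut (Lft # w) = Rgt # w"
| "swap_aut (Rgt # w) = Lft # w"

fun alpha_aut :: "letter list \<Rightarrow> letter list" and beta_aut :: "letter list \<Rightarrow> letter list" where
  "alpha_aut [] = []"
| "alpha_aut (Lft # w) = Lft # swap_aut w"
| "alpha_aut (Rgt # w) = Rgt # beta_aut w"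
| "beta_aut [] = []"
| "beta_aut (Lft # w) = Lft # alpha_aut w"
| "beta_aut (Rgt # w) = Rgt # w"

lemma alpha_aut_eq: "alpha_aut = pair_aut swap_aut beta_aut"
proof
  show "alpha_aut w = pair_aut swap_aut beta_aut w" for w
    by (cases "(swap_aut, beta_aut, w)" rule: pair_aut.cases) auto
qed

lemma beta_aut_eq: "beta_aut = pair_aut alpha_aut id"
proof
  show "beta_aut w = pair_aut alpha_aut id w" for w
    by (cases "(alpha_aut, id :: letter list \<Rightarrow> letter list, w)" rule: pair_aut.cases) auto
qed

lemma alpha_beta_unique:
  assumes "a = pair_aut swap_aut b" "b = pair_aut a id"
  shows "a = alpha_aut" "b = beta_aut"
proof -
  have "a w = alpha_aut w \<and> b w = beta_aut w" for w
  proof (induction w)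
    case Nil
    show ?case by (subst assms(1), subst assms(2)) simp
  next
    case (Cons x w)
    then show ?case
      by (cases x; subst assms(1); subst assms(2)) simp_all
  qed
  then show "a = alpha_aut" "b = beta_aut" by auto
qed

definition I_explicit :: "(letter list \<Rightarrow> letter list) set" where
  "I_explicit = generate Aut_T {swap_aut, alpha_aut, beta_aut}"

lemma group_Aut_T: "group Aut_T"
proof (rule groupI)
  fix g assume "g \<in> carrier Aut_T"
  then have g: "bij g" "\<And>w. length (g w) = length w" "\<And>w. g (butlast w) = butlast (g w)"
    by (auto simp: Aut_T_def tree_automorphism_def)
  have surj: "g (inv_into UNIV g w) = w" for w
    using g(1) by (simp add: bij_is_surj surj_f_inv_f)
  have inj: "inv_into UNIV g (g w) = w" for w
    using g(1) by (simp add: bij_is_inj)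
  have "bij (inv_into UNIV g)" using g(1) by (rule bij_imp_bij_inv)
  moreover have "length (inv_into UNIV g w) = length w" for w
    by (metis g(2) surj)
  moreover have "inv_into UNIV g (butlast w) = butlast (inv_into UNIV g w)" for w
    by (metis g(3) surj inj)
  ultimately have "inv_into UNIV g \<in> carrier Aut_T"
    by (simp add: Aut_T_def tree_automorphism_def)
  moreover have "inv_into UNIV g \<otimes>\<^bsub>Aut_T\<^esub> g = \<one>\<^bsub>Aut_T\<^esub>"
    using inj by (auto simp: Aut_T_def)
  ultimately show "\<exists>h\<in>carrier Aut_T. h \<otimes>\<^bsub>Aut_T\<^esub> g = \<one>\<^bsub>Aut_T\<^esub>" by blast
qed (auto simp: Aut_T_def tree_automorphism_def bij_comp comp_assoc)

lemma pair_aut_in_Aut_T: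
  assumes "a \<in> carrier Aut_T" "b \<in> carrier Aut_T"
  shows "pair_aut a b \<in> carrier Aut_T"
proof -
  have a: "bij a" "\<And>w. length (a w) = length w" "\<And>w. a (butlast w) = butlast (a w)"
    and b: "bij b" "\<And>w. length (b w) = length w" "\<And>w. b (butlast w) = butlast (b w)"
    using assms by (auto simp: Aut_T_def tree_automorphism_def)
  have len: "length (pair_aut a b w) = length w" for w
    using a(2) b(2) by (cases "(a, b, w)" rule: pair_aut.cases) auto
  have nil: "a w = [] \<longleftrightarrow> w = []" "b w = [] \<longleftrightarrow> w = []" for w
    using a(2)[of w] b(2)[of w] by (metis length_0_conv)+
  have but: "pair_aut a b (butlast w) = butlast (pair_aut a b w)" for w
    using a(3) b(3) nil by (cases "(a, b, w)" rule: pair_aut.cases) auto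
  have "inj (pair_aut a b)"
  proof (rule injI)
    fix v w assume "pair_aut a b v = pair_aut a b w"
    then show "v = w"
      using bij_is_inj[OF a(1)] bij_is_inj[OF b(1)]
      by (cases "(a, b, v)" rule: pair_aut.cases; cases "(a, b, w)" rule: pair_aut.cases)
        (auto dest: injD)
  qed
  moreover have "\<exists>w. v = pair_aut a b w" for v
  proof (cases v)
    case Nil
    then show ?thesis by (intro exI[of _ "[]"]) simp
  next
    case (Cons x u)
    obtain u1 u2 where "a u1 = u" "b u2 = u"
      using bij_is_surj[OF a(1)] bij_is_surj[OF b(1)] by (metis surjD)
    with Cons show ?thesis
      by (cases x) (auto intro: exI[of _ "Lft # u1"] exI[of _ "Rgt # u2"])
  qed
  ultimately have "bij (pair_aut a b)"
    by (auto intro!: bijI simp: surj_def)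
  with len but show ?thesis
    by (simp add: Aut_T_def tree_automorphism_def)
qed

lemma swap_aut_in_Aut_T: "swap_aut \<in> carrier Aut_T"
proof -
  have invol: "swap_aut (swap_aut w) = w" for w
    by (cases w rule: swap_aut.cases) auto
  have "bij swap_aut" by (rule involuntory_imp_bij) (rule invol)
  moreover have "length (swap_aut w) = length w" "swap_aut (butlast w) = butlast (swap_aut w)" for w
    by (cases w rule: swap_aut.cases; auto)+
  ultimately show ?thesis by (simp add: Aut_T_def tree_automorphism_def)
qed

lemma alpha_beta_aut_in_Aut_T: "alpha_aut \<in> carrier Aut_T" "beta_aut \<in> carrier Aut_T"
proof -
  have swap: "swap_aut (swap_aut w) = w" "length (swap_aut w) = length w"
    "swap_aut (butlast w) = butlast (swap_aut w)" "swap_aut w = [] \<longleftrightarrow> w = []" for w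
    by (cases w rule: swap_aut.cases; simp)+
  have len: "length (alpha_aut w) = length w" "length (beta_aut w) = length w" for w
    by (induction w rule: alpha_aut_beta_aut.induct) (auto simp: swap)
  have nil: "alpha_aut w = [] \<longleftrightarrow> w = []" "beta_aut w = [] \<longleftrightarrow> w = []" for w
    using len[of w] by (metis length_0_conv)+
  have "alpha_aut (alpha_aut w) = w" "beta_aut (beta_aut w) = w" for w
    by (induction w rule: alpha_aut_beta_aut.induct) (auto simp: swap)
  then have "bij alpha_aut" "bij beta_aut"
    by (auto intro: involuntory_imp_bij)
  moreover have "alpha_aut (butlast w) = butlast (alpha_aut w) \<and>
    beta_aut (butlast w) = butlast (beta_aut w)" for w
  proof (induction w)
    case (Cons x w)
    then show ?case by (cases x) (auto simp: swap nil)
  qed simp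
  ultimately show "alpha_aut \<in> carrier Aut_T" "beta_aut \<in> carrier Aut_T"
    by (auto simp: Aut_T_def tree_automorphism_def len)
qed

lemma swap_conj_pair_aut: "swap_aut \<circ> pair_aut a b \<circ> swap_aut = pair_aut b a"
proof
  show "(swap_aut \<circ> pair_aut a b \<circ> swap_aut) w = pair_aut b a w" for w
    by (cases w rule: swap_aut.cases) auto
qed


section \<open>The iterated monodromy group of a quadratic polynomial\<close>

definition quad :: "complex \<Rightarrow> complex \<Rightarrow> complex" where
  "quad c z = z^2 + c"

definition critical_orbit :: "complex \<Rightarrow> complex set" where
  "critical_orbit c = {(quad c ^^ n) 0 | n. n \<ge> 1}"

definition img_space :: "complex \<Rightarrow> complex set" where
  "img_space c = UNIV - closure (critical_orbit c)"

text \<open>The tag \<open>s\<close> in \<open>(s, x)\<close> makes the union of the sets of \<open>s\<close>-fold preimages disjoint.\<close>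

definition preimage_tree :: "complex \<Rightarrow> complex \<Rightarrow> (nat \<times> complex) set" where
  "preimage_tree c b = {(s, x). (quad c ^^ s) x = b}"

text \<open>
  An identification of the binary tree with the tree of preimages of \<open>b\<close>: a level-preserving
  bijection that sends the parent of a word to the image under the polynomial.
\<close>

definition tree_identification ::
  "complex \<Rightarrow> complex \<Rightarrow> (letter list \<Rightarrow> nat \<times> complex) \<Rightarrow> bool" where
  "tree_identification c b \<phi> \<longleftrightarrow>
     bij_betw \<phi> UNIV (preimage_tree c b) \<and>
     (\<forall>w. fst (\<phi> w) = length w) \<and>
     (\<forall>w x. snd (\<phi> w) = quad c (snd (\<phi> (w @ [x]))))"

lemma tree_identification_exists:
  assumes "b \<in> img_space c"
  shows "\<exists>\<phi>. tree_identification c b \<phi>"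
proof -
  define step where "step = (\<lambda>x z. if x = Lft then csqrt (z - c) else - csqrt (z - c))"
  define z where "z = (\<lambda>w. fold step w b)"
  define \<phi> where "\<phi> = (\<lambda>w. (length w, z w))"
  have z_snoc: "z (w @ [x]) = step x (z w)" for w x
    by (simp add: z_def)
  have quad_step: "quad c (step x y) = y" for x y
    by (simp add: step_def quad_def)
  have parent: "quad c (z (w @ [x])) = z w" for w x
    by (simp add: z_snoc quad_step)
  have orb: "(quad c ^^ length w) (z w) = b" for w
  proof (induction w rule: rev_induct)
    case Nil
    then show ?case by (simp add: z_def)
  next
    case (snoc x w)
    then show ?case
      using parent[of w x] by (simp add: funpow_swap1)
  qed
  have "z w \<noteq> c" for w
  proof
    assume "z w = c"
    then have "(quad c ^^ Suc (length w)) 0 = b"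
      using orb[of w] by (simp add: funpow_swap1 quad_def)
    then have "b \<in> critical_orbit c"
      unfolding critical_orbit_def
      by (intro CollectI exI[of _ "Suc (length w)"]) auto
    with assms show False
      using closure_subset by (auto simp: img_space_def)
  qed
  then have nz: "csqrt (z w - c) \<noteq> 0" for w
    by simp
  have inj_z: "length v = length w \<Longrightarrow> z v = z w \<Longrightarrow> v = w" for v w
  proof (induction v arbitrary: w rule: rev_induct)
    case Nil
    then show ?case by simp
  next
    case (snoc x v)
    then obtain y u where w: "w = u @ [y]"
      by (metis append_Nil2 append_is_Nil_conv length_0_conv rev_exhaust)
    have "z v = z u"
      using snoc.prems parent unfolding w by metis
    with snoc w have "v = u" by simp
    moreover have "x = y"
    proof (rule ccontr)
      assume "x \<noteq> y"
      with snoc.prems(2) w \<open>v = u\<close> have "csqrt (z u - c) = - csqrt (z u - c)"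
        by (cases x; cases y) (auto simp: z_snoc step_def)
      with nz[of u] show False by simp
    qed
    ultimately show ?case using w by simp
  qed
  have surj_z: "(quad c ^^ s) x = b \<Longrightarrow> \<exists>w. length w = s \<and> z w = x" for s x
  proof (induction s arbitrary: x)
    case 0
    then show ?case by (intro exI[of _ "[]"]) (simp add: z_def)
  next
    case (Suc s)
    then have "(quad c ^^ s) (quad c x) = b"
      by (simp add: funpow_swap1)
    then obtain w where w: "length w = s" "z w = quad c x"
      using Suc.IH by blast
    have "(csqrt (z w - c))\<^sup>2 = x\<^sup>2"
      by (simp add: w quad_def)
    then have "x = csqrt (z w - c) \<or> x = - csqrt (z w - c)"
      by (metis power2_eq_iff)
    then have "z (w @ [Lft]) = x \<or> z (w @ [Rgt]) = x"
      by (auto simp: z_snoc step_def)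
    then show ?case
      using w(1) by (metis length_append_singleton)
  qed
  have "bij_betw \<phi> UNIV (preimage_tree c b)"
    unfolding bij_betw_def
  proof
    show "inj \<phi>"
      using inj_z by (auto intro!: injI simp: \<phi>_def)
    show "range \<phi> = preimage_tree c b"
    proof
      show "range \<phi> \<subseteq> preimage_tree c b"
        using orb by (auto simp: \<phi>_def preimage_tree_def)
      show "preimage_tree c b \<subseteq> range \<phi>"
        using surj_z by (fastforce simp: \<phi>_def preimage_tree_def)
    qed
  qed
  then have "tree_identification c b \<phi>"
    by (auto simp: tree_identification_def \<phi>_def parent)
  then show ?thesis by blast
qed

text \<open>The endpoint of the lift of \<open>\<gamma>\<close> under the \<open>s\<close>-fold iterate starting at \<open>x\<close>.\<close>

definition lift_endpoint :: "complex \<Rightarrow> nat \<Rightarrow> (real \<Rightarrow> complex) \<Rightarrow> complex \<Rightarrow> complex" where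
  "lift_endpoint c s \<gamma> x =
     (THE y. \<exists>h. path h \<and> pathstart h = x \<and> pathfinish h = y \<and>
                 (\<forall>t\<in>{0..1}. (quad c ^^ s) (h t) = \<gamma> t))"

definition monodromy_action ::
  "complex \<Rightarrow> (letter list \<Rightarrow> nat \<times> complex) \<Rightarrow> (real \<Rightarrow> complex) \<Rightarrow> letter list \<Rightarrow> letter list" where
  "monodromy_action c \<phi> \<gamma> w =
     inv_into UNIV \<phi> (length w, lift_endpoint c (length w) \<gamma> (snd (\<phi> w)))"

text \<open>
  The action of a loop depends only on its class in the fundamental group of \<^term>\<open>img_space c\<close>
  at \<open>b\<close>, so the image of the fundamental group is the set of the actions of all loops.
\<close>

definition IMG :: "complex \<Rightarrow> complex \<Rightarrow> (letter list \<Rightarrow> nat \<times> complex) \<Rightarrow> (letter list \<Rightarrow> letter list) set"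
  where
    "IMG c b \<phi> =
       {monodromy_action c \<phi> \<gamma> | \<gamma>.
          path \<gamma> \<and> path_image \<gamma> \<subseteq> img_space c \<and> pathstart \<gamma> = b \<and> pathfinish \<gamma> = b}"


section \<open>Growth of finitely generated groups\<close>

text \<open>A word is a list of pairs \<open>(x, e)\<close>, where \<open>e\<close> says whether the exponent of \<open>x\<close> is 1 or -1.\<close>

definition word_value :: "('a, 'm) monoid_scheme \<Rightarrow> ('a \<times> bool) list \<Rightarrow> 'a" where
  "word_value G xs =
     foldr (\<lambda>(x, e) g. (if e then x else inv\<^bsub>G\<^esub> x) \<otimes>\<^bsub>G\<^esub> g) xs \<one>\<^bsub>G\<^esub>"

text \<open>
  For a finite generating set and positive weights only finitely many words have length below a
  given bound, so the infimum below is attained and the balls counted by \<open>growth\<close> are finite.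
\<close>

definition weighted_length ::
  "('a, 'm) monoid_scheme \<Rightarrow> 'a set \<Rightarrow> ('a \<Rightarrow> real) \<Rightarrow> 'a \<Rightarrow> real" where
  "weighted_length G \<Sigma> wt g =
     Inf {(\<Sum>(x, e)\<leftarrow>xs. wt x) | xs. fst ` set xs \<subseteq> \<Sigma> \<and> word_value G xs = g}"

definition growth ::
  "('a, 'm) monoid_scheme \<Rightarrow> 'a set \<Rightarrow> ('a \<Rightarrow> real) \<Rightarrow> real \<Rightarrow> nat" where
  "growth G \<Sigma> wt r = card {g \<in> carrier G. weighted_length G \<Sigma> wt g \<le> r}"

definition finite_generating_set :: "('a, 'm) monoid_scheme \<Rightarrow> 'a set \<Rightarrow> bool" where
  "finite_generating_set G \<Sigma> \<longleftrightarrow> finite \<Sigma> \<and> \<Sigma> \<subseteq> carrier G \<and> generate G \<Sigma> = carrier G"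

definition has_growth_rate ::
  "('a, 'm) monoid_scheme \<Rightarrow> 'a set \<Rightarrow> ('a \<Rightarrow> real) \<Rightarrow> real \<Rightarrow> bool" where
  "has_growth_rate G \<Sigma> wt l \<longleftrightarrow>
     ((\<lambda>r. real (growth G \<Sigma> wt r) powr (1 / r)) \<longlongrightarrow> l) at_top"

text \<open>
  Whether the growth rate exceeds 1 does not depend on the generating set and the weights; the
  definition asks for all choices, and separately that a finite generating set exists.
\<close>

definition subexponential_growth :: "('a, 'm) monoid_scheme \<Rightarrow> bool" where
  "subexponential_growth G \<longleftrightarrow>
     group G \<and> (\<exists>\<Sigma>. finite_generating_set G \<Sigma>) \<and>
     (\<forall>\<Sigma> wt. finite_generating_set G \<Sigma> \<and> (\<forall>x\<in>\<Sigma>. wt x > 0) \<longrightarrow>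
        (\<exists>l\<le>1. has_growth_rate G \<Sigma> wt l))"

end

theory Submission
  imports Defs
begin

text \<open>
  \<^emph>\<open>Growth.\<close> Give the generators \<open>\<sigma>, \<alpha>, \<beta>\<close> the weights 1, 2, 2. Splitting a word into its two
  sections deletes every \<open>\<sigma>\<close>, turns every \<open>\<beta>\<close> into an \<open>\<alpha>\<close> on one side, and turns every \<open>\<alpha>\<close> into a
  \<open>\<sigma>\<close> on one side and a \<open>\<beta>\<close> on the other. After free cancellation the weight of the two sections
  together is at most the weight of the word, up to the constant 1, and it drops by at least
  one for each place where two equal letters follow each other once the letters \<open>\<beta>\<close> are ignored
  (\<open>weight_sections\<close>). So a word that loses little weight is one in which \<open>\<sigma>\<close> and \<open>\<alpha>\<close> alternate
  almost everywhere. Such alternation is passed on: if \<open>\<sigma>\<close> and \<open>\<alpha>\<close> alternate in a word, then \<open>\<sigma>\<close>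
  and \<open>\<beta>\<close> alternate in its sections, and if \<open>\<sigma>\<close> alternates with both other letters, then \<open>\<alpha>\<close> and
  \<open>\<beta>\<close> alternate in the sections. Hence, if almost no weight is lost at three successive levels, then
  in the second-level sections all three pairs of letters alternate almost everywhere. A reduced word
  in which all pairs alternate is determined by its first two letters, since the sequence
  \<open>\<sigma>\<alpha>\<beta>\<sigma>\<alpha>\<beta>\<dots>\<close> can only reverse its direction at a factor \<open>xyx\<close>, called a turn here. Words with
  few turns form a set of arbitrarily small exponential growth.

  Thus every element is either determined by four words with few turns, or by eight third-level
  sections whose total length is, up to a constant, at most \<open>1 - \<epsilon>\<close> times its own. For the growth series
  \<open>S(x) = \<Sum> x\<^bsup>length g\<^esup>\<close> this gives \<open>S(x) \<le> A(x) + C S(x\<^bsup>1/(1-\<epsilon>)\<^esup>)\<^sup>8\<close> with \<open>A(x)\<close> finite, so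
  convergence for small \<open>x\<close> spreads to all \<open>x < 1\<close> (\<open>growth_series_converges\<close>).

  \<^emph>\<open>Monodromy.\<close> A frame at \<open>z\<close> is a labelling of the tree of preimages of \<open>z\<close> by words; paths transport
  frames. Cut the plane along the three radial half-lines that start at the postcritical points. The
  remaining slit plane is starlike about 0, so a frame at 0 extends to a frame field that is
  invariant under transport within it, and crossing one of the slits multiplies that field by a
  fixed tree automorphism. The two branches of the inverse map send a path across a slit to paths
  that again cross at most one slit each, up to deformation away from the postcritical points.
  Reading off which slits are crossed shows that the three crossing automorphisms satisfy
  the recursion that defines \<open>\<sigma>, \<alpha>, \<beta>\<close> (\<open>crossing_eq_gen_aut\<close>). Following a loop through the slit
  plane and neighbourhoods of the slits, its transport is a product of crossings, and every product
  occurs (\<open>loop_transport_in_I_explicit\<close>, \<open>I_explicit_realized\<close>). A change of base point and of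
  labelling conjugates the group.
\<close>

section \<open>Words in the generators and their sections\<close>

datatype gen = Gs | Ga | Gb

fun gen_aut :: "gen \<Rightarrow> letter list \<Rightarrow> letter list" where
  "gen_aut Gs = swap_aut"
| "gen_aut Ga = alpha_aut"
| "gen_aut Gb = beta_aut"

definition eval_word :: "gen list \<Rightarrow> letter list \<Rightarrow> letter list" where
  "eval_word w = foldr (\<lambda>x g. gen_aut x \<circ> g) w id"

lemma eval_word_simps [simp]:
  "eval_word [] = id" "eval_word (x # w) = gen_aut x \<circ> eval_word w"
  by (simp_all add: eval_word_def)

lemma eval_word_append: "eval_word (u @ v) = eval_word u \<circ> eval_word v"
  by (induction u) (auto simp: comp_assoc)

lemma swap_aut_involution [simp]: "swap_aut (swap_aut w) = w"
  by (cases w rule: swap_aut.cases) auto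

lemma alpha_beta_involution [simp]:
  "alpha_aut (alpha_aut w) = w" "beta_aut (beta_aut w) = w"
  by (induction w rule: alpha_aut_beta_aut.induct) auto

lemma gen_aut_involution: "gen_aut x \<circ> gen_aut x = id"
  by (cases x) (auto simp: fun_eq_iff)

lemma gen_aut_in_Aut_T: "gen_aut x \<in> carrier Aut_T"
  by (cases x) (auto simp: swap_aut_in_Aut_T alpha_beta_aut_in_Aut_T)

lemma comp_in_Aut_T: "f \<in> carrier Aut_T \<Longrightarrow> g \<in> carrier Aut_T \<Longrightarrow> f \<circ> g \<in> carrier Aut_T"
  using monoid.m_closed[OF group.is_monoid[OF group_Aut_T], of f g]
  by (simp only: Aut_T_def monoid.simps partial_object.simps)

lemma id_in_Aut_T: "id \<in> carrier Aut_T"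
  using monoid.one_closed[OF group.is_monoid[OF group_Aut_T]]
  by (simp only: Aut_T_def monoid.simps partial_object.simps)

lemma eval_word_in_Aut_T: "eval_word w \<in> carrier Aut_T"
  by (induction w) (simp_all only: eval_word_simps id_in_Aut_T comp_in_Aut_T gen_aut_in_Aut_T)

lemma eval_word_rev: "eval_word (rev w) \<circ> eval_word w = id"
proof (induction w)
  case (Cons x w)
  have "eval_word (rev (x # w)) \<circ> eval_word (x # w) =
    eval_word (rev w) \<circ> (gen_aut x \<circ> gen_aut x) \<circ> eval_word w"
    by (simp add: eval_word_append comp_assoc)
  also have "\<dots> = eval_word (rev w) \<circ> eval_word w"
    by (simp only: gen_aut_involution comp_id)
  finally show ?case using Cons by (simp only:)
qed simp

lemma inv_Aut_T_eval_word: "inv\<^bsub>Aut_T\<^esub> (eval_word w) = eval_word (rev w)"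
  using eval_word_rev[of w] eval_word_in_Aut_T
  by (intro group.inv_equality[OF group_Aut_T]) (auto simp: Aut_T_def)

text \<open>
  Positive words suffice because the generators are involutions.
\<close>

lemma I_explicit_eq_range: "I_explicit = range eval_word"
proof
  show "I_explicit \<subseteq> range eval_word"
  proof
    fix g assume "g \<in> I_explicit"
    then show "g \<in> range eval_word" unfolding I_explicit_def
    proof (induction rule: generate.induct)
      case one
      have "\<one>\<^bsub>Aut_T\<^esub> = eval_word []" by (simp add: Aut_T_def)
      then show ?case by blast
    next
      case (incl h)
      then obtain x where "h = gen_aut x" by (auto intro: that[of Gs] that[of Ga] that[of Gb])
      then have "h = eval_word [x]" by simp
      then show ?case by blast
    next
      case (inv h)
      then obtain x where "h = gen_aut x" by (auto intro: that[of Gs] that[of Ga] that[of Gb])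
      then have "h = eval_word [x]" by simp
      then show ?case using inv_Aut_T_eval_word by (auto simp del: eval_word_simps)
    next
      case (eng h1 h2)
      then obtain u v where "h1 = eval_word u" "h2 = eval_word v" by blast
      then have "h1 \<otimes>\<^bsub>Aut_T\<^esub> h2 = eval_word (u @ v)"
        by (simp only: Aut_T_def monoid.simps eval_word_append)
      then show ?case by blast
    qed
  qed
  have "eval_word w \<in> I_explicit" for w
  proof (induction w)
    case Nil
    have "\<one>\<^bsub>Aut_T\<^esub> \<in> I_explicit" unfolding I_explicit_def by (rule generate.one)
    then show ?case by (simp only: Aut_T_def monoid.simps eval_word_simps)
  next
    case (Cons x w)
    have "gen_aut x \<in> I_explicit" unfolding I_explicit_def
      by (cases x) (auto intro: generate.incl)
    then have "gen_aut x \<otimes>\<^bsub>Aut_T\<^esub> eval_word w \<in> I_explicit"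
      using Cons unfolding I_explicit_def by (rule generate.eng)
    then show ?case by (simp only: Aut_T_def monoid.simps eval_word_simps)
  qed
  then show "range eval_word \<subseteq> I_explicit" by auto
qed

text \<open>
  The weights are chosen so that a block \<open>\<alpha>\<close>, \<open>\<alpha>\<beta>\<close>, \<open>\<beta>\<alpha>\<close> or \<open>\<beta>\<alpha>\<beta>\<close> together with one adjacent \<open>\<sigma>\<close>
  has exactly the weight of the letters it contributes to the sections, while for any other block
  between two letters \<open>\<sigma>\<close> the sections are lighter after free cancellation.
\<close>

fun gen_weight :: "gen \<Rightarrow> nat" where
  "gen_weight Gs = 1"
| "gen_weight Ga = 2"
| "gen_weight Gb = 2"

definition word_weight :: "gen list \<Rightarrow> nat" where
  "word_weight w = sum_list (map gen_weight w)"

lemma word_weight_simps [simp]: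
  "word_weight [] = 0" "word_weight (x # w) = gen_weight x + word_weight w"
  "word_weight (u @ v) = word_weight u + word_weight v"
  "word_weight (rev w) = word_weight w"
  by (simp_all add: word_weight_def sum_list_rev flip: rev_map)

lemma length_le_word_weight: "length w \<le> word_weight w"
proof (induction w)
  case (Cons x w)
  then show ?case by (cases x) auto
qed simp

fun cancel_cons :: "gen \<Rightarrow> gen list \<Rightarrow> gen list" where
  "cancel_cons x [] = [x]"
| "cancel_cons x (y # w) = (if x = y then w else x # y # w)"

definition free_reduce :: "gen list \<Rightarrow> gen list" where
  "free_reduce w = foldr cancel_cons w []"

lemma free_reduce_simps [simp]:
  "free_reduce [] = []" "free_reduce (x # w) = cancel_cons x (free_reduce w)"
  by (simp_all add: free_reduce_def)

lemma distinct_adj_free_reduce: "distinct_adj (free_reduce w)"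
proof (induction w)
  case (Cons x w)
  then show ?case by (cases "free_reduce w") (auto dest: distinct_adj_ConsD)
qed simp

lemma eval_cancel_cons: "eval_word (cancel_cons x w) = gen_aut x \<circ> eval_word w"
proof (cases w)
  case (Cons y v)
  then show ?thesis using gen_aut_involution[of x] by (auto simp flip: comp_assoc)
qed simp

lemma eval_free_reduce: "eval_word (free_reduce w) = eval_word w"
  by (induction w) (auto simp: eval_cancel_cons)

text \<open>
  The sections are indexed by the subtree in which they end up, with the swap applied first; this
  makes them computable from right to left, a letter \<open>\<sigma>\<close> in front exchanging the two.
\<close>

fun sections :: "gen list \<Rightarrow> gen list \<times> gen list" where
  "sections [] = ([], [])"
| "sections (Gs # w) = (snd (sections w), fst (sections w))"
| "sections (Ga # w) = (Gs # fst (sections w), Gb # snd (sections w))"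
| "sections (Gb # w) = (Ga # fst (sections w), snd (sections w))"

fun swaps :: "gen list \<Rightarrow> bool" where
  "swaps [] = False"
| "swaps (x # w) = ((x = Gs) \<noteq> swaps w)"

lemma pair_aut_comp: "pair_aut a b \<circ> pair_aut c d = pair_aut (a \<circ> c) (b \<circ> d)"
proof
  show "(pair_aut a b \<circ> pair_aut c d) w = pair_aut (a \<circ> c) (b \<circ> d) w" for w
    by (cases "(c, d, w)" rule: pair_aut.cases) auto
qed

lemma swap_comp_pair_aut: "swap_aut \<circ> pair_aut a b = pair_aut b a \<circ> swap_aut"
proof
  show "(swap_aut \<circ> pair_aut a b) w = (pair_aut b a \<circ> swap_aut) w" for w
    by (cases "(a, b, w)" rule: pair_aut.cases) auto
qed

lemma pair_aut_id: "pair_aut id id = id"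
proof (rule ext)
  fix w show "pair_aut id id w = id w"
  proof (cases w)
    case (Cons x v)
    then show ?thesis by (cases x) (simp_all only: pair_aut.simps id_apply)
  qed (simp only: pair_aut.simps id_apply)
qed

lemma eval_word_sections:
  "eval_word w = pair_aut (eval_word (fst (sections w))) (eval_word (snd (sections w)))
     \<circ> (if swaps w then swap_aut else id)"
proof (induction w)
  case Nil
  show ?case by (simp only: eval_word_simps sections.simps swaps.simps fst_conv snd_conv if_False
      pair_aut_id comp_id)
next
  case (Cons x w)
  let ?e = "if swaps w then swap_aut else id"
  let ?l = "eval_word (fst (sections w))" and ?r = "eval_word (snd (sections w))"
  have ev: "eval_word (x # w) = gen_aut x \<circ> pair_aut ?l ?r \<circ> ?e"
    by (simp only: eval_word_simps comp_assoc Cons[symmetric])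
  show ?case
  proof (cases x)
    case Gs
    have "swap_aut \<circ> ?e = (if swaps (Gs # w) then swap_aut else id)"
      by (auto simp: fun_eq_iff)
    then show ?thesis unfolding ev by (simp add: Gs swap_comp_pair_aut comp_assoc)
  next
    case Ga
    have "pair_aut (swap_aut \<circ> ?l) (beta_aut \<circ> ?r) = alpha_aut \<circ> pair_aut ?l ?r"
      by (subst alpha_aut_eq) (simp only: pair_aut_comp)
    then show ?thesis unfolding ev unfolding Ga
      by (simp only: gen_aut.simps sections.simps swaps.simps gen.distinct
          fst_conv snd_conv eval_word_simps simp_thms)
  next
    case Gb
    have "pair_aut (alpha_aut \<circ> ?l) ?r = beta_aut \<circ> pair_aut ?l ?r"
      by (subst beta_aut_eq) (simp only: pair_aut_comp id_comp)
    then show ?thesis unfolding ev unfolding Gb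
      by (simp only: gen_aut.simps sections.simps swaps.simps gen.distinct
          fst_conv snd_conv eval_word_simps simp_thms)
  qed
qed

section \<open>Repeated letters\<close>

definition next_in :: "gen \<Rightarrow> gen \<Rightarrow> gen list \<Rightarrow> gen option" where
  "next_in p q w = find (\<lambda>x. x = p \<or> x = q) w"

lemma next_in_simps [simp]:
  "next_in p q [] = None"
  "next_in p q (x # w) = (if x = p \<or> x = q then Some x else next_in p q w)"
  by (auto simp: next_in_def)

lemma next_in_cases: "next_in p q w = None \<or> next_in p q w = Some p \<or> next_in p q w = Some q"
  by (induction w) auto

text \<open>
  Delete from a word all letters outside \<open>{p, q}\<close>; the number of adjacent equal letters in the result
  measures how far \<open>p\<close> and \<open>q\<close> are from alternating.
\<close>

fun repeats :: "gen \<Rightarrow> gen \<Rightarrow> gen list \<Rightarrow> nat" where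
  "repeats p q [] = 0"
| "repeats p q (x # w) =
     repeats p q w + (if (x = p \<or> x = q) \<and> next_in p q w = Some x then 1 else 0)"

text \<open>
  Cancelling a factor \<open>xx\<close> removes a repetition of \<open>x\<close>. It may also bring two equal letters together,
  but no more than the one removed. For the induction, a change of the first relevant letter has to be
  paid for by a repetition that has already disappeared.
\<close>

lemma repeats_free_reduce_strong:
  "repeats p q (free_reduce w) + (if next_in p q (free_reduce w) \<noteq> next_in p q w then 1 else 0)
     \<le> repeats p q w"
proof (induction w)
  case IH: (Cons x w)
  show ?case
  proof (cases "free_reduce w")
    case Nil
    then show ?thesis using IH by (auto split: if_splits)
  next
    case (Cons y u)
    have "repeats p q (y # u) + (if next_in p q (y # u) \<noteq> next_in p q w then 1 else 0)
      \<le> repeats p q w" using IH unfolding Cons .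
    then show ?thesis unfolding free_reduce_simps Cons
      using next_in_cases[of p q w] next_in_cases[of p q u]
      by (cases "x = y"; cases "y = p \<or> y = q"; cases "x = p \<or> x = q";
        cases "next_in p q w = Some x"; cases "next_in p q w = Some y";
        cases "next_in p q u = Some x") simp_all
  qed
qed simp

lemma repeats_free_reduce: "repeats p q (free_reduce w) \<le> repeats p q w"
  using repeats_free_reduce_strong[of p q w] by linarith

lemma weight_cancel_cons: "word_weight (cancel_cons x w) \<le> gen_weight x + word_weight w"
  by (cases w) auto

text \<open>
  Induction over the word from right to left. An \<open>\<alpha>\<close> adds weight 3 to the sections but only 2 to the
  word. While this debt of 1 is open, the right section begins with \<open>\<beta>\<close>; the next \<open>\<sigma>\<close>,
  whose weight 1 produces nothing, settles it. A second \<open>\<alpha>\<close> in the same block cancels that \<open>\<beta>\<close>, which pays for the debt and for the repetition of \<open>\<alpha>\<close>.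
\<close>

lemma weight_sections_strong:
  fixes w defines "L \<equiv> free_reduce (fst (sections w))" and "R \<equiv> free_reduce (snd (sections w))"
  shows "word_weight L + word_weight R + repeats Gs Ga w +
      (if next_in Gs Ga w = Some Ga \<and> (\<forall>v. R \<noteq> Gb # v) then 1 else 0)
     \<le> word_weight w + (if next_in Gs Ga w = Some Ga \<and> (\<exists>v. R = Gb # v) then 1 else 0)"
  unfolding L_def R_def
proof (induction w)
  case (Cons x w)
  let ?L = "free_reduce (fst (sections w))" and ?R = "free_reduce (snd (sections w))"
  note IH = Cons
  show ?case
  proof (cases x)
    case Gs
    then show ?thesis using IH by (auto split: if_splits)
  next
    case Ga
    have "word_weight (cancel_cons Gs ?L) \<le> 1 + word_weight ?L"
      using weight_cancel_cons[of Gs] by simp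
    then show ?thesis using Ga IH
      by (cases ?R) (auto split: if_splits)
  next
    case Gb
    have "word_weight (cancel_cons Ga ?L) \<le> 2 + word_weight ?L"
      using weight_cancel_cons[of Ga] by simp
    then show ?thesis using Gb IH by (auto split: if_splits)
  qed
qed simp

text \<open>
  Letters \<open>\<beta>\<close> contribute only letters \<open>\<alpha>\<close>, so the positions of \<open>\<sigma>\<close> and \<open>\<beta>\<close> in the sections are
  dictated by \<open>\<sigma>\<close> and \<open>\<alpha>\<close> in the word: each \<open>\<alpha>\<close> puts \<open>\<sigma>\<close> on one side and \<open>\<beta>\<close> on the other, and
  each \<open>\<sigma>\<close> exchanges the sides. Both sides fail to alternate exactly when an even number of \<open>\<sigma>\<close> separates two
  consecutive \<open>\<alpha>\<close>, and then \<open>\<sigma>\<alpha>\<close> has a repetition there. The conditional summand records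
  a repetition that has occurred between the current \<open>\<sigma>\<close> and the following \<open>\<alpha>\<close> but has not yet been used.
\<close>

lemma repeats_Gs_Gb_sections_strong:
  fixes w defines "l \<equiv> next_in Gs Gb (fst (sections w))" and "r \<equiv> next_in Gs Gb (snd (sections w))"
  shows "(l, r) \<in> {(None, None), (Some Gs, Some Gb), (Some Gb, Some Gs)} \<and>
    (next_in Gs Ga w = None \<longrightarrow> l = None) \<and>
    (next_in Gs Ga w = Some Ga \<longrightarrow> l = Some Gs) \<and>
    repeats Gs Gb (fst (sections w)) + (if next_in Gs Ga w = Some Gs \<and> l = Some Gs then 1 else 0)
      \<le> repeats Gs Ga w \<and>
    repeats Gs Gb (snd (sections w)) + (if next_in Gs Ga w = Some Gs \<and> l = Some Gs then 1 else 0)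
      \<le> repeats Gs Ga w"
  unfolding l_def r_def
proof (induction w)
  case (Cons x w)
  show ?case
    using next_in_cases[of Gs Ga w]
    by (elim disjE; use Cons in \<open>cases x; auto\<close>)
qed simp

text \<open>
  The left section receives \<open>\<alpha>\<close> from the letters \<open>\<beta>\<close> of the word that lie in the left phase and
  \<open>\<beta>\<close> from the letters \<open>\<alpha>\<close> that lie in the right phase, the phase changing at every \<open>\<sigma>\<close>. If
  every block between letters \<open>\<sigma>\<close> contains exactly one \<open>\<alpha>\<close> and one \<open>\<beta>\<close>, the two kinds alternate.
  The conditional summands record that the expected letter was missing in a block further to the right.
\<close>

lemma repeats_Ga_Gb_sections_strong:
  fixes w defines "l \<equiv> next_in Ga Gb (fst (sections w))" and "r \<equiv> next_in Ga Gb (snd (sections w))"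
  shows "(next_in Gs Ga w = None \<longrightarrow> r = None) \<and> (next_in Gs Gb w = None \<longrightarrow> l = None) \<and>
    (next_in Gs Ga w = Some Ga \<longrightarrow> r = Some Gb) \<and>
    (next_in Gs Gb w = Some Gb \<longrightarrow> l = Some Ga) \<and>
    repeats Ga Gb (fst (sections w)) + (if next_in Gs Gb w = Some Gs \<and> l = Some Ga then 1 else 0)
      \<le> repeats Gs Ga w + repeats Gs Gb w \<and>
    repeats Ga Gb (snd (sections w)) + (if next_in Gs Ga w = Some Gs \<and> r = Some Gb then 1 else 0)
      \<le> repeats Gs Ga w + repeats Gs Gb w"
  unfolding l_def r_def
proof (induction w)
  case (Cons x w)
  show ?case
    using next_in_cases[of Gs Ga w] next_in_cases[of Gs Gb w]
      next_in_cases[of Ga Gb "fst (sections w)"] next_in_cases[of Ga Gb "snd (sections w)"]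
    by (elim disjE; use Cons in \<open>cases x; simp\<close>)
qed simp

text \<open>
  In a reduced word over three letters, a position is either a turn \<open>xyx\<close> or continues with the third
  letter.
\<close>

fun turns :: "gen list \<Rightarrow> nat" where
  "turns (x # y # z # w) = turns (y # z # w) + (if x = z then 1 else 0)"
| "turns w = 0"

text \<open>
  A turn \<open>xyx\<close> is a repetition of \<open>x\<close> for the pair formed by \<open>x\<close> and the third letter.
\<close>

lemma turns_le_repeats:
  "distinct_adj w \<Longrightarrow> turns w \<le> repeats Gs Ga w + repeats Gs Gb w + repeats Ga Gb w"
proof (induction w rule: turns.induct)
  case (1 x y z w)
  then show ?case by (cases x; cases y; cases z) auto
qed auto

lemma UNIV_gen: "UNIV = {Gs, Ga, Gb}"
  using gen.exhaust by blast

lemma finite_gen: "finite (UNIV :: gen set)"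
  by (simp add: UNIV_gen)

section \<open>Contraction over three levels\<close>

definition section_left :: "gen list \<Rightarrow> gen list" where
  "section_left w = free_reduce (fst (sections w))"

definition section_right :: "gen list \<Rightarrow> gen list" where
  "section_right w = free_reduce (snd (sections w))"

text \<open>
  Composing \<open>split_word\<close> with itself yields nested tuples that hold the words at level 2 or 3 together
  with the permutations on the levels above; \<open>section_total\<close> and \<open>pair_product\<close> are the corresponding
  sums and products over the leaves.
\<close>

definition split_word :: "(gen list \<Rightarrow> 'a) \<Rightarrow> gen list \<Rightarrow> bool \<times> 'a \<times> 'a" where
  "split_word h w = (swaps w, h (section_left w), h (section_right w))"

definition section_total :: "(gen list \<Rightarrow> nat) \<Rightarrow> gen list \<Rightarrow> nat" where
  "section_total f w = f (section_left w) + f (section_right w)"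

definition pair_product :: "('a \<Rightarrow> real) \<Rightarrow> bool \<times> 'a \<times> 'a \<Rightarrow> real" where
  "pair_product F = (\<lambda>(e, a, b). F a * F b)"

text \<open>
  An automorphism is determined by its action on the first level and its two sections.
\<close>

lemma eval_word_eqI_split_word:
  assumes "split_word h v = split_word h w" and h: "\<And>a b. h a = h b \<Longrightarrow> eval_word a = eval_word b"
  shows "eval_word v = eval_word w"
proof -
  have "swaps v = swaps w" "eval_word (section_left v) = eval_word (section_left w)"
    "eval_word (section_right v) = eval_word (section_right w)"
    using assms(1) by (auto simp: split_word_def intro: h)
  then show ?thesis
    using eval_word_sections[of v] eval_word_sections[of w]
    by (simp only: section_left_def section_right_def eval_free_reduce)
qed

lemma pair_product_split_word:
  fixes y :: real
  assumes "\<And>v. F (h v) = y ^ f v * z ^ g v"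
  shows "pair_product F (split_word h w) = y ^ section_total f w * z ^ section_total g w"
  by (simp add: pair_product_def split_word_def section_total_def assms power_add)

lemma weight_sections: "section_total word_weight w + repeats Gs Ga w \<le> word_weight w + 1"
  using weight_sections_strong[of w]
  by (auto simp: section_total_def section_left_def section_right_def split: if_splits)

lemma section_total_mono_add:
  assumes "\<And>v. f v + g v \<le> h v + c"
  shows "section_total f w + section_total g w \<le> section_total h w + 2 * c"
  using assms[of "section_left w"] assms[of "section_right w"] by (simp add: section_total_def)

text \<open>
  A lower bound, up to the constant 7, for the weight that is lost on the way down to level 3.
\<close>

definition gain :: "gen list \<Rightarrow> nat" where
  "gain w = repeats Gs Ga w + section_total (repeats Gs Ga) w + section_total (section_total (repeats Gs Ga)) w"

lemma weight_level2:
  "section_total (section_total word_weight) w + section_total (repeats Gs Ga) w + repeats Gs Ga w \<le> word_weight w + 3"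
proof -
  have "section_total (section_total word_weight) w + section_total (repeats Gs Ga) w \<le> section_total word_weight w + 2 * 1"
    by (intro section_total_mono_add weight_sections)
  with weight_sections[of w] show ?thesis by linarith
qed

lemma weight_level3: "section_total (section_total (section_total word_weight)) w + gain w \<le> word_weight w + 7"
proof -
  have "section_total (section_total (section_total word_weight)) w + section_total (section_total (repeats Gs Ga)) w
    \<le> section_total (section_total word_weight) w + 2 * (2 * 1)"
    by (intro section_total_mono_add weight_sections)
  with weight_level2[of w] show ?thesis unfolding gain_def by linarith
qed

lemma repeats_Gs_Gb_sections:
  "repeats Gs Gb (section_left w) \<le> repeats Gs Ga w" "repeats Gs Gb (section_right w) \<le> repeats Gs Ga w"
  using repeats_Gs_Gb_sections_strong[of w] repeats_free_reduce[of Gs Gb "fst (sections w)"]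
    repeats_free_reduce[of Gs Gb "snd (sections w)"]
  unfolding section_left_def section_right_def by linarith+

lemma repeats_Ga_Gb_sections:
  "repeats Ga Gb (section_left w) \<le> repeats Gs Ga w + repeats Gs Gb w"
  "repeats Ga Gb (section_right w) \<le> repeats Gs Ga w + repeats Gs Gb w"
  using repeats_Ga_Gb_sections_strong[of w] repeats_free_reduce[of Ga Gb "fst (sections w)"]
    repeats_free_reduce[of Ga Gb "snd (sections w)"]
  unfolding section_left_def section_right_def by linarith+

lemma turns_sections:
  "turns (section_left u) \<le> repeats Gs Ga (section_left u) + 2 * repeats Gs Ga u + repeats Gs Gb u"
  "turns (section_right u) \<le> repeats Gs Ga (section_right u) + 2 * repeats Gs Ga u + repeats Gs Gb u"
  using turns_le_repeats[of "section_left u"] turns_le_repeats[of "section_right u"]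
    repeats_Ga_Gb_sections[of u] repeats_Gs_Gb_sections[of u]
    distinct_adj_free_reduce[of "fst (sections u)"] distinct_adj_free_reduce[of "snd (sections u)"]
  unfolding section_left_def[symmetric] section_right_def[symmetric] by linarith+

text \<open>
  Each of the repetitions counted by \<open>gain\<close> is responsible for at most four turns, because a
  repetition at level 0 is felt in all four sections at level 2.
\<close>

lemma turns_level2: "section_total (section_total turns) w \<le> 4 * gain w"
proof -
  let ?l = "section_left w" and ?r = "section_right w"
  show ?thesis
    using turns_sections[of ?l] turns_sections[of ?r] repeats_Gs_Gb_sections[of w]
    unfolding gain_def section_total_def by (simp add: algebra_simps)
qed

section \<open>Summation over sets of elements and of words\<close>

definition sums_bounded :: "('a \<Rightarrow> real) \<Rightarrow> 'a set \<Rightarrow> real \<Rightarrow> bool" where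
  "sums_bounded F S K \<longleftrightarrow> (\<forall>x\<in>S. 0 \<le> F x) \<and> (\<forall>A. finite A \<longrightarrow> A \<subseteq> S \<longrightarrow> sum F A \<le> K)"

lemma sums_bounded_pair_product:
  assumes "sums_bounded F S K"
  shows "sums_bounded (pair_product F) (UNIV \<times> S \<times> S) (2 * K^2)"
  unfolding sums_bounded_def
proof (intro conjI ballI allI impI)
  have nn: "0 \<le> F x" if "x \<in> S" for x using assms that by (auto simp: sums_bounded_def)
  show "0 \<le> pair_product F n" if "n \<in> UNIV \<times> S \<times> S" for n
    using that nn by (auto simp: pair_product_def)
  fix N :: "(bool \<times> 'a \<times> 'a) set" assume N: "finite N" "N \<subseteq> UNIV \<times> S \<times> S"
  define A where "A = (fst \<circ> snd) ` N \<union> (snd \<circ> snd) ` N"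
  have A: "finite A" "A \<subseteq> S" using N by (auto simp: A_def)
  have sub: "N \<subseteq> UNIV \<times> A \<times> A" by (force simp: A_def)
  have "sum (pair_product F) N \<le> sum (pair_product F) (UNIV \<times> A \<times> A)"
    using sub A nn by (intro sum_mono2) (auto simp: pair_product_def intro!: mult_nonneg_nonneg)
  also have "\<dots> = (\<Sum>e\<in>(UNIV :: bool set). \<Sum>p\<in>A \<times> A. F (fst p) * F (snd p))"
    by (simp only: pair_product_def sum.cartesian_product case_prod_unfold)
  also have "\<dots> = 2 * (\<Sum>p\<in>A \<times> A. F (fst p) * F (snd p))"
    by (simp add: UNIV_bool)
  also have "(\<Sum>p\<in>A \<times> A. F (fst p) * F (snd p)) = (sum F A)^2"
    by (simp only: sum_product power2_eq_square sum.cartesian_product case_prod_unfold)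
  also have "2 * (sum F A)^2 \<le> 2 * K^2"
  proof -
    have "sum F A \<le> K" using assms A unfolding sums_bounded_def by blast
    moreover have "0 \<le> sum F A" using A nn by (intro sum_nonneg) auto
    ultimately show ?thesis by (simp add: power_mono)
  qed
  finally show "sum (pair_product F) N \<le> 2 * K^2" .
qed

lemma sums_bounded_subset: "sums_bounded F S K \<Longrightarrow> T \<subseteq> S \<Longrightarrow> sums_bounded F T K"
  unfolding sums_bounded_def by blast

lemma sums_bounded_inj:
  assumes "sums_bounded F S K" "inj_on t A" "t ` A \<subseteq> S" "c \<ge> 0"
    and "\<And>a. a \<in> A \<Longrightarrow> 0 \<le> f a \<and> f a \<le> c * F (t a)"
  shows "sums_bounded f A (c * K)"
  unfolding sums_bounded_def
proof (intro conjI ballI allI impI)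
  fix B assume B: "finite B" "B \<subseteq> A"
  have "sum f B \<le> (\<Sum>a\<in>B. c * F (t a))"
    using B assms(5) by (intro sum_mono) auto
  also have "\<dots> = c * sum F (t ` B)"
    using B inj_on_subset[OF assms(2)] by (simp add: sum_distrib_left sum.reindex)
  also have "\<dots> \<le> c * K"
  proof (rule mult_left_mono[OF _ assms(4)])
    have "finite (t ` B)" "t ` B \<subseteq> S" using B assms(3) by auto
    then show "sum F (t ` B) \<le> K" using assms(1) unfolding sums_bounded_def by blast
  qed
  finally show "sum f B \<le> c * K" .
qed (use assms(5) in auto)

lemma sums_bounded_Un:
  assumes "sums_bounded F S K" "sums_bounded F T M"
  shows "sums_bounded F (S \<union> T) (K + M)"
  unfolding sums_bounded_def
proof (intro conjI ballI allI impI)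
  fix A assume A: "finite A" "A \<subseteq> S \<union> T"
  have "sum F A = sum F (A \<inter> S) + sum F (A - S)"
    using A(1) by (metis Diff_Diff_Int Diff_subset sum.subset_diff add.commute)
  also have "\<dots> \<le> K + M"
    using assms A unfolding sums_bounded_def by (intro add_mono) (auto simp: Diff_subset_conv)
  finally show "sum F A \<le> K + M" .
qed (use assms in \<open>auto simp: sums_bounded_def\<close>)

definition reduced_words :: "nat \<Rightarrow> gen list set" where
  "reduced_words n = {w. distinct_adj w \<and> length w = n}"

lemma finite_reduced_words: "finite (reduced_words n)"
  using finite_lists_length_eq[OF finite_gen, of n]
  by (rule finite_subset[rotated]) (auto simp: reduced_words_def)

text \<open>
  In front of a reduced word of length at least 2 there are two choices: one creates a turn, the other
  does not.
\<close>

lemma turns_generating_step: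
  fixes z :: real
  assumes z: "0 \<le> z" and n: "n \<ge> 2"
  shows "(\<Sum>v\<in>reduced_words (Suc n). z ^ turns v) = (1 + z) * (\<Sum>v\<in>reduced_words n. z ^ turns v)"
proof -
  have eq: "reduced_words (Suc n) = (\<lambda>(v, x). x # v) ` (SIGMA v:reduced_words n. - {hd v})"
  proof (rule Set.set_eqI)
    fix w
    show "w \<in> reduced_words (Suc n) \<longleftrightarrow> w \<in> (\<lambda>(v, x). x # v) ` (SIGMA v:reduced_words n. - {hd v})"
    proof (cases w)
      case (Cons x v)
      then show ?thesis using n
        by (cases v) (auto simp: reduced_words_def image_iff)
    qed (auto simp: reduced_words_def)
  qed
  have "(\<Sum>v\<in>reduced_words (Suc n). z ^ turns v) =
    (\<Sum>v\<in>reduced_words n. \<Sum>x\<in>- {hd v}. z ^ turns (x # v))"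
    unfolding eq
    by (subst sum.reindex, force simp: inj_on_def, subst sum.Sigma)
      (auto simp: finite_reduced_words case_prod_beta intro: finite_subset[OF _ finite_gen])
  also have "\<dots> = (\<Sum>v\<in>reduced_words n. (1 + z) * z ^ turns v)"
  proof (rule sum.cong[OF refl])
    fix v assume "v \<in> reduced_words n"
    then obtain a b u where v: "v = a # b # u" "a \<noteq> b"
      using n by (cases v; cases "tl v") (auto simp: reduced_words_def)
    have "- {a} \<noteq> {}" by (cases a) auto
    obtain c where c: "- {a} = {b, c}" "b \<noteq> c"
    proof -
      have U: "UNIV = {Gs, Ga, Gb}" by (rule UNIV_gen)
      consider "a = Gs" "b = Ga" | "a = Gs" "b = Gb" | "a = Ga" "b = Gs" | "a = Ga" "b = Gb"
        | "a = Gb" "b = Gs" | "a = Gb" "b = Ga"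
        using v(2) by (cases a; cases b) auto
      then show ?thesis
      proof cases
        case 1 then show ?thesis using that[of Gb] U by auto
      next
        case 2 then show ?thesis using that[of Ga] U by auto
      next
        case 3 then show ?thesis using that[of Gb] U by auto
      next
        case 4 then show ?thesis using that[of Gs] U by auto
      next
        case 5 then show ?thesis using that[of Ga] U by auto
      next
        case 6 then show ?thesis using that[of Gs] U by auto
      qed
    qed
    show "(\<Sum>x\<in>- {hd v}. z ^ turns (x # v)) = (1 + z) * z ^ turns v"
      using c(2) by (simp add: v(1) c(1) algebra_simps)
  qed
  finally show ?thesis by (simp add: sum_distrib_left)
qed

lemma turns_generating_bound:
  fixes z :: real
  assumes "0 \<le> z" "z \<le> 1"
  shows "(\<Sum>v\<in>reduced_words n. z ^ turns v) \<le> 9 * (1 + z) ^ n"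
proof (induction n)
  case base: 0
  have "reduced_words 0 = {[]}" by (auto simp: reduced_words_def)
  then show ?case by simp
next
  case (Suc n)
  show ?case
  proof (cases "n \<ge> 2")
    case True
    then show ?thesis
      using Suc assms by (simp add: turns_generating_step mult.left_commute)
  next
    case False
    have "card (reduced_words (Suc n)) \<le> card {w :: gen list. set w \<subseteq> UNIV \<and> length w = Suc n}"
      using finite_lists_length_eq[OF finite_gen, of "Suc n"]
      by (intro card_mono) (auto simp: reduced_words_def)
    also have "\<dots> = 3 ^ Suc n"
    proof -
      have "card (UNIV :: gen set) = 3" by (simp add: UNIV_gen)
      then show ?thesis using card_lists_length_eq[OF finite_gen, of "Suc n"] by simp
    qed
    also have "(3::nat) ^ Suc n \<le> 3 ^ 2"
      using False by (intro power_increasing) auto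
    finally have card: "card (reduced_words (Suc n)) \<le> 9" by simp
    have "(\<Sum>v\<in>reduced_words (Suc n). z ^ turns v) \<le> (\<Sum>v\<in>reduced_words (Suc n). 1)"
      using assms by (intro sum_mono power_le_one) auto
    also have "\<dots> \<le> 9 * 1" using card by simp
    also have "\<dots> \<le> 9 * (1 + z) ^ Suc n"
      using assms by (intro mult_left_mono one_le_power) auto
    finally show ?thesis .
  qed
qed

text \<open>
  For small \<open>z\<close> the factor \<open>z\<close> per turn makes the series converge for \<open>y\<close> close to 1: words with few
  turns have small exponential growth.
\<close>

lemma reduced_words_sums_bounded:
  fixes y z :: real
  assumes y: "0 < y" "y < 1" and z: "0 \<le> z" "z \<le> 1" and yz: "(1 + z) * y < 1"
  shows "\<exists>K. sums_bounded (\<lambda>w. y ^ word_weight w * z ^ turns w) {w. distinct_adj w} K"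
proof (intro exI)
  let ?F = "\<lambda>w. y ^ word_weight w * z ^ turns w" and ?q = "(1 + z) * y"
  have q: "0 \<le> ?q" using y z by simp
  show "sums_bounded ?F {w. distinct_adj w} (9 * (1 / (1 - ?q)))"
    unfolding sums_bounded_def
  proof (intro conjI ballI allI impI)
    fix A :: "gen list set" assume A: "finite A" "A \<subseteq> {w. distinct_adj w}"
    define N where "N = Max (insert 0 (length ` A))"
    have len: "length w \<le> N" if "w \<in> A" for w
      using A that by (auto simp: N_def)
    have "sum ?F A \<le> sum ?F (\<Union>n\<in>{..N}. reduced_words n)"
    proof (rule sum_mono2)
      show "finite (\<Union>n\<in>{..N}. reduced_words n)" by (simp add: finite_reduced_words)
      show "A \<subseteq> (\<Union>n\<in>{..N}. reduced_words n)" using A len by (auto simp: reduced_words_def)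
    qed (use y z in auto)
    also have "\<dots> = (\<Sum>n\<le>N. sum ?F (reduced_words n))"
      by (rule sum.UNION_disjoint) (auto simp: finite_reduced_words, auto simp: reduced_words_def)
    also have "\<dots> \<le> (\<Sum>n\<le>N. 9 * ?q ^ n)"
    proof (rule sum_mono)
      fix n
      have "sum ?F (reduced_words n) \<le> (\<Sum>w\<in>reduced_words n. y ^ n * z ^ turns w)"
        using length_le_word_weight y z
        by (intro sum_mono mult_right_mono power_decreasing) (auto simp: reduced_words_def)
      also have "\<dots> \<le> y ^ n * (9 * (1 + z) ^ n)"
        using turns_generating_bound[OF z, of n] y by (simp flip: sum_distrib_left)
      finally show "sum ?F (reduced_words n) \<le> 9 * ?q ^ n"
        by (simp add: power_mult_distrib mult_ac)
    qed
    also have "\<dots> = 9 * (\<Sum>n\<le>N. ?q ^ n)" by (simp add: sum_distrib_left)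
    also have "(\<Sum>n\<le>N. ?q ^ n) \<le> (\<Sum>n. ?q ^ n)"
      using q yz by (intro sum_le_suminf summable_geometric) auto
    also have "\<dots> = 1 / (1 - ?q)" using q yz by (intro suminf_geometric) auto
    finally show "sum ?F A \<le> 9 * (1 / (1 - ?q))" by simp
  qed (use y z in auto)
qed

section \<open>Convergence of the growth series\<close>

definition weight_length :: "(letter list \<Rightarrow> letter list) \<Rightarrow> nat" where
  "weight_length g = (LEAST n. \<exists>w. eval_word w = g \<and> word_weight w = n)"

lemma weight_length_le: "weight_length (eval_word w) \<le> word_weight w"
  unfolding weight_length_def by (rule Least_le) blast

lemma ex_minimal_word:
  assumes "g \<in> I_explicit"
  shows "\<exists>w. eval_word w = g \<and> word_weight w = weight_length g"
proof -
  obtain w where "eval_word w = g" using assms by (auto simp: I_explicit_eq_range)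
  then have "\<exists>n. \<exists>w. eval_word w = g \<and> word_weight w = n" by blast
  then show ?thesis unfolding weight_length_def by (rule LeastI_ex)
qed

lemma weight_free_reduce: "word_weight (free_reduce w) \<le> word_weight w"
proof (induction w)
  case (Cons x w)
  then show ?case using weight_cancel_cons[of x "free_reduce w"] by simp
qed simp

definition minimal_word :: "(letter list \<Rightarrow> letter list) \<Rightarrow> gen list" where
  "minimal_word g = (SOME w. eval_word w = g \<and> word_weight w = weight_length g \<and> distinct_adj w)"

lemma minimal_word_props:
  assumes "g \<in> I_explicit"
  shows "eval_word (minimal_word g) = g" "word_weight (minimal_word g) = weight_length g"
    "distinct_adj (minimal_word g)"
proof -
  obtain w where w: "eval_word w = g" "word_weight w = weight_length g"
    using ex_minimal_word[OF assms] by blast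
  have "eval_word (free_reduce w) = g" using w by (simp only: eval_free_reduce)
  moreover from this have "word_weight (free_reduce w) = weight_length g"
    using w weight_free_reduce[of w] weight_length_le[of "free_reduce w"] by auto
  ultimately have "\<exists>w. eval_word w = g \<and> word_weight w = weight_length g \<and> distinct_adj w"
    using distinct_adj_free_reduce by blast
  then have "eval_word (minimal_word g) = g \<and> word_weight (minimal_word g) = weight_length g \<and>
    distinct_adj (minimal_word g)"
    unfolding minimal_word_def by (rule someI_ex)
  then show "eval_word (minimal_word g) = g" "word_weight (minimal_word g) = weight_length g"
    "distinct_adj (minimal_word g)" by auto
qed

lemma inj_on_minimal_word: "inj_on minimal_word I_explicit"
  by (rule inj_onI) (metis minimal_word_props(1))

definition growth_series_converges :: "real \<Rightarrow> bool" where
  "growth_series_converges x \<longleftrightarrow> (\<exists>K. sums_bounded (\<lambda>g. x ^ weight_length g) I_explicit K)"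

text \<open>
  There are at most \<open>3 \<sdot> 2\<^bsup>n-1\<^esup>\<close> reduced words of positive length \<open>n\<close>, which is the bound on turns with \<open>z = 1\<close>.
\<close>

lemma growth_series_converges_small:
  assumes "0 < x" "x < 1/2"
  shows "growth_series_converges x"
proof -
  obtain K where "sums_bounded (\<lambda>w. x ^ word_weight w * 1 ^ turns w) {w. distinct_adj w} K"
    using reduced_words_sums_bounded[of x 1] assms by auto
  then have "sums_bounded (\<lambda>g. x ^ weight_length g) I_explicit (1 * K)"
    using assms minimal_word_props
    by (intro sums_bounded_inj[OF _ inj_on_minimal_word]) auto
  then show ?thesis by (auto simp: growth_series_converges_def)
qed

lemma section_total_mono: "(\<And>v. f v \<le> g v) \<Longrightarrow> section_total f w \<le> section_total g w"
  by (simp add: section_total_def add_mono)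

lemma eval_word_in_I_explicit: "eval_word w \<in> I_explicit"
  by (simp add: I_explicit_eq_range)

text \<open>
  An element whose eight third-level sections have total length at most \<open>(1 - \<epsilon>) n + 7\<close> contributes
  no more, up to a constant, than the product of the eight contributions of the sections at the smaller
  argument \<open>x\<^bsup>1/(1-\<epsilon>)\<^esup>\<close>.
\<close>

lemma contracting_elements_bounded:
  fixes x \<epsilon> :: real
  assumes x: "0 < x" "x < 1" and e: "0 < \<epsilon>" "\<epsilon> < 1"
    and conv: "growth_series_converges (x powr (1 / (1 - \<epsilon>)))"
  shows "\<exists>K. sums_bounded (\<lambda>g. x ^ weight_length g)
      {g \<in> I_explicit. \<epsilon> * weight_length g \<le> gain (minimal_word g)} K"
proof -
  define X where "X = x powr (1 / (1 - \<epsilon>))"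
  have X: "0 < X" "X \<le> 1" using x e by (auto simp: X_def powr_le1)
  let ?F = "\<lambda>g. X ^ weight_length g * 1 ^ weight_length g"
  obtain K where "sums_bounded ?F I_explicit K"
    using conv by (auto simp: growth_series_converges_def X_def)
  note K = sums_bounded_pair_product[OF sums_bounded_pair_product[OF sums_bounded_pair_product[OF this]]]
  let ?h = "split_word (split_word (split_word eval_word))"
  let ?A = "{g \<in> I_explicit. \<epsilon> * weight_length g \<le> gain (minimal_word g)}"
  have "sums_bounded (\<lambda>g. x ^ weight_length g) ?A (inverse (X ^ 7) * (2 * (2 * (2 * K\<^sup>2)\<^sup>2)\<^sup>2))"
  proof (rule sums_bounded_inj[OF K, where t = "\<lambda>g. ?h (minimal_word g)"])
    show "inj_on (\<lambda>g. ?h (minimal_word g)) ?A"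
    proof (rule inj_onI)
      fix g g' assume gg: "g \<in> ?A" "g' \<in> ?A" "?h (minimal_word g) = ?h (minimal_word g')"
      from gg(3) have "eval_word (minimal_word g) = eval_word (minimal_word g')"
        by (rule eval_word_eqI_split_word) (erule eval_word_eqI_split_word, erule eval_word_eqI_split_word)
      then show "g = g'" using gg(1,2) minimal_word_props(1) by simp
    qed
    show "(\<lambda>g. ?h (minimal_word g)) ` ?A \<subseteq>
      UNIV \<times> (UNIV \<times> (UNIV \<times> I_explicit \<times> I_explicit) \<times> UNIV \<times> I_explicit \<times> I_explicit) \<times>
      UNIV \<times> (UNIV \<times> I_explicit \<times> I_explicit) \<times> UNIV \<times> I_explicit \<times> I_explicit"
      by (auto simp: split_word_def eval_word_in_I_explicit)
    show "0 \<le> inverse (X ^ 7)" using X by simp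
    fix g assume "g \<in> ?A"
    then have g: "g \<in> I_explicit" "\<epsilon> * weight_length g \<le> gain (minimal_word g)" by auto
    let ?w = "minimal_word g" and ?n = "weight_length g"
    let ?T = "section_total (section_total (section_total (weight_length \<circ> eval_word)))"
    have F: "pair_product (pair_product (pair_product ?F)) (?h ?w) = X ^ ?T ?w * 1 ^ ?T ?w"
      by (intro pair_product_split_word) simp
    have "?T ?w \<le> section_total (section_total (section_total word_weight)) ?w"
      by (intro section_total_mono) (simp add: weight_length_le)
    then have "?T ?w + gain ?w \<le> ?n + 7"
      using weight_level3[of ?w] minimal_word_props(2)[OF g(1)] by simp
    then have "real (?T ?w) \<le> (1 - \<epsilon>) * ?n + 7"
      using g(2) by (simp add: algebra_simps flip: of_nat_add)
    then have "X powr ((1 - \<epsilon>) * ?n + 7) \<le> X powr real (?T ?w)"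
      using X by (intro powr_mono') auto
    also have "X powr ((1 - \<epsilon>) * ?n + 7) = x ^ ?n * X ^ 7"
    proof -
      have "X powr ((1 - \<epsilon>) * ?n) = x powr ?n" using e by (simp add: X_def powr_powr)
      moreover have "X powr 7 = X ^ 7" using X by (simp add: powr_numeral)
      ultimately show ?thesis using x by (simp add: powr_add powr_realpow)
    qed
    also have "X powr real (?T ?w) = X ^ ?T ?w"
      using X by (simp add: powr_realpow)
    finally show "0 \<le> x ^ ?n \<and>
      x ^ ?n \<le> inverse (X ^ 7) * pair_product (pair_product (pair_product ?F)) (?h ?w)"
      unfolding F using x X by (simp add: field_simps)
  qed
  then show ?thesis by blast
qed

text \<open>
  An element that does not contract is determined by four reduced words at level 2 with total weight
  at most \<open>n + 3\<close> and at most \<open>4 \<epsilon> n\<close> turns. With \<open>x = y\<^sup>2\<close>, one factor \<open>y\<^sup>n\<close> is spent on the weights and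
  the other one on the turns.
\<close>

lemma noncontracting_elements_bounded:
  fixes x :: real
  assumes x: "0 < x" "x < 1"
  shows "\<exists>\<epsilon>::real. 0 < \<epsilon> \<and> \<epsilon> < 1 \<and> (\<exists>K. sums_bounded (\<lambda>g. x ^ weight_length g)
      {g \<in> I_explicit. gain (minimal_word g) < \<epsilon> * weight_length g} K)"
proof -
  define y where "y = sqrt x"
  \<comment> \<open>the penalty per turn, small enough for \<open>(1 + z) y < 1\<close>\<close>
  define z where "z = (1 - y) / 2"
  have y: "0 < y" "y < 1" and xy: "x = y * y" using x by (auto simp: y_def)
  have z: "0 < z" "z < 1" using y by (auto simp: z_def)
  have "(1 + z) * y = y + y * (1 - y) / 2" by (simp add: z_def field_simps)
  also have "y * (1 - y) / 2 < 1 - y"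
    using y mult_strict_right_mono[of "y / 2" 1 "1 - y"] by simp
  finally have yz: "(1 + z) * y < 1" by simp
  \<comment> \<open>chosen so that \<open>y \<le> z\<^bsup>4 \<epsilon>\<^esup>\<close>, since an element has at most \<open>4 \<epsilon> n\<close> turns\<close>
  define \<epsilon> where "\<epsilon> = min (1/2) (ln y / (4 * ln z))"
  have e: "0 < \<epsilon>" "\<epsilon> < 1" using y z by (auto simp: \<epsilon>_def zero_less_divide_iff)
  have "\<epsilon> \<le> ln y / (4 * ln z)" by (simp add: \<epsilon>_def)
  then have "ln y \<le> 4 * \<epsilon> * ln z" using z by (simp add: field_simps)
  then have ze: "y \<le> z powr (4 * \<epsilon>)"
    using y z by (simp add: powr_def) (metis exp_le_cancel_iff exp_ln)
  let ?F = "\<lambda>w. y ^ word_weight w * z ^ turns w"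
  obtain K where "sums_bounded ?F {w. distinct_adj w} K"
    using reduced_words_sums_bounded[of y z] y z yz by auto
  note K = sums_bounded_pair_product[OF sums_bounded_pair_product[OF this]]
  let ?h = "split_word (split_word id)"
  let ?A = "{g \<in> I_explicit. gain (minimal_word g) < \<epsilon> * weight_length g}"
  have "sums_bounded (\<lambda>g. x ^ weight_length g) ?A (inverse (y ^ 3) * (2 * (2 * K\<^sup>2)\<^sup>2))"
  proof (rule sums_bounded_inj[OF K, where t = "\<lambda>g. ?h (minimal_word g)"])
    show "inj_on (\<lambda>g. ?h (minimal_word g)) ?A"
    proof (rule inj_onI)
      fix g g' assume gg: "g \<in> ?A" "g' \<in> ?A" "?h (minimal_word g) = ?h (minimal_word g')"
      from gg(3) have "eval_word (minimal_word g) = eval_word (minimal_word g')"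
        by (rule eval_word_eqI_split_word) (erule eval_word_eqI_split_word, simp)
      then show "g = g'" using gg(1,2) minimal_word_props(1) by simp
    qed
    show "(\<lambda>g. ?h (minimal_word g)) ` ?A \<subseteq>
      UNIV \<times> (UNIV \<times> {w. distinct_adj w} \<times> {w. distinct_adj w}) \<times> UNIV \<times> {w. distinct_adj w} \<times> {w. distinct_adj w}"
      by (auto simp: split_word_def section_left_def section_right_def distinct_adj_free_reduce)
    show "0 \<le> inverse (y ^ 3)" using y by simp
    fix g assume "g \<in> ?A"
    then have g: "g \<in> I_explicit" "gain (minimal_word g) < \<epsilon> * weight_length g" by auto
    let ?w = "minimal_word g" and ?n = "weight_length g"
    let ?T = "section_total (section_total turns)" and ?W = "section_total (section_total word_weight)"
    have F: "pair_product (pair_product ?F) (?h ?w) = y ^ ?W ?w * z ^ ?T ?w"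
      by (intro pair_product_split_word) simp
    have W: "?W ?w \<le> ?n + 3"
      using weight_level2[of ?w] minimal_word_props(2)[OF g(1)] by simp
    have "real (?T ?w) \<le> 4 * gain ?w" using turns_level2[of ?w] by (simp flip: of_nat_mult)
    then have T: "real (?T ?w) \<le> 4 * \<epsilon> * ?n" using g(2) by linarith
    have "y ^ ?n = y powr ?n" using y by (simp add: powr_realpow)
    also have "\<dots> \<le> (z powr (4 * \<epsilon>)) powr ?n" using ze y by (intro powr_mono2) auto
    also have "\<dots> = z powr (4 * \<epsilon> * ?n)" by (simp add: powr_powr)
    also have "\<dots> \<le> z powr (?T ?w)" using T z by (intro powr_mono') auto
    also have "\<dots> = z ^ ?T ?w" using z by (simp add: powr_realpow)
    finally have "y ^ ?n \<le> z ^ ?T ?w" .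
    moreover have "y ^ (?n + 3) \<le> y ^ ?W ?w" using W y by (intro power_decreasing) auto
    ultimately have "y ^ (?n + 3) * y ^ ?n \<le> y ^ ?W ?w * z ^ ?T ?w"
      using y by (intro mult_mono) auto
    then have "x ^ ?n * y ^ 3 \<le> y ^ ?W ?w * z ^ ?T ?w"
      by (simp add: xy power_mult_distrib power_add mult_ac)
    then show "0 \<le> x ^ ?n \<and> x ^ ?n \<le> inverse (y ^ 3) * pair_product (pair_product ?F) (?h ?w)"
      unfolding F using x y by (simp add: field_simps)
  qed
  with e show ?thesis by blast
qed

text \<open>
  The same \<open>\<epsilon>\<close> serves all smaller arguments, because the contribution of the noncontracting
  elements only decreases with the argument. This uniformity lets the step be iterated.
\<close>

lemma growth_series_step:
  fixes x :: real
  assumes x: "0 < x" "x < 1"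
  obtains \<epsilon> :: real where "0 < \<epsilon>" "\<epsilon> < 1"
    "\<And>x'. 0 < x' \<Longrightarrow> x' \<le> x \<Longrightarrow> growth_series_converges (x' powr (1 / (1 - \<epsilon>))) \<Longrightarrow> growth_series_converges x'"
proof -
  obtain \<epsilon> K :: real where e: "0 < \<epsilon>" "\<epsilon> < 1" and K: "sums_bounded (\<lambda>g. x ^ weight_length g)
      {g \<in> I_explicit. gain (minimal_word g) < \<epsilon> * weight_length g} K"
    using noncontracting_elements_bounded[OF x] by (elim exE conjE) (rule that)
  have "growth_series_converges x'"
    if x': "0 < x'" "x' \<le> x" and c: "growth_series_converges (x' powr (1 / (1 - \<epsilon>)))" for x'
  proof -
    have "sums_bounded (\<lambda>g. x' ^ weight_length g)
      {g \<in> I_explicit. gain (minimal_word g) < \<epsilon> * weight_length g} (1 * K)"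
    proof (rule sums_bounded_inj[OF K, of id])
      fix g
      have "x' ^ weight_length g \<le> x ^ weight_length g" using x' by (intro power_mono) auto
      then show "0 \<le> x' ^ weight_length g \<and> x' ^ weight_length g \<le> 1 * x ^ weight_length (id g)"
        using x' by simp
    qed simp_all
    moreover obtain M where "sums_bounded (\<lambda>g. x' ^ weight_length g)
      {g \<in> I_explicit. \<epsilon> * weight_length g \<le> gain (minimal_word g)} M"
      using contracting_elements_bounded[OF x'(1) _ e(1) e(2) c] x' x by auto
    ultimately have "sums_bounded (\<lambda>g. x' ^ weight_length g)
      ({g \<in> I_explicit. gain (minimal_word g) < \<epsilon> * weight_length g} \<union>
       {g \<in> I_explicit. \<epsilon> * weight_length g \<le> gain (minimal_word g)}) (1 * K + M)"
      by (rule sums_bounded_Un)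
    then show ?thesis unfolding growth_series_converges_def
      by (intro exI) (erule sums_bounded_subset, auto)
  qed
  with e show thesis by (rule that)
qed

text \<open>
  The arguments \<open>x\<^bsup>r^k\<^esup>\<close> with \<open>r = 1/(1 - \<epsilon>)\<close> tend to 0 and eventually enter the range where the
  series is known to converge; the step leads back from there to \<open>x\<close>.
\<close>

lemma growth_series_converges:
  fixes x :: real
  assumes x: "0 < x" "x < 1"
  shows "growth_series_converges x"
proof -
  obtain \<epsilon> :: real where e: "0 < \<epsilon>" "\<epsilon> < 1" and step:
    "\<And>x'. 0 < x' \<Longrightarrow> x' \<le> x \<Longrightarrow> growth_series_converges (x' powr (1 / (1 - \<epsilon>))) \<Longrightarrow> growth_series_converges x'"
    using growth_series_step[OF x] by blast
  define r where "r = 1 / (1 - \<epsilon>)"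
  have r: "r > 1" using e by (simp add: r_def)
  have pos: "0 < x powr (r ^ k)" and le: "x powr (r ^ k) \<le> x" for k
  proof -
    show "0 < x powr (r ^ k)" using x by simp
    have "x powr (r ^ k) \<le> x powr 1"
      using x r by (intro powr_mono') (auto intro: one_le_power)
    then show "x powr (r ^ k) \<le> x" using x by simp
  qed
  have "growth_series_converges (x powr (r ^ k)) \<Longrightarrow> growth_series_converges x" for k
  proof (induction k)
    case 0
    then show ?case using x by simp
  next
    case (Suc k)
    have "(x powr (r ^ k)) powr r = x powr (r ^ Suc k)" by (simp add: powr_powr mult.commute)
    with Suc show ?case using step[OF pos le, of k] by (simp add: r_def)
  qed
  moreover have "\<exists>k. x powr (r ^ k) < 1/2"
  proof -
    obtain k where k: "ln (1/2) / ln x < r ^ k"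
      using real_arch_pow[OF r] by blast
    then have "r ^ k * ln x < ln (1/2)" using x by (simp add: field_simps)
    then have "exp (r ^ k * ln x) < exp (ln (1/2))" by (simp only: exp_less_cancel_iff)
    then show ?thesis using x by (auto simp: powr_def)
  qed
  ultimately show ?thesis using growth_series_converges_small pos by blast
qed

lemma finite_ball: "finite {g \<in> I_explicit. weight_length g \<le> n}"
proof (rule finite_surj)
  show "finite {w :: gen list. set w \<subseteq> UNIV \<and> length w \<le> n}"
    by (rule finite_lists_length_le[OF finite_gen])
  show "{g \<in> I_explicit. weight_length g \<le> n} \<subseteq> eval_word ` {w. set w \<subseteq> UNIV \<and> length w \<le> n}"
  proof
    fix g assume "g \<in> {g \<in> I_explicit. weight_length g \<le> n}"
    then show "g \<in> eval_word ` {w. set w \<subseteq> UNIV \<and> length w \<le> n}"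
      using minimal_word_props[of g] length_le_word_weight[of "minimal_word g"]
      by (intro image_eqI[of _ _ "minimal_word g"]) auto
  qed
qed

theorem card_ball_subexponential:
  fixes c :: real
  assumes "c > 1"
  shows "\<exists>C. \<forall>n. real (card {g \<in> I_explicit. weight_length g \<le> n}) \<le> C * c ^ n"
proof -
  define x where "x = 1 / c"
  have x: "0 < x" "x < 1" using assms by (auto simp: x_def)
  obtain K where K: "sums_bounded (\<lambda>g. x ^ weight_length g) I_explicit K"
    using growth_series_converges[OF x] by (auto simp: growth_series_converges_def)
  show ?thesis
  proof (intro exI allI)
    fix n
    let ?B = "{g \<in> I_explicit. weight_length g \<le> n}"
    have "real (card ?B) * x ^ n \<le> (\<Sum>g\<in>?B. x ^ weight_length g)"
      using x by (subst sum_constant[symmetric], intro sum_mono) (auto intro: power_decreasing)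
    also have "\<dots> \<le> K" using K finite_ball[of n] by (auto simp: sums_bounded_def)
    finally show "real (card ?B) \<le> K * c ^ n"
      using assms by (simp add: x_def field_simps)
  qed
qed

section \<open>Growth rates from a subadditive length\<close>

lemma word_value_Nil [simp]: "word_value G [] = \<one>\<^bsub>G\<^esub>"
  by (simp add: word_value_def)

lemma word_value_Cons [simp]:
  "word_value G ((x, e) # xs) = (if e then x else inv\<^bsub>G\<^esub> x) \<otimes>\<^bsub>G\<^esub> word_value G xs"
  by (simp add: word_value_def)

lemma (in group) word_value_closed:
  "fst ` set xs \<subseteq> \<Sigma> \<Longrightarrow> \<Sigma> \<subseteq> carrier G \<Longrightarrow> word_value G xs \<in> carrier G"
  by (induction xs) (auto split: prod.splits)

lemma (in group) word_value_append:
  assumes "\<Sigma> \<subseteq> carrier G" "fst ` set xs \<subseteq> \<Sigma>" "fst ` set ys \<subseteq> \<Sigma>"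
  shows "word_value G (xs @ ys) = word_value G xs \<otimes> word_value G ys"
  using assms
proof (induction xs)
  case (Cons p xs)
  obtain x e where p: "p = (x, e)" by (cases p)
  have "word_value G xs \<in> carrier G" "word_value G ys \<in> carrier G"
    using Cons.prems by (auto intro: word_value_closed)
  then show ?case using Cons by (auto simp: p m_assoc)
next
  case Nil
  then have "word_value G ys \<in> carrier G" by (intro word_value_closed[of ys \<Sigma>]) auto
  then show ?case by simp
qed

text \<open>
  Guarantees that the infimum that defines the weighted length is taken over a nonempty set.
\<close>

lemma (in group) generate_imp_word_value:
  assumes "\<Sigma> \<subseteq> carrier G" "g \<in> generate G \<Sigma>"
  shows "\<exists>xs. fst ` set xs \<subseteq> \<Sigma> \<and> word_value G xs = g"
  using assms(2)
proof (induction rule: generate.induct)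
  case one
  show ?case by (intro exI[of _ "[]"]) simp
next
  case (incl h)
  then show ?case using assms(1) by (intro exI[of _ "[(h, True)]"]) auto
next
  case (inv h)
  then show ?case using assms(1) by (intro exI[of _ "[(h, False)]"]) auto
next
  case (eng h1 h2)
  then obtain xs ys where "fst ` set xs \<subseteq> \<Sigma>" "word_value G xs = h1" "fst ` set ys \<subseteq> \<Sigma>" "word_value G ys = h2"
    by blast
  then show ?case
    using word_value_append[OF assms(1), of xs ys] by (intro exI[of _ "xs @ ys"]) auto
qed

text \<open>
  A subadditive length is dominated by the weighted length for any finite generating set. The slack
  \<open>r + 1\<close> avoids having to attain the infimum.
\<close>

lemma (in group) subadditive_length_le_weighted_length:
  fixes L :: "'a \<Rightarrow> nat"
  assumes fin: "finite_generating_set G \<Sigma>" and wt: "\<And>x. x \<in> \<Sigma> \<Longrightarrow> wt x > 0"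
    and one: "L \<one> = 0" and mult: "\<And>g h. g \<in> carrier G \<Longrightarrow> h \<in> carrier G \<Longrightarrow> L (g \<otimes> h) \<le> L g + L h"
    and inv: "\<And>g. g \<in> carrier G \<Longrightarrow> L (inv g) \<le> L g"
  shows "\<exists>M::real. M > 0 \<and>
    (\<forall>g r. g \<in> carrier G \<longrightarrow> weighted_length G \<Sigma> wt g \<le> r \<longrightarrow> real (L g) \<le> M * (r + 1))"
proof -
  have sub: "\<Sigma> \<subseteq> carrier G" and f: "finite \<Sigma>" and gen: "generate G \<Sigma> = carrier G"
    using fin by (auto simp: finite_generating_set_def)
  define M where "M = Max (insert 1 ((\<lambda>x. real (L x) / wt x) ` \<Sigma>))"
  have M: "M > 0" using f by (auto simp: M_def Max_gr_iff)
  have gen_le: "real (L x) \<le> M * wt x" if "x \<in> \<Sigma>" for x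
  proof -
    have "real (L x) / wt x \<le> M" using f that by (auto simp: M_def)
    then show ?thesis using wt[OF that] by (simp add: field_simps)
  qed
  have word_le: "fst ` set xs \<subseteq> \<Sigma> \<Longrightarrow> real (L (word_value G xs)) \<le> M * (\<Sum>(x, e)\<leftarrow>xs. wt x)" for xs
  proof (induction xs)
    case (Cons p xs)
    obtain x e where p: "p = (x, e)" by (cases p)
    let ?y = "if e then x else inv x"
    have x: "x \<in> \<Sigma>" "x \<in> carrier G" and cl: "word_value G xs \<in> carrier G"
      using Cons.prems sub word_value_closed[of xs \<Sigma>] by (auto simp: p)
    have "L (word_value G (p # xs)) \<le> L ?y + L (word_value G xs)"
      using x cl by (auto simp: p intro!: mult)
    moreover have "L ?y \<le> L x" using inv x by auto
    ultimately show ?case using Cons gen_le[OF x(1)] by (simp add: p distrib_left)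
  qed (simp add: one)
  have "real (L g) \<le> M * (r + 1)" if g: "g \<in> carrier G" "weighted_length G \<Sigma> wt g \<le> r" for g r
  proof -
    let ?S = "{(\<Sum>(x, e)\<leftarrow>xs. wt x) |xs. fst ` set xs \<subseteq> \<Sigma> \<and> word_value G xs = g}"
    have "?S \<noteq> {}" using generate_imp_word_value[OF sub] g gen by blast
    moreover have "Inf ?S < r + 1" using g by (simp add: weighted_length_def)
    ultimately have "\<exists>s\<in>?S. s < r + 1" by (rule cInf_lessD)
    then obtain xs where xs: "fst ` set xs \<subseteq> \<Sigma>" "word_value G xs = g" "(\<Sum>(x, e)\<leftarrow>xs. wt x) < r + 1"
      by fast
    then have "real (L g) \<le> M * (\<Sum>(x, e)\<leftarrow>xs. wt x)" using word_le by blast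
    also have "\<dots> \<le> M * (r + 1)" using xs M by (intro mult_left_mono) auto
    finally show ?thesis .
  qed
  with M show ?thesis by (intro exI[of _ M]) simp
qed

lemma (in group) weighted_length_one_le:
  assumes "\<And>x. x \<in> \<Sigma> \<Longrightarrow> wt x > 0"
  shows "weighted_length G \<Sigma> wt \<one> \<le> 0"
  unfolding weighted_length_def
proof (rule cInf_lower)
  show "0 \<in> {(\<Sum>(x, e)\<leftarrow>xs. wt x) |xs. fst ` set xs \<subseteq> \<Sigma> \<and> word_value G xs = \<one>}"
    by (intro CollectI exI[of _ "[]"]) simp
  show "bdd_below {(\<Sum>(x, e)\<leftarrow>xs. wt x) |xs. fst ` set xs \<subseteq> \<Sigma> \<and> word_value G xs = \<one>}"
    unfolding bdd_below_def
  proof (intro exI[of _ 0] ballI)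
    fix s assume "s \<in> {(\<Sum>(x, e)\<leftarrow>xs. wt x) |xs. fst ` set xs \<subseteq> \<Sigma> \<and> word_value G xs = \<one>}"
    then obtain xs :: "('a \<times> bool) list" where xs: "s = (\<Sum>(x, e)\<leftarrow>xs. wt x)" "fst ` set xs \<subseteq> \<Sigma>"
      by blast
    have "0 \<le> (case p of (x, e) \<Rightarrow> wt x)" if "p \<in> set xs" for p
      using assms[of "fst p"] xs(2) that by (cases p) force
    then show "0 \<le> s" unfolding xs(1) by (intro sum_list_nonneg) auto
  qed
qed

lemma root_of_subexponential_tendsto_1:
  fixes f :: "real \<Rightarrow> real"
  assumes ge: "\<And>r. r \<ge> 0 \<Longrightarrow> f r \<ge> 1"
    and le: "\<And>d. d > 1 \<Longrightarrow> \<exists>C>0. \<forall>r\<ge>0. f r \<le> C * d powr r"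
  shows "((\<lambda>r. f r powr (1 / r)) \<longlongrightarrow> 1) at_top"
proof (rule order_tendstoI)
  fix a :: real assume "a < 1"
  have "eventually (\<lambda>r::real. r > 0) at_top" by (rule eventually_gt_at_top)
  then show "eventually (\<lambda>r. a < f r powr (1 / r)) at_top"
  proof eventually_elim
    case (elim r)
    then have "1 \<le> f r powr (1 / r)" using ge[of r] by (intro ge_one_powr_ge_zero) auto
    with \<open>a < 1\<close> show ?case by linarith
  qed
next
  fix a :: real assume a: "1 < a"
  define d where "d = (1 + a) / 2"
  have d: "1 < d" "d < a" using a by (auto simp: d_def)
  obtain C where C: "C > 0" "\<And>r. r \<ge> 0 \<Longrightarrow> f r \<le> C * d powr r" using le[OF d(1)] by blast
  have "((\<lambda>r::real. 1 / r) \<longlongrightarrow> 0) at_top"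
    by (intro tendsto_divide_0[OF tendsto_const] filterlim_at_top_imp_at_infinity filterlim_ident)
  then have "((\<lambda>r. C powr (1 / r) * d) \<longlongrightarrow> C powr 0 * d) at_top"
    using C(1) by (intro tendsto_intros) auto
  then have "eventually (\<lambda>r. C powr (1 / r) * d < a) at_top"
    using C(1) d by (intro order_tendstoD(2)) auto
  moreover have "eventually (\<lambda>r::real. r > 0) at_top" by (rule eventually_gt_at_top)
  ultimately show "eventually (\<lambda>r. f r powr (1 / r) < a) at_top"
  proof eventually_elim
    case (elim r)
    have "f r powr (1 / r) \<le> (C * d powr r) powr (1 / r)"
      using elim ge[of r] C(2)[of r] by (intro powr_mono2) auto
    also have "\<dots> = C powr (1 / r) * d"
      using elim C(1) d by (simp add: powr_mult powr_powr)
    finally show ?case using elim by linarith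
  qed
qed

text \<open>
  The growth rate is exactly 1: it is at least 1 because balls contain the identity, and at most 1 by
  comparison with the balls of \<open>L\<close>.
\<close>

theorem (in group) subexponential_growthI:
  fixes L :: "'a \<Rightarrow> nat"
  assumes gen: "finite_generating_set G \<Sigma>'"
    and one: "L \<one> = 0" and mult: "\<And>g h. g \<in> carrier G \<Longrightarrow> h \<in> carrier G \<Longrightarrow> L (g \<otimes> h) \<le> L g + L h"
    and inv: "\<And>g. g \<in> carrier G \<Longrightarrow> L (inv g) \<le> L g"
    and fin: "\<And>n. finite {g \<in> carrier G. L g \<le> n}"
    and ball: "\<And>c::real. c > 1 \<Longrightarrow> \<exists>C. \<forall>n. real (card {g \<in> carrier G. L g \<le> n}) \<le> C * c ^ n"
  shows "subexponential_growth G"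
  unfolding subexponential_growth_def
proof (intro conjI allI impI, rule group_axioms, rule exI[of _ \<Sigma>'], rule gen)
  fix \<Sigma> :: "'a set" and wt :: "'a \<Rightarrow> real"
  assume "finite_generating_set G \<Sigma> \<and> (\<forall>x\<in>\<Sigma>. wt x > 0)"
  then have \<Sigma>: "finite_generating_set G \<Sigma>" and wt: "\<And>x. x \<in> \<Sigma> \<Longrightarrow> wt x > 0" by auto
  obtain M :: real where M: "M > 0"
    "\<And>g r. g \<in> carrier G \<Longrightarrow> weighted_length G \<Sigma> wt g \<le> r \<Longrightarrow> real (L g) \<le> M * (r + 1)"
    using subadditive_length_le_weighted_length[of \<Sigma> wt L, OF \<Sigma> wt one mult inv] by auto
  define N where "N r = nat \<lfloor>M * (r + 1)\<rfloor>" for r :: real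
  have sub: "{g \<in> carrier G. weighted_length G \<Sigma> wt g \<le> r} \<subseteq> {g \<in> carrier G. L g \<le> N r}" for r
    using M(2) by (auto simp: N_def le_nat_floor)
  have "((\<lambda>r. real (growth G \<Sigma> wt r) powr (1 / r)) \<longlongrightarrow> 1) at_top"
  proof (rule root_of_subexponential_tendsto_1)
    fix r :: real assume "r \<ge> 0"
    have "finite {g \<in> carrier G. weighted_length G \<Sigma> wt g \<le> r}"
      using sub fin by (rule finite_subset)
    moreover have "\<one> \<in> {g \<in> carrier G. weighted_length G \<Sigma> wt g \<le> r}"
      using weighted_length_one_le[of \<Sigma> wt, OF wt] \<open>r \<ge> 0\<close> by auto
    ultimately have "growth G \<Sigma> wt r > 0"
      unfolding growth_def by (subst card_gt_0_iff) blast
    then show "real (growth G \<Sigma> wt r) \<ge> 1" by linarith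
  next
    fix d :: real assume d: "d > 1"
    define c where "c = d powr (1 / M)"
    have c: "c > 1" using d M(1) by (auto simp: c_def intro: gr_one_powr)
    obtain C where C: "\<And>n. real (card {g \<in> carrier G. L g \<le> n}) \<le> C * c ^ n" using ball[OF c] by blast
    show "\<exists>C>0. \<forall>r\<ge>0. real (growth G \<Sigma> wt r) \<le> C * d powr r"
    proof (intro exI[of _ "(\<bar>C\<bar> + 1) * d"] conjI allI impI)
      fix r :: real assume r: "r \<ge> 0"
      have "real (growth G \<Sigma> wt r) \<le> real (card {g \<in> carrier G. L g \<le> N r})"
        unfolding growth_def using sub fin by (auto intro: card_mono)
      also have "\<dots> \<le> C * c ^ N r" by (rule C)
      also have "\<dots> \<le> (\<bar>C\<bar> + 1) * c ^ N r" using c by (intro mult_right_mono) auto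
      also have "\<dots> \<le> (\<bar>C\<bar> + 1) * (d * d powr r)"
      proof (rule mult_left_mono)
        have "c ^ N r = c powr real (N r)" using c by (simp add: powr_realpow)
        also have "\<dots> \<le> c powr (M * (r + 1))"
          using c M(1) r by (intro powr_mono) (auto simp: N_def)
        also have "\<dots> = d * d powr r" using M(1) d by (simp add: c_def powr_powr powr_add)
        finally show "c ^ N r \<le> d * d powr r" .
      qed simp
      finally show "real (growth G \<Sigma> wt r) \<le> (\<bar>C\<bar> + 1) * d * d powr r" by (simp add: mult_ac)
    qed (use d in auto)
  qed
  then show "\<exists>l\<le>1. has_growth_rate G \<Sigma> wt l" by (auto simp: has_growth_rate_def)
qed

section \<open>The growth of conjugates of the explicit group\<close>

lemma weight_length_id: "weight_length id = 0"
  using weight_length_le[of "[]"] by simp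

lemma weight_length_comp:
  assumes "g \<in> I_explicit" "h \<in> I_explicit"
  shows "weight_length (g \<circ> h) \<le> weight_length g + weight_length h"
proof -
  have "g \<circ> h = eval_word (minimal_word g @ minimal_word h)"
    by (simp only: eval_word_append minimal_word_props(1) assms)
  then have "weight_length (g \<circ> h) \<le> word_weight (minimal_word g @ minimal_word h)"
    using weight_length_le by metis
  then show ?thesis using minimal_word_props(2) assms by simp
qed

lemma weight_length_inv:
  assumes "g \<in> I_explicit"
  shows "weight_length (inv\<^bsub>Aut_T\<^esub> g) \<le> weight_length g"
proof -
  have "inv\<^bsub>Aut_T\<^esub> g = eval_word (rev (minimal_word g))"
    using inv_Aut_T_eval_word[of "minimal_word g"] minimal_word_props(1)[OF assms] by simp
  then have "weight_length (inv\<^bsub>Aut_T\<^esub> g) \<le> word_weight (rev (minimal_word g))"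
    using weight_length_le by metis
  then show ?thesis using minimal_word_props(2)[OF assms] by simp
qed

lemma Aut_T_mult [simp]: "f \<otimes>\<^bsub>Aut_T\<^esub> g = f \<circ> g" and Aut_T_one: "\<one>\<^bsub>Aut_T\<^esub> = id"
  by (simp_all add: Aut_T_def)

lemma inv_Aut_T:
  assumes "\<tau> \<in> carrier Aut_T"
  shows "inv\<^bsub>Aut_T\<^esub> \<tau> = inv_into UNIV \<tau>"
proof -
  have b: "bij \<tau>" using assms by (auto simp: Aut_T_def tree_automorphism_def)
  have "inv\<^bsub>Aut_T\<^esub> \<tau> \<circ> \<tau> = id"
    using group.l_inv[OF group_Aut_T assms] by (simp only: Aut_T_mult Aut_T_one)
  then have "inv\<^bsub>Aut_T\<^esub> \<tau> \<circ> \<tau> \<circ> inv_into UNIV \<tau> = inv_into UNIV \<tau>" by (simp only: id_comp)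
  then show ?thesis using b by (simp only: comp_assoc surj_iff[THEN iffD1] bij_is_surj comp_id)
qed

text \<open>
  The length is pulled back along the conjugation, which is an isomorphism onto the conjugate group.
\<close>

theorem conjugate_subexponential_growth:
  assumes \<tau>: "\<tau> \<in> carrier Aut_T"
  shows "subexponential_growth (Aut_T\<lparr>carrier := (\<lambda>g. \<tau> \<circ> g \<circ> inv_into UNIV \<tau>) ` I_explicit\<rparr>)"
proof -
  interpret A: group Aut_T by (rule group_Aut_T)
  let ?i = "inv_into UNIV \<tau>"
  define c where "c g = \<tau> \<circ> g \<circ> ?i" for g
  define c' where "c' g = ?i \<circ> g \<circ> \<tau>" for g
  have b: "bij \<tau>" using \<tau> by (auto simp: Aut_T_def tree_automorphism_def)
  have it: "?i \<circ> \<tau> = id" "\<tau> \<circ> ?i = id"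
    using b by (simp_all add: inj_iff[THEN iffD1] bij_is_inj surj_iff[THEN iffD1] bij_is_surj)
  have i: "?i \<in> carrier Aut_T" using A.inv_closed[OF \<tau>] inv_Aut_T[OF \<tau>] by simp
  have c'c: "c' (c g) = g" for g
  proof -
    have "c' (c g) = (?i \<circ> \<tau>) \<circ> g \<circ> (?i \<circ> \<tau>)" by (simp only: c_def c'_def comp_assoc)
    then show ?thesis by (simp only: it id_comp comp_id)
  qed
  have cm: "c (g \<circ> h) = c g \<circ> c h" for g h
  proof -
    have "c g \<circ> c h = \<tau> \<circ> g \<circ> (?i \<circ> \<tau>) \<circ> h \<circ> ?i" by (simp only: c_def comp_assoc)
    then show ?thesis by (simp only: it comp_id c_def comp_assoc)
  qed
  have hom: "group_hom Aut_T Aut_T c"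
    using comp_in_Aut_T[OF comp_in_Aut_T[OF \<tau>] i]
    unfolding group_hom_def group_hom_axioms_def hom_def
    by (simp add: A.group_axioms cm Pi_iff flip: c_def)
  interpret H: group_hom Aut_T Aut_T c by (rule hom)
  let ?gens = "{swap_aut, alpha_aut, beta_aut}" and ?S = "c ` I_explicit"
  have gens: "?gens \<subseteq> carrier Aut_T"
    using swap_aut_in_Aut_T alpha_beta_aut_in_Aut_T by auto
  have S: "?S = generate Aut_T (c ` ?gens)"
    unfolding I_explicit_def by (rule H.generate_img[OF gens, symmetric])
  have subI: "I_explicit \<subseteq> carrier Aut_T"
    unfolding I_explicit_def by (rule A.generate_incl[OF gens])
  have cgens: "c ` ?gens \<subseteq> carrier Aut_T" using gens H.hom_closed by blast
  have sg: "subgroup ?S Aut_T" unfolding S by (rule A.generate_is_subgroup[OF cgens])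
  have sgI: "subgroup I_explicit Aut_T" unfolding I_explicit_def by (rule A.generate_is_subgroup[OF gens])
  interpret G: group "Aut_T\<lparr>carrier := ?S\<rparr>" by (rule subgroup.subgroup_is_group[OF sg A.group_axioms])
  have inj: "inj_on c I_explicit" using c'c by (metis inj_onI)
  have "subexponential_growth (Aut_T\<lparr>carrier := ?S\<rparr>)"
  proof (rule G.subexponential_growthI[where L = "\<lambda>g. weight_length (c' g)" and \<Sigma>' = "c ` ?gens"])
    have "c ` ?gens \<subseteq> ?S" unfolding S by (auto intro: generate.incl)
    then show "finite_generating_set (Aut_T\<lparr>carrier := ?S\<rparr>) (c ` ?gens)"
      unfolding finite_generating_set_def using A.generate_consistent[OF _ sg] S by simp
    have one: "\<one>\<^bsub>Aut_T\<lparr>carrier := ?S\<rparr>\<^esub> = c id"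
      using it by (simp add: Aut_T_one c_def)
    show "weight_length (c' \<one>\<^bsub>Aut_T\<lparr>carrier := ?S\<rparr>\<^esub>) = 0"
      unfolding one by (simp only: c'c weight_length_id)
    fix g assume g: "g \<in> carrier (Aut_T\<lparr>carrier := ?S\<rparr>)"
    then obtain g0 where g0: "g0 \<in> I_explicit" "g = c g0" by auto
    have "inv\<^bsub>Aut_T\<lparr>carrier := ?S\<rparr>\<^esub> g = inv\<^bsub>Aut_T\<^esub> g" using g by (simp add: A.m_inv_consistent[OF sg])
    also have "\<dots> = c (inv\<^bsub>Aut_T\<^esub> g0)" using g0 subI by (auto simp: H.hom_inv)
    finally have "c' (inv\<^bsub>Aut_T\<lparr>carrier := ?S\<rparr>\<^esub> g) = inv\<^bsub>Aut_T\<^esub> g0" by (simp only: c'c)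
    then show "weight_length (c' (inv\<^bsub>Aut_T\<lparr>carrier := ?S\<rparr>\<^esub> g)) \<le> weight_length (c' g)"
      using weight_length_inv[OF g0(1)] by (simp only: g0(2) c'c)
    fix h assume h: "h \<in> carrier (Aut_T\<lparr>carrier := ?S\<rparr>)"
    then obtain h0 where h0: "h0 \<in> I_explicit" "h = c h0" by auto
    have "g \<otimes>\<^bsub>Aut_T\<lparr>carrier := ?S\<rparr>\<^esub> h = c (g0 \<circ> h0)" by (simp add: g0(2) h0(2) cm)
    then have "c' (g \<otimes>\<^bsub>Aut_T\<lparr>carrier := ?S\<rparr>\<^esub> h) = g0 \<circ> h0" by (simp only: c'c)
    then show "weight_length (c' (g \<otimes>\<^bsub>Aut_T\<lparr>carrier := ?S\<rparr>\<^esub> h)) \<le> weight_length (c' g) + weight_length (c' h)"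
      using weight_length_comp[OF g0(1) h0(1)] by (simp only: g0(2) h0(2) c'c)
  next
    have ball: "{g \<in> carrier (Aut_T\<lparr>carrier := ?S\<rparr>). weight_length (c' g) \<le> n} =
      c ` {g \<in> I_explicit. weight_length g \<le> n}" for n
      by (auto simp: c'c)
    show "finite {g \<in> carrier (Aut_T\<lparr>carrier := ?S\<rparr>). weight_length (c' g) \<le> n}" for n
      unfolding ball using finite_ball by simp
    have card: "card {g \<in> carrier (Aut_T\<lparr>carrier := ?S\<rparr>). weight_length (c' g) \<le> n} =
      card {g \<in> I_explicit. weight_length g \<le> n}" for n
      unfolding ball by (rule card_image) (rule inj_on_subset[OF inj], auto)
    show "\<exists>C. \<forall>n. real (card {g \<in> carrier (Aut_T\<lparr>carrier := ?S\<rparr>). weight_length (c' g) \<le> n}) \<le> C * q ^ n"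
      if "q > 1" for q :: real
      unfolding card using card_ball_subexponential[OF that] .
  qed
  then show ?thesis by (simp only: c_def[abs_def])
qed

theorem I_explicit_subexponential_growth: "subexponential_growth (Aut_T\<lparr>carrier := I_explicit\<rparr>)"
proof -
  have "(\<lambda>g. id \<circ> g \<circ> inv_into UNIV id) ` I_explicit = I_explicit"
    by (simp only: inv_id id_comp comp_id image_ident)
  then show ?thesis using conjugate_subexponential_growth[OF id_in_Aut_T] by simp
qed

section \<open>Lifting paths through iterates of the polynomial\<close>

lemma covering_space_restrict_open:
  assumes cov: "covering_space c p S" and S': "openin (top_of_set S) S'"
  shows "covering_space (c \<inter> p -` S') p S'"
proof
  have sub: "S' \<subseteq> S" using S' by (rule openin_imp_subset)
  show "continuous_on (c \<inter> p -` S') p"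
    using covering_space_imp_continuous[OF cov] by (rule continuous_on_subset) auto
  show "p ` (c \<inter> p -` S') = S'"
    using covering_space_imp_surjective[OF cov] sub by blast
  fix x assume x: "x \<in> S'"
  then obtain T v where T: "x \<in> T" "openin (top_of_set S) T" and v: "\<Union>v = c \<inter> p -` T"
    "\<And>u. u \<in> v \<Longrightarrow> openin (top_of_set c) u" "pairwise disjnt v" "\<And>u. u \<in> v \<Longrightarrow> \<exists>q. homeomorphism u T p q"
    using cov[unfolded covering_space_def, THEN conjunct2, THEN conjunct2, rule_format, OF subsetD[OF sub x]]
    by (elim exE conjE) (rule that, auto)
  let ?v = "(\<lambda>u. u \<inter> p -` S') ` v"
  have "openin (top_of_set S') (T \<inter> S')"
    using openin_Int[OF T(2) S'] by (rule openin_subset_trans) (auto simp: sub)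
  moreover have "\<Union>?v = (c \<inter> p -` S') \<inter> p -` (T \<inter> S')" using v(1) by blast
  moreover have "openin (top_of_set (c \<inter> p -` S')) u'" if u': "u' \<in> ?v" for u'
  proof -
    obtain u where u: "u \<in> v" "u' = u \<inter> p -` S'" using u' by blast
    have "u \<subseteq> c" using openin_imp_subset[OF v(2)[OF u(1)]] .
    then have "u' = (c \<inter> p -` S') \<inter> u" using u(2) by blast
    then show ?thesis using v(2)[OF u(1)] by (auto simp: openin_open)
  qed
  moreover have "pairwise disjnt ?v"
    using v(3) unfolding pairwise_def disjnt_def by blast
  moreover have "\<exists>q. homeomorphism u' (T \<inter> S') p q" if u': "u' \<in> ?v" for u'
  proof -
    obtain u where u: "u \<in> v" "u' = u \<inter> p -` S'" using u' by blast
    obtain q where q: "homeomorphism u T p q" using v(4)[OF u(1)] by blast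
    have "p ` u' = T \<inter> S'" using homeomorphism_image1[OF q] u(2) by blast
    then have "homeomorphism u' (T \<inter> S') p q"
      using q u(2) by (intro homeomorphism_of_subsets[OF q]) auto
    then show ?thesis by blast
  qed
  ultimately show "\<exists>T. x \<in> T \<and> openin (top_of_set S') T \<and>
      (\<exists>v. \<Union>v = (c \<inter> p -` S') \<inter> p -` T \<and> (\<forall>u\<in>v. openin (top_of_set (c \<inter> p -` S')) u) \<and>
        pairwise disjnt v \<and> (\<forall>u\<in>v. \<exists>q. homeomorphism u T p q))"
    using T(1) x by (intro exI[of _ "T \<inter> S'"] conjI exI[of _ ?v]) auto
qed

lemma covering_space_translation:
  fixes p :: "'a::topological_space \<Rightarrow> 'b::real_normed_vector"
  assumes cov: "covering_space c p S"
  shows "covering_space c (\<lambda>z. a + p z) ((+) a ` S)"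
proof
  show "continuous_on c (\<lambda>z. a + p z)"
    by (intro continuous_intros covering_space_imp_continuous[OF cov])
  show "(\<lambda>z. a + p z) ` c = (+) a ` S"
    using covering_space_imp_surjective[OF cov] by auto
  fix x assume "x \<in> (+) a ` S"
  then obtain x0 where x0: "x0 \<in> S" "x = a + x0" by blast
  then obtain T v where T: "x0 \<in> T" "openin (top_of_set S) T" and v: "\<Union>v = c \<inter> p -` T"
    "\<And>u. u \<in> v \<Longrightarrow> openin (top_of_set c) u" "pairwise disjnt v" "\<And>u. u \<in> v \<Longrightarrow> \<exists>q. homeomorphism u T p q"
    using cov[unfolded covering_space_def, THEN conjunct2, THEN conjunct2, rule_format, OF x0(1)]
    by (elim exE conjE) (rule that, auto)
  obtain U where U: "open U" "T = S \<inter> U" using T(2) by (auto simp: openin_open)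
  have "openin (top_of_set ((+) a ` S)) ((+) a ` T)"
    unfolding openin_open using open_translation[OF U(1), of a] U(2) by (intro exI[of _ "(+) a ` U"]) auto
  moreover have "\<Union>v = c \<inter> (\<lambda>z. a + p z) -` ((+) a ` T)" using v(1) by auto
  moreover have "\<exists>q. homeomorphism u ((+) a ` T) (\<lambda>z. a + p z) q" if u: "u \<in> v" for u
  proof -
    obtain q where q: "homeomorphism u T p q" using v(4)[OF u] by blast
    have "homeomorphism T ((+) a ` T) ((+) a) (\<lambda>y. y - a)"
      by (auto simp: homeomorphism_def image_image intro!: continuous_intros)
    from homeomorphism_compose[OF q this] show ?thesis by (auto simp: o_def)
  qed
  ultimately show "\<exists>T. x \<in> T \<and> openin (top_of_set ((+) a ` S)) T \<and>
      (\<exists>v. \<Union>v = c \<inter> (\<lambda>z. a + p z) -` T \<and> (\<forall>u\<in>v. openin (top_of_set c) u) \<and>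
        pairwise disjnt v \<and> (\<forall>u\<in>v. \<exists>q. homeomorphism u T (\<lambda>z. a + p z) q))"
    using T(1) x0(2) v(2,3) by (intro exI[of _ "(+) a ` T"] conjI exI[of _ v]) auto
qed

abbreviation fi :: "complex \<Rightarrow> complex" where "fi \<equiv> quad \<i>"

abbreviation X :: "complex set" where "X \<equiv> img_space \<i>"

lemma critical_orbit_i: "critical_orbit \<i> = {\<i>, -1 + \<i>, -\<i>}"
proof
  have f: "fi 0 = \<i>" "fi \<i> = -1 + \<i>" "fi (-1 + \<i>) = -\<i>" "fi (-\<i>) = -1 + \<i>"
    unfolding quad_def power2_eq_square complex_eq_iff by simp_all
  have "(fi ^^ Suc n) 0 \<in> {\<i>, -1 + \<i>, -\<i>}" for n
  proof (induction n)
    case (Suc n)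
    have "(fi ^^ Suc (Suc n)) 0 = fi ((fi ^^ Suc n) 0)" by simp
    then show ?case using Suc f by auto
  qed (simp add: f)
  then show "critical_orbit \<i> \<subseteq> {\<i>, -1 + \<i>, -\<i>}"
    unfolding critical_orbit_def by (auto simp del: funpow.simps) (metis Suc_le_D insertE singletonD)
  have "(fi ^^ 1) 0 = \<i>" "(fi ^^ 2) 0 = -1 + \<i>" "(fi ^^ 3) 0 = -\<i>"
    by (simp_all only: numeral_eq_Suc pred_numeral_simps Num.BitM.simps One_nat_def funpow.simps o_apply id_apply f)
  then show "{\<i>, -1 + \<i>, -\<i>} \<subseteq> critical_orbit \<i>"
    unfolding critical_orbit_def
    by (metis (mono_tags, lifting) CollectI empty_subsetI insert_subset le_refl one_le_numeral)
qed

lemma img_space_i: "X = - {\<i>, -1 + \<i>, -\<i>}"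
proof -
  have "closed {\<i>, -1 + \<i>, -\<i>}" by (intro finite_imp_closed) simp
  then show ?thesis unfolding img_space_def critical_orbit_i by (simp only: closure_closed Compl_eq_Diff_UNIV)
qed

lemma open_X: "open X"
  unfolding img_space_i by (intro open_Compl finite_imp_closed) simp

text \<open>
  The postcritical set is forward invariant, so lifts of paths in \<open>X\<close> stay in \<open>X\<close> and can be
  lifted again.
\<close>

lemma fi_in_X_D: "fi y \<in> X \<Longrightarrow> y \<in> X"
  unfolding img_space_i by (auto simp: quad_def power2_eq_square complex_eq_iff)

lemma funpow_fi_in_X_D: "(fi ^^ s) y \<in> X \<Longrightarrow> y \<in> X"
  by (induction s) (auto dest: fi_in_X_D)

lemma covering_space_fi: "covering_space (fi -` X) fi X"
proof -
  have "covering_space (- {0}) (\<lambda>z. \<i> + z\<^sup>2) ((+) \<i> ` (- {0}))"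
    by (rule covering_space_translation[OF covering_space_square_punctured_plane])
  moreover have "(+) \<i> ` (- {0}) = - {\<i>}"
  proof (intro equalityI subsetI)
    fix x assume "x \<in> - {\<i>}"
    then show "x \<in> (+) \<i> ` (- {0})" by (intro image_eqI[of _ _ "x - \<i>"]) auto
  qed auto
  moreover have "(\<lambda>z. \<i> + z\<^sup>2) = fi" by (simp add: quad_def fun_eq_iff)
  ultimately have "covering_space (- {0}) fi (- {\<i>})" by simp
  moreover have "openin (top_of_set (- {\<i>})) X"
    unfolding openin_open using open_X by (intro exI[of _ X]) (auto simp: img_space_i)
  ultimately have "covering_space (- {0} \<inter> fi -` X) fi X" by (rule covering_space_restrict_open)
  moreover have "- {0} \<inter> fi -` X = fi -` X" by (auto simp: img_space_i quad_def)
  ultimately show ?thesis by simp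
qed

lemma continuous_on_fi: "continuous_on S fi"
  unfolding quad_def by (intro continuous_intros)

definition is_lift :: "nat \<Rightarrow> (real \<Rightarrow> complex) \<Rightarrow> (real \<Rightarrow> complex) \<Rightarrow> bool" where
  "is_lift s \<gamma> h \<longleftrightarrow> path h \<and> (\<forall>t\<in>{0..1}. (fi ^^ s) (h t) = \<gamma> t)"

definition X_path :: "(real \<Rightarrow> complex) \<Rightarrow> bool" where
  "X_path \<gamma> \<longleftrightarrow> path \<gamma> \<and> path_image \<gamma> \<subseteq> X"

lemma is_lift_X_path:
  assumes "X_path \<gamma>" "is_lift s \<gamma> h" shows "X_path h"
proof -
  have "h t \<in> X" if "t \<in> {0..1}" for t
  proof (rule funpow_fi_in_X_D[of s])
    have "(fi ^^ s) (h t) = \<gamma> t" using assms(2) that by (simp add: is_lift_def)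
    moreover have "\<gamma> t \<in> X" using assms(1) that by (auto simp: X_path_def path_image_def simp del: Compl_iff)
    ultimately show "(fi ^^ s) (h t) \<in> X" by simp
  qed
  then show ?thesis using assms by (auto simp: X_path_def is_lift_def path_image_def)
qed

lemma is_lift_Suc: "is_lift (Suc s) \<gamma> h \<Longrightarrow> is_lift s \<gamma> (fi \<circ> h)"
  unfolding is_lift_def
  using path_continuous_image[OF _ continuous_on_fi] by (simp add: funpow_swap1)

text \<open>
  Lifting under an iterate is lifting step by step, and each step is a lift through a covering map.
  For equal paths this says in particular that lifts have a well-defined endpoint.
\<close>

lemma lifts_homotopic:
  assumes "homotopic_paths X \<gamma> \<gamma>'" "is_lift s \<gamma> h" "is_lift s \<gamma>' h'" "pathstart h = pathstart h'"
  shows "homotopic_paths X h h'"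
  using assms(2-)
proof (induction s arbitrary: h h')
  case 0
  have "homotopic_paths X h \<gamma>" "homotopic_paths X \<gamma>' h'"
    using 0 homotopic_paths_imp_path[OF assms(1)] homotopic_paths_imp_subset[OF assms(1)]
    by (auto simp: is_lift_def path_image_def intro!: homotopic_paths_eq[THEN homotopic_paths_sym] homotopic_paths_eq)
  then show ?case using assms(1) homotopic_paths_trans by blast
next
  case (Suc s)
  have XP: "X_path \<gamma>" "X_path \<gamma>'"
    using homotopic_paths_imp_path[OF assms(1)] homotopic_paths_imp_subset[OF assms(1)]
    by (auto simp: X_path_def)
  have l: "is_lift s \<gamma> (fi \<circ> h)" "is_lift s \<gamma>' (fi \<circ> h')" using Suc.prems is_lift_Suc by auto
  have "homotopic_paths X (fi \<circ> h) (fi \<circ> h')"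
    by (rule Suc.IH[OF l]) (simp only: pathstart_def comp_apply Suc.prems(3)[unfolded pathstart_def])
  moreover have "path_image h \<subseteq> fi -` X" "path_image h' \<subseteq> fi -` X"
    using is_lift_X_path[OF XP(1) l(1)] is_lift_X_path[OF XP(2) l(2)]
    by (auto simp: X_path_def path_image_def)
  ultimately have "homotopic_paths (fi -` X) h h'"
    using Suc.prems is_lift_X_path[OF XP(1) l(1)] is_lift_X_path[OF XP(2) l(2)]
    by (intro covering_space_lift_homotopic_paths[OF covering_space_fi, of "fi \<circ> h" "fi \<circ> h'"])
      (auto simp: X_path_def is_lift_def)
  then show ?case by (rule homotopic_paths_subset) (auto dest: fi_in_X_D)
qed

lemma lift_exists:
  assumes "X_path \<gamma>" "(fi ^^ s) x = pathstart \<gamma>"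
  shows "\<exists>h. is_lift s \<gamma> h \<and> pathstart h = x"
  using assms(2)
proof (induction s arbitrary: x)
  case 0
  then show ?case using assms(1) by (intro exI[of _ \<gamma>]) (auto simp: is_lift_def X_path_def)
next
  case (Suc s)
  then have "(fi ^^ s) (fi x) = pathstart \<gamma>" by (simp add: funpow_swap1)
  then obtain k where k: "is_lift s \<gamma> k" "pathstart k = fi x" using Suc.IH by blast
  have kX: "X_path k" using is_lift_X_path[OF assms(1) k(1)] .
  then have "x \<in> fi -` X" using k(2) pathstart_in_path_image[of k] by (auto simp: X_path_def)
  then obtain h where h: "path h" "pathstart h = x" "\<And>t. t \<in> {0..1} \<Longrightarrow> fi (h t) = k t"
    using covering_space_lift_path_strong[OF covering_space_fi, of x k] kX k(2) by (auto simp: X_path_def)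
  then have "is_lift (Suc s) \<gamma> h" using k(1) by (auto simp: is_lift_def funpow_Suc_right simp del: funpow.simps)
  then show ?case using h(2) by blast
qed

lemma lift_endpoint_eq:
  assumes "X_path \<gamma>" "is_lift s \<gamma> h"
  shows "lift_endpoint \<i> s \<gamma> (pathstart h) = pathfinish h"
  unfolding lift_endpoint_def
proof (rule the_equality)
  show "\<exists>k. path k \<and> pathstart k = pathstart h \<and> pathfinish k = pathfinish h \<and> (\<forall>t\<in>{0..1}. (fi ^^ s) (k t) = \<gamma> t)"
    using assms(2) by (auto simp: is_lift_def)
  fix y assume "\<exists>k. path k \<and> pathstart k = pathstart h \<and> pathfinish k = y \<and> (\<forall>t\<in>{0..1}. (fi ^^ s) (k t) = \<gamma> t)"
  then obtain k where "is_lift s \<gamma> k" "pathstart k = pathstart h" "pathfinish k = y" by (auto simp: is_lift_def)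
  moreover have "homotopic_paths X \<gamma> \<gamma>" using assms(1) by (auto simp: X_path_def)
  ultimately show "y = pathfinish h"
    using lifts_homotopic[of \<gamma> \<gamma> s k h] assms(2) homotopic_paths_imp_pathfinish by blast
qed

lemma lift_endpoint_obtain:
  assumes "X_path \<gamma>" "(fi ^^ s) x = pathstart \<gamma>"
  obtains h where "is_lift s \<gamma> h" "pathstart h = x" "pathfinish h = lift_endpoint \<i> s \<gamma> x"
  using lift_exists[OF assms] lift_endpoint_eq[OF assms(1)] that by metis

lemma funpow_lift_endpoint:
  assumes "X_path \<gamma>" "(fi ^^ s) x = pathstart \<gamma>"
  shows "(fi ^^ s) (lift_endpoint \<i> s \<gamma> x) = pathfinish \<gamma>"
  using lift_endpoint_obtain[OF assms]
  by (metis atLeastAtMost_iff is_lift_def order_refl pathfinish_def zero_le_one)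

lemma lift_endpoint_homotopic:
  assumes "homotopic_paths X \<gamma> \<gamma>'" "(fi ^^ s) x = pathstart \<gamma>"
  shows "lift_endpoint \<i> s \<gamma> x = lift_endpoint \<i> s \<gamma>' x"
proof -
  have X: "X_path \<gamma>" "X_path \<gamma>'" and st: "pathstart \<gamma>' = pathstart \<gamma>"
    using homotopic_paths_imp_path[OF assms(1)] homotopic_paths_imp_subset[OF assms(1)]
      homotopic_paths_imp_pathstart[OF assms(1)] by (auto simp: X_path_def)
  obtain h where h: "is_lift s \<gamma> h" "pathstart h = x" "pathfinish h = lift_endpoint \<i> s \<gamma> x"
    using lift_endpoint_obtain[OF X(1) assms(2)] .
  obtain h' where h': "is_lift s \<gamma>' h'" "pathstart h' = x" "pathfinish h' = lift_endpoint \<i> s \<gamma>' x"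
    using lift_endpoint_obtain[OF X(2)] assms(2) st by metis
  have "homotopic_paths X h h'" using lifts_homotopic[OF assms(1) h(1) h'(1)] h(2) h'(2) by simp
  then show ?thesis using homotopic_paths_imp_pathfinish h(3) h'(3) by metis
qed

lemma lift_endpoint_join:
  assumes "X_path \<gamma>" "X_path \<delta>" "pathfinish \<gamma> = pathstart \<delta>" "(fi ^^ s) x = pathstart \<gamma>"
  shows "lift_endpoint \<i> s (\<gamma> +++ \<delta>) x = lift_endpoint \<i> s \<delta> (lift_endpoint \<i> s \<gamma> x)"
proof -
  obtain h where h: "is_lift s \<gamma> h" "pathstart h = x" "pathfinish h = lift_endpoint \<i> s \<gamma> x"
    using lift_endpoint_obtain[OF assms(1,4)] .
  obtain k where k: "is_lift s \<delta> k" "pathstart k = lift_endpoint \<i> s \<gamma> x"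
    "pathfinish k = lift_endpoint \<i> s \<delta> (lift_endpoint \<i> s \<gamma> x)"
    using lift_endpoint_obtain[OF assms(2), of s "lift_endpoint \<i> s \<gamma> x"]
      funpow_lift_endpoint[OF assms(1,4)] assms(3) by metis
  have "is_lift s (\<gamma> +++ \<delta>) (h +++ k)"
    unfolding is_lift_def
  proof
    show "path (h +++ k)" using h k by (simp add: is_lift_def)
    show "\<forall>t\<in>{0..1}. (fi ^^ s) ((h +++ k) t) = (\<gamma> +++ \<delta>) t"
      using h(1) k(1) by (auto simp: is_lift_def joinpaths_def)
  qed
  moreover have "X_path (\<gamma> +++ \<delta>)"
    using assms by (auto simp: X_path_def path_image_join)
  ultimately show ?thesis using lift_endpoint_eq[of "\<gamma> +++ \<delta>" s "h +++ k"] h k by simp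
qed

lemma lift_endpoint_parent:
  assumes "X_path \<gamma>" "(fi ^^ Suc s) x = pathstart \<gamma>"
  shows "fi (lift_endpoint \<i> (Suc s) \<gamma> x) = lift_endpoint \<i> s \<gamma> (fi x)"
proof -
  obtain h where h: "is_lift (Suc s) \<gamma> h" "pathstart h = x" "pathfinish h = lift_endpoint \<i> (Suc s) \<gamma> x"
    using lift_endpoint_obtain[OF assms] .
  then show ?thesis using lift_endpoint_eq[OF assms(1) is_lift_Suc[OF h(1)]]
    by (simp add: pathstart_def pathfinish_def)
qed

lemma lift_endpoint_reversepath:
  assumes "X_path \<gamma>" "(fi ^^ s) x = pathstart \<gamma>"
  shows "lift_endpoint \<i> s (reversepath \<gamma>) (lift_endpoint \<i> s \<gamma> x) = x"
proof -
  obtain h where h: "is_lift s \<gamma> h" "pathstart h = x" "pathfinish h = lift_endpoint \<i> s \<gamma> x"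
    using lift_endpoint_obtain[OF assms] .
  have "is_lift s (reversepath \<gamma>) (reversepath h)"
    using h by (auto simp: is_lift_def reversepath_def path_reversepath[unfolded reversepath_def])
  moreover have "X_path (reversepath \<gamma>)" using assms(1) by (auto simp: X_path_def)
  ultimately show ?thesis using lift_endpoint_eq h by (metis pathfinish_reversepath pathstart_reversepath)
qed

text \<open>
  The self-similarity behind the wreath recursion: lifting under \<open>s + 1\<close> iterates is lifting once and
  then lifting the lift under \<open>s\<close> iterates.
\<close>

lemma lift_endpoint_Suc:
  assumes "X_path \<gamma>" "is_lift 1 \<gamma> k" "(fi ^^ s) x = pathstart k"
  shows "lift_endpoint \<i> (Suc s) \<gamma> x = lift_endpoint \<i> s k x"
proof -
  have kX: "X_path k" using is_lift_X_path[OF assms(1,2)] .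
  obtain h where h: "is_lift s k h" "pathstart h = x" "pathfinish h = lift_endpoint \<i> s k x"
    using lift_endpoint_obtain[OF kX assms(3)] .
  have "is_lift (Suc s) \<gamma> h" using h(1) assms(2) by (auto simp: is_lift_def)
  then show ?thesis using lift_endpoint_eq[OF assms(1)] h by metis
qed

lemma lift_endpoint_const:
  assumes "z \<in> X" "(fi ^^ s) x = z"
  shows "lift_endpoint \<i> s (linepath z z) x = x"
proof -
  have "is_lift s (linepath z z) (linepath x x)" using assms(2) path_linepath[of x x]
    by (simp add: is_lift_def linepath_refl)
  moreover have "X_path (linepath z z)" using assms(1) by (auto simp: X_path_def)
  ultimately show ?thesis using lift_endpoint_eq by fastforce
qed

section \<open>Frames and their transport along paths\<close>

text \<open>
  A labelling of the tree of preimages of \<open>z\<close>. The level of a point is the length of its label, so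
  it is left out of the values; the second component of a tree identification is a frame.
\<close>

definition frame :: "complex \<Rightarrow> (letter list \<Rightarrow> complex) \<Rightarrow> bool" where
  "frame z q \<longleftrightarrow> q [] = z \<and> (\<forall>w x. fi (q (w @ [x])) = q w) \<and> (\<forall>w. q (w @ [Lft]) \<noteq> q (w @ [Rgt]))"

definition transport :: "(real \<Rightarrow> complex) \<Rightarrow> (letter list \<Rightarrow> complex) \<Rightarrow> letter list \<Rightarrow> complex" where
  "transport \<gamma> q w = lift_endpoint \<i> (length w) \<gamma> (q w)"

lemma frame_level: "frame z q \<Longrightarrow> (fi ^^ length w) (q w) = z"
proof (induction w rule: rev_induct)
  case (snoc x w)
  then show ?case by (simp add: frame_def funpow_swap1)
qed (simp add: frame_def)

lemma frame_transport:
  assumes "frame z q" "X_path \<gamma>" "pathstart \<gamma> = z"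
  shows "frame (pathfinish \<gamma>) (transport \<gamma> q)"
  unfolding frame_def
proof (intro conjI allI)
  have lev: "(fi ^^ length w) (q w) = pathstart \<gamma>" for w using frame_level[OF assms(1)] assms(3) by simp
  show "transport \<gamma> q [] = pathfinish \<gamma>"
    using funpow_lift_endpoint[OF assms(2), of 0] lev[of "[]"] by (simp add: transport_def)
  show "fi (transport \<gamma> q (w @ [x])) = transport \<gamma> q w" for w x
    using lift_endpoint_parent[OF assms(2), of "length w" "q (w @ [x])"] lev[of "w @ [x]"] assms(1)
    by (simp add: transport_def frame_def)
  show "transport \<gamma> q (w @ [Lft]) \<noteq> transport \<gamma> q (w @ [Rgt])" for w
  proof
    assume "transport \<gamma> q (w @ [Lft]) = transport \<gamma> q (w @ [Rgt])"
    then have "q (w @ [Lft]) = q (w @ [Rgt])"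
      using lift_endpoint_reversepath[OF assms(2), of "Suc (length w)"] lev[of "w @ [Lft]"] lev[of "w @ [Rgt]"]
      unfolding transport_def by (metis length_append_singleton)
    then show False using assms(1) by (auto simp: frame_def)
  qed
qed

lemma transport_homotopic:
  assumes "frame z q" "homotopic_paths X \<gamma> \<gamma>'" "pathstart \<gamma> = z"
  shows "transport \<gamma> q = transport \<gamma>' q"
  using lift_endpoint_homotopic[OF assms(2)] frame_level[OF assms(1)] assms(3)
  by (auto simp: transport_def fun_eq_iff)

lemma transport_join:
  assumes "frame z q" "X_path \<gamma>" "X_path \<delta>" "pathstart \<gamma> = z" "pathfinish \<gamma> = pathstart \<delta>"
  shows "transport (\<gamma> +++ \<delta>) q = transport \<delta> (transport \<gamma> q)"
  using lift_endpoint_join[OF assms(2,3,5)] frame_level[OF assms(1)] assms(4)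
  by (auto simp: transport_def fun_eq_iff)

lemma transport_reversepath:
  assumes "frame z q" "X_path \<gamma>" "pathstart \<gamma> = z"
  shows "transport (reversepath \<gamma>) (transport \<gamma> q) = q"
  using lift_endpoint_reversepath[OF assms(2)] frame_level[OF assms(1)] assms(3)
  by (auto simp: transport_def fun_eq_iff)

text \<open>
  Transport commutes with relabelling, so automorphisms act on frames from the right and transports
  from the left.
\<close>

lemma transport_comp:
  assumes "\<And>w. length (g w) = length w"
  shows "transport \<gamma> (q \<circ> g) = transport \<gamma> q \<circ> g"
  by (auto simp: transport_def fun_eq_iff assms)

lemma transport_const:
  assumes "frame z q" "z \<in> X" shows "transport (linepath z z) q = q"
  using lift_endpoint_const[OF assms(2)] frame_level[OF assms(1)] by (auto simp: transport_def fun_eq_iff)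

definition subframe :: "(letter list \<Rightarrow> complex) \<Rightarrow> letter \<Rightarrow> letter list \<Rightarrow> complex" where
  "subframe q x v = q (x # v)"

lemma frame_subframe: "frame z q \<Longrightarrow> frame (q [x]) (subframe q x)"
  by (auto simp: frame_def subframe_def simp flip: append_Cons)

text \<open>
  The part of a frame below a first-level vertex is transported along the lift of the path that starts
  at this vertex.
\<close>

lemma subframe_transport:
  assumes "frame z q" "X_path \<gamma>" "pathstart \<gamma> = z" "is_lift 1 \<gamma> k" "pathstart k = q [x]"
  shows "subframe (transport \<gamma> q) x = transport k (subframe q x)"
proof
  fix v
  have "(fi ^^ length v) (subframe q x v) = pathstart k"
    using frame_level[OF frame_subframe[OF assms(1)], of v x] assms(5) by simp
  then show "subframe (transport \<gamma> q) x v = transport k (subframe q x) v"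
    using lift_endpoint_Suc[OF assms(2,4), of "length v" "q (x # v)"]
    by (simp add: subframe_def transport_def)
qed

lemma fi_eq_iff: "fi a = fi b \<longleftrightarrow> a = b \<or> a = - b"
  by (auto simp: quad_def power2_eq_iff)

lemma frame_inj:
  assumes q: "frame z q" shows "length v = length w \<Longrightarrow> q v = q w \<Longrightarrow> v = w"
proof (induction v arbitrary: w rule: rev_induct)
  case (snoc x v)
  then obtain y u where w: "w = u @ [y]" by (metis length_append_singleton length_0_conv nat.distinct(1) rev_exhaust)
  have "q v = q u" using snoc.prems(2) q unfolding w frame_def by metis
  then have "v = u" using snoc w by simp
  moreover have "x = y"
    using q snoc.prems(2) w \<open>v = u\<close> unfolding frame_def by (cases x; cases y) (auto, metis)
  ultimately show ?case using w by simp
qed simp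

lemma frame_surj:
  assumes q: "frame z q" shows "(fi ^^ n) y = z \<Longrightarrow> \<exists>w. length w = n \<and> q w = y"
proof (induction n arbitrary: y)
  case 0
  then show ?case using q by (intro exI[of _ "[]"]) (auto simp: frame_def)
next
  case (Suc n)
  then have "(fi ^^ n) (fi y) = z" by (simp add: funpow_swap1)
  then obtain w where w: "length w = n" "q w = fi y" using Suc.IH by blast
  have "fi (q (w @ [Lft])) = fi y" "fi (q (w @ [Rgt])) = fi y" "q (w @ [Lft]) \<noteq> q (w @ [Rgt])"
    using q w by (auto simp: frame_def)
  then have "q (w @ [Lft]) = y \<or> q (w @ [Rgt]) = y" by (auto simp: fi_eq_iff)
  then show ?case using w(1) by (metis length_append_singleton)
qed

lemma tree_automorphismD:
  assumes "g \<in> carrier Aut_T"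
  shows "bij g" "length (g w) = length w" "g (butlast w) = butlast (g w)"
  using assms by (auto simp: Aut_T_def tree_automorphism_def)

text \<open>
  Both frames enumerate the same tree of preimages.
\<close>

lemma frames_differ_by_automorphism:
  assumes q: "frame z q" and q': "frame z q'"
  shows "\<exists>g\<in>carrier Aut_T. q' = q \<circ> g"
proof -
  have "\<exists>g. \<forall>w. length (g w) = length w \<and> q (g w) = q' w" if "frame z q" "frame z q'" for q q'
    using frame_surj[OF that(1) frame_level[OF that(2)]] by metis
  then obtain g h where g: "\<And>w. length (g w) = length w" "\<And>w. q (g w) = q' w"
    and h: "\<And>w. length (h w) = length w" "\<And>w. q' (h w) = q w"
    using q q' by metis
  have gh: "g (h w) = w" and hg: "h (g w) = w" for w
    using frame_inj[OF q, of "g (h w)" w] frame_inj[OF q', of "h (g w)" w] g h by auto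
  have "bij g" using gh hg by (metis bijI' )
  moreover have "g (butlast w) = butlast (g w)" for w
  proof (cases w rule: rev_cases)
    case (snoc v x)
    obtain u y where gu: "g w = u @ [y]" using g(1)[of w] snoc by (cases "g w" rule: rev_cases) auto
    have "q u = fi (q (g w))" using q gu by (simp add: frame_def)
    also have "\<dots> = q' v" using g(2)[of w] q' snoc by (simp add: frame_def)
    also have "\<dots> = q (g v)" by (simp add: g(2))
    finally have "u = g v" using frame_inj[OF q, of u "g v"] g(1)[of w] g(1)[of v] gu snoc by simp
    then show ?thesis using gu snoc by simp
  qed (use g(1)[of "[]"] in simp)
  ultimately have "g \<in> carrier Aut_T" using g(1) by (simp add: Aut_T_def tree_automorphism_def)
  then show ?thesis using g(2) by (intro bexI[of _ g]) (auto simp: fun_eq_iff)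
qed

section \<open>The slit plane and its invariant frame field\<close>

text \<open>
  The half-lines \<open>i[1,\<infinity>)\<close>, \<open>-i[1,\<infinity>)\<close> and \<open>(-1+i)[1,\<infinity>)\<close>. They are radial, so that their complement is
  starlike about 0, and the polynomial maps the third one into the second one.
\<close>

definition slit :: "complex \<Rightarrow> bool" where
  "slit z \<longleftrightarrow> Re z = 0 \<and> 1 \<le> \<bar>Im z\<bar> \<or> Im z = - Re z \<and> 1 \<le> Im z"

definition slit_plane :: "complex set" where
  "slit_plane = {z. \<not> slit z}"

text \<open>
  The images of the slits: \<open>-i[1,\<infinity>)\<close>, and the horizontal half-line to the left of \<open>-1+i\<close>, which is
  the common image of the two slits on the imaginary axis. A path that avoids them has all its lifts in the
  slit plane.
\<close>

definition slit_image :: "complex \<Rightarrow> bool" where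
  "slit_image z \<longleftrightarrow> Re z = 0 \<and> Im z \<le> -1 \<or> Im z = 1 \<and> Re z \<le> -1"

lemma Re_Im_fi [simp]: "Re (fi y) = (Re y)\<^sup>2 - (Im y)\<^sup>2" "Im (fi y) = 2 * Re y * Im y + 1"
  by (simp_all add: quad_def Re_power2 Im_power2)

lemma one_le_square: "1 \<le> \<bar>a\<bar> \<Longrightarrow> 1 \<le> a\<^sup>2" for a :: real
  using abs_le_square_iff[of 1 a] by simp

lemma slit_imp_slit_image: "slit y \<Longrightarrow> slit_image (fi y)"
  using one_le_square[of "Im y"] unfolding slit_def slit_image_def
  by (auto simp: power2_eq_square)

lemma slit_plane_subset_X: "slit_plane \<subseteq> X"
  by (auto simp: slit_plane_def slit_def img_space_i)

lemma segment_0_slit_plane: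
  assumes "z \<in> slit_plane" shows "closed_segment 0 z \<subseteq> slit_plane"
proof
  fix y assume "y \<in> closed_segment 0 z"
  then obtain t where t: "0 \<le> t" "t \<le> 1" "y = t *\<^sub>R z" by (auto simp: in_segment)
  have le: "\<bar>t * Im z\<bar> \<le> \<bar>Im z\<bar>" using t by (simp add: abs_mult mult_left_le_one_le)
  have "\<not> slit y"
  proof
    assume s: "slit y"
    then have "t \<noteq> 0" using t by (auto simp: slit_def)
    then have Re: "Re z = 0 \<longleftrightarrow> Re y = 0" and Im: "Im z = - Re z \<longleftrightarrow> Im y = - Re y"
      using t mult_cancel_left[of t "Im z" "- Re z"] by auto
    have "1 \<le> Im y \<Longrightarrow> 1 \<le> Im z"
      using le t zero_le_mult_iff[of t "Im z"] by (auto simp: abs_if split: if_splits)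
    moreover have "1 \<le> \<bar>Im y\<bar> \<Longrightarrow> 1 \<le> \<bar>Im z\<bar>" using le t by auto
    ultimately have "slit z" using s Re Im unfolding slit_def by blast
    then show False using assms by (simp add: slit_plane_def)
  qed
  then show "y \<in> slit_plane" by (simp add: slit_plane_def)
qed

lemma zero_in_slit_plane: "0 \<in> slit_plane"
  by (simp add: slit_plane_def slit_def)

lemma open_slit_plane: "open slit_plane"
proof -
  have "closed ({z. Re z = 0} \<inter> {z. 1 \<le> \<bar>Im z\<bar>} \<union> {z. Im z = - Re z} \<inter> {z. 1 \<le> Im z})"
    by (intro closed_Un closed_Int closed_Collect_eq closed_Collect_le continuous_intros)
  moreover have "slit_plane = - ({z. Re z = 0} \<inter> {z. 1 \<le> \<bar>Im z\<bar>} \<union> {z. Im z = - Re z} \<inter> {z. 1 \<le> Im z})"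
    by (auto simp: slit_plane_def slit_def)
  ultimately show ?thesis by (metis open_Compl)
qed

text \<open>
  In a starlike domain all paths with the same endpoints are homotopic.
\<close>

lemma transport_starlike:
  assumes U: "U \<subseteq> X" "a \<in> U" "\<And>z. z \<in> U \<Longrightarrow> closed_segment a z \<subseteq> U"
    and q: "frame a q" and \<gamma>: "path \<gamma>" "path_image \<gamma> \<subseteq> U"
  shows "transport \<gamma> (transport (linepath a (pathstart \<gamma>)) q) = transport (linepath a (pathfinish \<gamma>)) q"
proof -
  have "starlike U" using U by (auto simp: starlike_def)
  then have sc: "simply_connected U" by (rule starlike_imp_simply_connected)
  have se: "pathstart \<gamma> \<in> U" "pathfinish \<gamma> \<in> U" using \<gamma> by auto
  let ?l = "linepath a (pathstart \<gamma>)"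
  have l: "path_image ?l \<subseteq> U" "path_image (linepath a (pathfinish \<gamma>)) \<subseteq> U" using U(3) se by auto
  have "homotopic_paths U (?l +++ \<gamma>) (linepath a (pathfinish \<gamma>))"
    using sc l \<gamma> unfolding simply_connected_eq_homotopic_paths
    by (simp add: path_image_join)
  then have "homotopic_paths X (?l +++ \<gamma>) (linepath a (pathfinish \<gamma>))"
    using U(1) by (rule homotopic_paths_subset)
  from transport_homotopic[OF q this]
  have "transport (?l +++ \<gamma>) q = transport (linepath a (pathfinish \<gamma>)) q" by simp
  moreover have "transport (?l +++ \<gamma>) q = transport \<gamma> (transport ?l q)"
    using l \<gamma> U(1) by (intro transport_join[OF q]) (auto simp: X_path_def)
  ultimately show ?thesis by simp
qed

definition sqrt_minus_i :: complex where
  "sqrt_minus_i = Complex (- 1 / sqrt 2) (1 / sqrt 2)"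

lemma sqrt_minus_i_square: "sqrt_minus_i * sqrt_minus_i = - \<i>"
  by (simp add: sqrt_minus_i_def complex_eq_iff)

fun signed :: "letter \<Rightarrow> complex \<Rightarrow> complex" where
  "signed Lft z = z"
| "signed Rgt z = - z"

fun other :: "letter \<Rightarrow> letter" where
  "other Lft = Rgt"
| "other Rgt = Lft"

text \<open>
  The inverse branches of the polynomial on the complement of the slit from the critical value. Since
  \<open>sqrt_minus_i\<close> points in the direction of \<open>-1+i\<close>, the branch \<open>Lft\<close> takes values in the half-plane to
  the upper left of the diagonal line that is the preimage of this slit.
\<close>

definition branch :: "letter \<Rightarrow> complex \<Rightarrow> complex" where
  "branch x z = signed x (sqrt_minus_i * csqrt (\<i> * (z - \<i>)))"

lemma fi_signed [simp]: "fi (signed x z) = fi z"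
  by (cases x) (simp_all add: quad_def)

lemma fi_branch: "fi (branch x z) = z"
proof -
  have "(sqrt_minus_i * csqrt (\<i> * (z - \<i>)))\<^sup>2 = (sqrt_minus_i * sqrt_minus_i) * (csqrt (\<i> * (z - \<i>)))\<^sup>2"
    by (simp add: power2_eq_square)
  also have "\<dots> = - \<i> * (\<i> * (z - \<i>))" by (simp only: sqrt_minus_i_square power2_csqrt)
  also have "\<dots> = z - \<i>" by (simp add: algebra_simps flip: mult.assoc)
  finally show ?thesis by (simp add: branch_def) (simp add: quad_def)
qed

definition critical_slit :: "complex \<Rightarrow> bool" where
  "critical_slit z \<longleftrightarrow> Re z = 0 \<and> 1 \<le> Im z"

lemma critical_slit_imp_slit: "critical_slit z \<Longrightarrow> slit z"
  by (auto simp: critical_slit_def slit_def)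

lemma continuous_on_signed: "continuous_on S g \<Longrightarrow> continuous_on S (\<lambda>z. signed x (g z))"
  by (cases x) (auto intro: continuous_intros)

lemma continuous_on_csqrt_compose:
  "continuous_on S g \<Longrightarrow> (\<And>z. z \<in> S \<Longrightarrow> g z \<notin> \<real>\<^sub>\<le>\<^sub>0) \<Longrightarrow> continuous_on S (\<lambda>z. csqrt (g z))"
  by (rule continuous_on_compose2[OF continuous_on_csqrt]) auto

lemma continuous_on_branch:
  assumes "\<And>z. z \<in> S \<Longrightarrow> \<not> critical_slit z" shows "continuous_on S (branch x)"
  unfolding branch_def
proof (rule continuous_on_signed, rule continuous_on_mult[OF continuous_on_const continuous_on_csqrt_compose])
  show "continuous_on S (\<lambda>z. \<i> * (z - \<i>))" by (intro continuous_intros)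
  show "\<i> * (z - \<i>) \<notin> \<real>\<^sub>\<le>\<^sub>0" if "z \<in> S" for z
    using assms[OF that] by (auto simp: critical_slit_def complex_nonpos_Reals_iff)
qed

lemma branch_Lft_side:
  assumes "\<not> critical_slit z" shows "Re (branch Lft z) < Im (branch Lft z)"
proof -
  let ?c = "csqrt (\<i> * (z - \<i>))"
  have "\<i> * (z - \<i>) \<notin> \<real>\<^sub>\<le>\<^sub>0"
    using assms by (auto simp: critical_slit_def complex_nonpos_Reals_iff)
  then have "?c\<^sup>2 \<notin> \<real>\<^sub>\<le>\<^sub>0" by (simp only: power2_csqrt not_False_eq_True)
  then have "Re ?c \<noteq> 0"
    by (auto simp: complex_nonpos_Reals_iff Re_power2 Im_power2 simp del: power2_csqrt csqrt.simps)
  then have "0 < Re ?c" using Re_csqrt[of "\<i> * (z - \<i>)"] by linarith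
  moreover have "Im (branch Lft z) - Re (branch Lft z) = 2 / sqrt 2 * Re ?c"
    by (simp add: branch_def sqrt_minus_i_def field_simps del: csqrt.simps)
  moreover have "0 < 2 / sqrt 2 * Re ?c" using calculation(1) by simp
  ultimately show ?thesis by linarith
qed

lemma branch_0: "branch x 0 = signed x sqrt_minus_i"
  by (simp add: branch_def)

text \<open>
  The two first-level vertices are the preimages of 0; below each of them, the frame is the transport
  of the whole frame along the segment from 0. This choice makes the frame field compatible with
  passing to subtrees.
\<close>

fun base_frame :: "letter list \<Rightarrow> complex" where
  "base_frame [] = 0"
| "base_frame (x # v) = lift_endpoint \<i> (length v) (linepath 0 (branch x 0)) (base_frame v)"

lemma branch_0_in_slit_plane: "branch x 0 \<in> slit_plane"
proof -
  have "\<not> sqrt 2 \<le> (-1 :: real)" using real_sqrt_ge_zero[of 2] by linarith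
  then show ?thesis by (cases x) (auto simp: branch_0 sqrt_minus_i_def slit_plane_def slit_def field_simps)
qed

lemma X_path_linepath: "closed_segment a b \<subseteq> X \<Longrightarrow> X_path (linepath a b)"
  by (simp add: X_path_def)

lemma X_path_linepath_0: "z \<in> slit_plane \<Longrightarrow> X_path (linepath 0 z)"
  using segment_0_slit_plane slit_plane_subset_X by (intro X_path_linepath) blast

lemma frame_base_frame: "frame 0 base_frame"
proof -
  note XP = X_path_linepath_0[OF branch_0_in_slit_plane]
  have lev: "(fi ^^ length w) (base_frame w) = 0" for w
  proof (induction w)
    case (Cons x v)
    then show ?case using funpow_lift_endpoint[OF XP[of x], of "length v" "base_frame v"] by (simp add: fi_branch)
  qed simp
  have par: "fi (base_frame (w @ [x])) = base_frame w" for w x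
  proof (induction w)
    case Nil
    then show ?case using funpow_lift_endpoint[OF XP[of x], of 0 0] by (simp add: fi_branch)
  next
    case (Cons a w)
    then show ?case
      using lift_endpoint_parent[OF XP[of a], of "length w" "base_frame (w @ [x])"] lev[of "w @ [x]"] by simp
  qed
  have "base_frame (w @ [Lft]) \<noteq> base_frame (w @ [Rgt])" for w
  proof (induction w)
    case Nil
    have "sqrt_minus_i \<noteq> 0" using sqrt_minus_i_square by auto
    moreover have "base_frame [x] = branch x 0" for x
      using funpow_lift_endpoint[OF XP[of x], of 0 0] by (simp add: branch_0)
    ultimately show ?case by (simp add: branch_0 del: base_frame.simps)
  next
    case (Cons a w)
    show ?case
    proof
      assume "base_frame ((a # w) @ [Lft]) = base_frame ((a # w) @ [Rgt])"
      then have "base_frame (w @ [Lft]) = base_frame (w @ [Rgt])"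
        using lift_endpoint_reversepath[OF XP[of a], of "Suc (length w)"] lev[of "w @ [Lft]"] lev[of "w @ [Rgt]"]
        by (metis append_Cons base_frame.simps(2) length_append_singleton pathstart_linepath)
      with Cons show False by simp
    qed
  qed
  with par show ?thesis by (simp add: frame_def)
qed

definition slit_frame :: "complex \<Rightarrow> letter list \<Rightarrow> complex" where
  "slit_frame z = transport (linepath 0 z) base_frame"

lemma frame_slit_frame: "z \<in> slit_plane \<Longrightarrow> frame z (slit_frame z)"
  using frame_transport[OF frame_base_frame X_path_linepath_0, of z] by (simp add: slit_frame_def)

lemma slit_frame_0: "slit_frame 0 = base_frame"
  unfolding slit_frame_def using transport_const[OF frame_base_frame] slit_plane_subset_X zero_in_slit_plane by blast

lemma transport_slit_frame:
  assumes "path \<gamma>" "path_image \<gamma> \<subseteq> slit_plane"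
  shows "transport \<gamma> (slit_frame (pathstart \<gamma>)) = slit_frame (pathfinish \<gamma>)"
  unfolding slit_frame_def
  using slit_plane_subset_X zero_in_slit_plane segment_0_slit_plane frame_base_frame assms
  by (rule transport_starlike)

lemma subframe_base_frame: "subframe base_frame x = slit_frame (branch x 0)"
  by (auto simp: subframe_def slit_frame_def transport_def fun_eq_iff)

lemma path_branch_linepath:
  assumes "\<And>w. w \<in> closed_segment a b \<Longrightarrow> \<not> critical_slit w"
  shows "is_lift 1 (linepath a b) (branch x \<circ> linepath a b)"
    "pathstart (branch x \<circ> linepath a b) = branch x a"
    "pathfinish (branch x \<circ> linepath a b) = branch x b"
    "path (branch x \<circ> linepath a b)"
    "path_image (branch x \<circ> linepath a b) = branch x ` closed_segment a b"
proof -
  show p: "path (branch x \<circ> linepath a b)"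
    using assms by (intro path_continuous_image continuous_on_branch) auto
  then show "is_lift 1 (linepath a b) (branch x \<circ> linepath a b)"
    unfolding is_lift_def by (simp add: fi_branch)
  show "path_image (branch x \<circ> linepath a b) = branch x ` closed_segment a b"
    by (simp add: path_image_compose)
qed (simp_all add: pathstart_compose pathfinish_compose)

lemma branch_in_slit_plane: "\<not> slit_image z \<Longrightarrow> branch x z \<in> slit_plane"
  using slit_imp_slit_image[of "branch x z"] fi_branch[of x z] by (auto simp: slit_plane_def)

text \<open>
  The frame field reproduces itself below the first level, at every point that is visible from 0
  without crossing the images of the slits.
\<close>

lemma subframe_slit_frame:
  assumes z: "z \<in> slit_plane" and avoid: "\<And>w. w \<in> closed_segment 0 z \<Longrightarrow> \<not> slit_image w"
  shows "subframe (slit_frame z) x = slit_frame (branch x z)"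
proof -
  have cs: "\<not> critical_slit w" if "w \<in> closed_segment 0 z" for w
    using segment_0_slit_plane[OF z] that critical_slit_imp_slit by (auto simp: slit_plane_def)
  note b = path_branch_linepath[OF cs, where x = x]
  have "base_frame [x] = branch x 0"
    using subframe_base_frame[of x] frame_slit_frame[OF branch_0_in_slit_plane, of x]
    by (metis frame_def subframe_def)
  then have "subframe (slit_frame z) x = transport (branch x \<circ> linepath 0 z) (slit_frame (branch x 0))"
    unfolding slit_frame_def[of z] subframe_base_frame[symmetric]
    using b by (intro subframe_transport[OF frame_base_frame X_path_linepath_0[OF z]]) auto
  also have "\<dots> = slit_frame (branch x z)"
    using transport_slit_frame[OF b(4)] b(2,3,5) branch_in_slit_plane[OF avoid] by (auto simp: image_subset_iff)
  finally show ?thesis .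
qed

section \<open>Crossing the slits\<close>

text \<open>
  Convex neighbourhoods of the slits without their initial points, in \<open>X\<close> and disjoint from the other
  slits. They are named after the generator that will turn out to describe the crossing.
\<close>

fun crossing_region :: "gen \<Rightarrow> complex set" where
  "crossing_region Gs = {z. 1 < Im z \<and> 0 < Im z + Re z}"
| "crossing_region Ga = {z. Re z < -1}"
| "crossing_region Gb = {z. Im z < -1}"

text \<open>
  Linear functionals that vanish on the slit and are positive on the side that is met first when
  the slit is crossed counterclockwise.
\<close>

fun side :: "gen \<Rightarrow> complex \<Rightarrow> real" where
  "side Gs z = Re z"
| "side Ga z = Im z + Re z"
| "side Gb z = - Re z"

text \<open>
  Explicit points on the two sides of each slit, such that the segments from 0 to them avoid
  \<open>slit_image\<close> and the lifts of the segment that joins them lie in single crossing regions or in the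
  slit plane. For \<open>Ga\<close> this segment crosses the horizontal half-line of \<open>slit_image\<close>
  in addition to its slit.
\<close>

fun before :: "gen \<Rightarrow> complex" where
  "before Gs = Complex 1 2"
| "before Ga = Complex (-2) 3"
| "before Gb = Complex (-1) (-3)"

fun after :: "gen \<Rightarrow> complex" where
  "after Gs = Complex (-1) 2"
| "after Ga = Complex (-2) 0"
| "after Gb = Complex 1 (-3)"

lemma convex_half: "convex {z. 0 < a * Re z + b * Im z + c}" for a b c :: real
proof -
  have "{z. 0 < a * Re z + b * Im z + c} = {z. inner (Complex a b) z > - c}"
    by (auto simp: inner_complex_def)
  then show ?thesis by (simp only: convex_halfspace_gt)
qed

lemma open_half: "open {z. 0 < a * Re z + b * Im z + c}" for a b c :: real
  by (intro open_Collect_less continuous_intros)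

lemma crossing_region_halves:
  "crossing_region Gs = {z. 0 < 0 * Re z + 1 * Im z + (-1)} \<inter> {z. 0 < 1 * Re z + 1 * Im z + 0}"
  "crossing_region Ga = {z. 0 < (-1) * Re z + 0 * Im z + (-1)}"
  "crossing_region Gb = {z. 0 < 0 * Re z + (-1) * Im z + (-1)}"
  by auto

lemma convex_crossing_region: "convex (crossing_region p)"
  by (cases p) (simp_all only: crossing_region_halves convex_half convex_Int)

lemma open_crossing_region: "open (crossing_region p)"
  by (cases p) (simp_all only: crossing_region_halves open_half open_Int)

lemma convex_side: "convex {z. 0 < s * side p z}"
proof (cases p)
  case Gs
  then show ?thesis using convex_half[of s 0 0] by simp
next
  case Ga
  then show ?thesis using convex_half[of s s 0] by (simp add: algebra_simps)
next
  case Gb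
  then show ?thesis using convex_half[of "- s" 0 0] by simp
qed

lemma crossing_region_subset_X: "crossing_region p \<subseteq> X"
  by (cases p) (auto simp: img_space_i)

lemma slit_crossing_region: "z \<in> crossing_region p \<Longrightarrow> slit z \<longleftrightarrow> side p z = 0"
  by (cases p) (auto simp: slit_def)

lemma slit_cases:
  assumes "z \<in> X" "slit z" shows "\<exists>p. z \<in> crossing_region p"
proof -
  consider "Re z = 0" "Im z \<ge> 1" | "Re z = 0" "Im z \<le> -1" | "Im z = - Re z" "Im z \<ge> 1"
    using assms(2) by (auto simp: slit_def abs_if split: if_splits)
  then show ?thesis
  proof cases
    case 1
    then have "Im z \<noteq> 1" using assms(1) by (auto simp: img_space_i complex_eq_iff)
    with 1 show ?thesis by (intro exI[of _ Gs]) auto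
  next
    case 2
    then have "Im z \<noteq> -1" using assms(1) by (auto simp: img_space_i complex_eq_iff)
    with 2 show ?thesis by (intro exI[of _ Gb]) auto
  next
    case 3
    then have "Im z \<noteq> 1" using assms(1) by (auto simp: img_space_i complex_eq_iff)
    with 3 show ?thesis by (intro exI[of _ Ga]) auto
  qed
qed

lemma slit_unique_crossing_region:
  "slit z \<Longrightarrow> z \<in> crossing_region p \<Longrightarrow> z \<in> crossing_region p' \<Longrightarrow> p = p'"
  by (cases p; cases p') (auto simp: slit_def)

lemma before_after [simp]:
  "before p \<in> crossing_region p" "after p \<in> crossing_region p" "0 < side p (before p)" "side p (after p) < 0"
  by (cases p; simp)+

lemma in_slit_plane: "z \<in> crossing_region p \<Longrightarrow> side p z \<noteq> 0 \<Longrightarrow> z \<in> slit_plane"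
  using slit_crossing_region by (auto simp: slit_plane_def)

lemma before_after_in_slit_plane [simp]: "before p \<in> slit_plane" "after p \<in> slit_plane"
  using in_slit_plane[of _ p] before_after[of p] by (metis less_irrefl)+

text \<open>
  The frame field on a crossing region that extends the one on its positive side across the slit.
\<close>

definition crossing_frame :: "gen \<Rightarrow> complex \<Rightarrow> letter list \<Rightarrow> complex" where
  "crossing_frame p z = transport (linepath (before p) z) (slit_frame (before p))"

lemma transport_crossing_frame:
  assumes "path \<gamma>" "path_image \<gamma> \<subseteq> crossing_region p"
  shows "transport \<gamma> (crossing_frame p (pathstart \<gamma>)) = crossing_frame p (pathfinish \<gamma>)"
  unfolding crossing_frame_def
proof (rule transport_starlike[OF crossing_region_subset_X _ _ _ assms])
  show "frame (before p) (slit_frame (before p))" by (rule frame_slit_frame) simp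
  show "closed_segment (before p) z \<subseteq> crossing_region p" if "z \<in> crossing_region p" for z
    using convex_crossing_region that by (intro closed_segment_subset) auto
qed simp

lemma frame_crossing_frame: "z \<in> crossing_region p \<Longrightarrow> frame z (crossing_frame p z)"
  unfolding crossing_frame_def
  using frame_transport[OF frame_slit_frame, of "before p" "linepath (before p) z"]
    closed_segment_subset[OF before_after(1) _ convex_crossing_region, of z p] crossing_region_subset_X[of p]
    X_path_linepath[of "before p" z] by auto

lemma one_sided_segment:
  assumes "a \<in> crossing_region p" "b \<in> crossing_region p" "0 < s * side p a" "0 < s * side p b"
  shows "closed_segment a b \<subseteq> crossing_region p" "closed_segment a b \<subseteq> slit_plane"
proof -
  show c: "closed_segment a b \<subseteq> crossing_region p"
    using assms convex_crossing_region by (intro closed_segment_subset) auto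
  have "closed_segment a b \<subseteq> {z. 0 < s * side p z}"
    using assms convex_side by (intro closed_segment_subset) auto
  with c show "closed_segment a b \<subseteq> slit_plane" using in_slit_plane[of _ p] by force
qed

lemma crossing_frame_before:
  assumes "z \<in> crossing_region p" "0 < side p z"
  shows "crossing_frame p z = slit_frame z"
proof -
  have "closed_segment (before p) z \<subseteq> slit_plane" using one_sided_segment(2)[of "before p" p z 1] assms by simp
  then show ?thesis using transport_slit_frame[of "linepath (before p) z"] by (simp add: crossing_frame_def)
qed

text \<open>
  The automorphism by which the extended field differs from the original one on the far side.
\<close>

definition crossing :: "gen \<Rightarrow> letter list \<Rightarrow> letter list" where
  "crossing p = (SOME g. g \<in> carrier Aut_T \<and> crossing_frame p (after p) = slit_frame (after p) \<circ> g)"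

lemma crossing_props:
  "crossing p \<in> carrier Aut_T" "crossing_frame p (after p) = slit_frame (after p) \<circ> crossing p"
proof -
  have "\<exists>g. g \<in> carrier Aut_T \<and> crossing_frame p (after p) = slit_frame (after p) \<circ> g"
    using frames_differ_by_automorphism[OF frame_slit_frame frame_crossing_frame, of "after p" p] by auto
  then have "crossing p \<in> carrier Aut_T \<and> crossing_frame p (after p) = slit_frame (after p) \<circ> crossing p"
    unfolding crossing_def by (rule someI_ex)
  then show "crossing p \<in> carrier Aut_T" "crossing_frame p (after p) = slit_frame (after p) \<circ> crossing p"
    by auto
qed

lemma length_crossing: "length (crossing p w) = length w"
  using tree_automorphismD(2)[OF crossing_props(1)] .

text \<open>
  The difference is transported along the far side, so it is the same at all its points.
\<close>

lemma crossing_frame_after: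
  assumes "z \<in> crossing_region p" "side p z < 0"
  shows "crossing_frame p z = slit_frame z \<circ> crossing p"
proof -
  let ?l = "linepath (after p) z"
  have seg: "closed_segment (after p) z \<subseteq> crossing_region p" "closed_segment (after p) z \<subseteq> slit_plane"
    using one_sided_segment[of "after p" p z "-1"] assms by auto
  have "crossing_frame p z = transport ?l (slit_frame (after p) \<circ> crossing p)"
    using transport_crossing_frame[of ?l p] seg by (simp add: crossing_props(2))
  also have "\<dots> = transport ?l (slit_frame (after p)) \<circ> crossing p"
    by (rule transport_comp[OF length_crossing])
  also have "transport ?l (slit_frame (after p)) = slit_frame z"
    using transport_slit_frame[of ?l] seg by simp
  finally show ?thesis .
qed

lemma subframe_crossing_frame_after:
  assumes "is_lift 1 (linepath (before p) (after p)) k" "pathstart k = branch x (before p)"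
    and avoid: "\<And>w. w \<in> closed_segment 0 (before p) \<Longrightarrow> \<not> slit_image w"
  shows "subframe (crossing_frame p (after p)) x = transport k (slit_frame (branch x (before p)))"
proof -
  have sub: "subframe (slit_frame (before p)) x = slit_frame (branch x (before p))"
    using avoid by (intro subframe_slit_frame) auto
  have "branch x (before p) \<in> slit_plane" using avoid by (intro branch_in_slit_plane) auto
  then have "slit_frame (before p) [x] = branch x (before p)"
    using sub frame_slit_frame[of "branch x (before p)"] by (metis frame_def subframe_def)
  moreover have "closed_segment (before p) (after p) \<subseteq> X"
    using closed_segment_subset[OF before_after(1,2) convex_crossing_region, of p] crossing_region_subset_X by blast
  ultimately show ?thesis
    unfolding crossing_frame_def sub[symmetric] using assms(1,2)
    by (intro subframe_transport[OF frame_slit_frame]) (auto intro: X_path_linepath)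
qed

text \<open>
  Sections of the crossing automorphism are read off from the transport along the lifts of the
  segment between the two marked points.
\<close>

lemma crossing_section:
  assumes sub: "subframe (crossing_frame p (after p)) x = slit_frame (branch y (after p)) \<circ> g"
    and g: "\<And>w. length (g w) = length w"
    and avoid: "\<And>w. w \<in> closed_segment 0 (after p) \<Longrightarrow> \<not> slit_image w"
  shows "crossing p (x # v) = y # g v"
proof (rule frame_inj[OF frame_slit_frame])
  show "after p \<in> slit_plane" by simp
  show "length (crossing p (x # v)) = length (y # g v)" by (simp add: length_crossing g)
  have "slit_frame (after p) (crossing p (x # v)) = subframe (crossing_frame p (after p)) x v"
    by (simp add: crossing_props(2) subframe_def)
  also have "\<dots> = slit_frame (branch y (after p)) (g v)" by (simp add: sub)
  also have "\<dots> = subframe (slit_frame (after p)) y (g v)"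
    using avoid by (subst subframe_slit_frame) auto
  finally show "slit_frame (after p) (crossing p (x # v)) = slit_frame (after p) (y # g v)"
    by (simp add: subframe_def)
qed

lemma in_segment_Complex:
  "w \<in> closed_segment (Complex a b) (Complex c d) \<longleftrightarrow>
    (\<exists>t. 0 \<le> t \<and> t \<le> 1 \<and> Re w = (1 - t) * a + t * c \<and> Im w = (1 - t) * b + t * d)"
  by (auto simp: in_segment complex_eq_iff)

lemma avoid_slit_image:
  "w \<in> closed_segment 0 (before p) \<Longrightarrow> \<not> slit_image w"
  "w \<in> closed_segment 0 (after p) \<Longrightarrow> \<not> slit_image w"
  by (cases p; auto simp: zero_complex.code in_segment_Complex slit_image_def)+

text \<open>
  The triangle with vertices 0 and the two marked points winds around the critical value, so its lifts
  exchange the two preimages of 0. Since it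
  avoids \<open>slit_image\<close>, the lifts remain in the slit plane and the sections are trivial.
\<close>

lemma crossing_Gs: "crossing Gs (x # v) = other x # v"
proof -
  \<comment> \<open>an inverse branch that is continuous across the slit from the critical value, where \<open>branch\<close> jumps\<close>
  define c where "c z = sqrt_minus_i * \<i> * csqrt (- (\<i> * (z - \<i>)))" for z
  let ?l = "linepath (before Gs) (after Gs)"
  have Im: "Im w = 2" if "w \<in> closed_segment (before Gs) (after Gs)" for w
    using that by (auto simp: in_segment_Complex algebra_simps)
  have fc: "fi (c z) = z" for z
  proof -
    have "(c z)\<^sup>2 = (sqrt_minus_i * sqrt_minus_i) * (\<i> * \<i>) * (csqrt (- (\<i> * (z - \<i>))))\<^sup>2"
      by (simp only: c_def power2_eq_square mult_ac)
    also have "\<dots> = z - \<i>" by (simp only: sqrt_minus_i_square power2_csqrt) (simp add: algebra_simps flip: mult.assoc)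
    finally show ?thesis by (simp add: quad_def)
  qed
  have "continuous_on (closed_segment (before Gs) (after Gs)) c"
    unfolding c_def
    by (intro continuous_on_mult continuous_on_const continuous_on_csqrt_compose continuous_intros)
      (use Im in \<open>auto simp: complex_nonpos_Reals_iff\<close>)
  then have pc: "path (signed x \<circ> (c \<circ> ?l))"
    by (intro path_continuous_image continuous_on_signed continuous_on_id path_linepath) (auto simp: path_image_linepath)
  define k where "k = signed x \<circ> (c \<circ> ?l)"
  have lift: "is_lift 1 ?l k" using pc by (simp add: is_lift_def k_def fc)
  have kim: "path_image k \<subseteq> slit_plane"
  proof
    fix y assume "y \<in> path_image k"
    then obtain w where w: "w \<in> closed_segment (before Gs) (after Gs)" "y = signed x (c w)"
      by (auto simp: k_def path_image_compose)
    have "\<not> slit_image (fi y)" using Im[OF w(1)] by (simp add: w(2) fc slit_image_def del: Re_Im_fi)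
    then show "y \<in> slit_plane" using slit_imp_slit_image by (auto simp: slit_plane_def)
  qed
  have ii: "a * \<i> * (\<i> * b) = - (a * b)" for a b by (simp add: complex_eq_iff)
  have start: "c (before Gs) = branch Lft (before Gs)" and fin: "c (after Gs) = - branch Lft (after Gs)"
    using csqrt_minus[of "- (\<i> * (before Gs - \<i>))"] csqrt_minus[of "\<i> * (after Gs - \<i>)"]
    by (simp_all add: c_def branch_def ii)
  have ks: "pathstart k = branch x (before Gs)" using start by (cases x) (auto simp: k_def pathstart_compose branch_def)
  have kf: "pathfinish k = branch (other x) (after Gs)"
    using fin by (cases x) (auto simp: k_def pathfinish_compose branch_def)
  have "subframe (crossing_frame Gs (after Gs)) x = transport k (slit_frame (pathstart k))"
    unfolding ks by (rule subframe_crossing_frame_after[OF lift ks avoid_slit_image(1)])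
  also have "\<dots> = slit_frame (pathfinish k)"
    using lift kim by (intro transport_slit_frame) (auto simp: is_lift_def)
  finally have "subframe (crossing_frame Gs (after Gs)) x = slit_frame (branch (other x) (after Gs)) \<circ> id"
    by (simp only: kf comp_id)
  then have "crossing Gs (x # v) = other x # id v"
    by (rule crossing_section[OF _ _ avoid_slit_image(2)]) simp
  then show ?thesis by simp
qed

text \<open>
  If the lift crosses a single slit, the section is the automorphism of that crossing.
\<close>

lemma crossing_section_through:
  assumes seg: "\<And>w. w \<in> closed_segment (before p) (after p) \<Longrightarrow>
      \<not> critical_slit w \<and> branch x w \<in> crossing_region r"
    and "0 < side r (branch x (before p))" "side r (branch x (after p)) < 0"
  shows "crossing p (x # v) = x # crossing r v"
proof (rule crossing_section[OF _ length_crossing avoid_slit_image(2)])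
  note b = path_branch_linepath[of "before p" "after p" x]
  let ?k = "branch x \<circ> linepath (before p) (after p)"
  have cs: "\<not> critical_slit w" if "w \<in> closed_segment (before p) (after p)" for w using seg that by blast
  have "subframe (crossing_frame p (after p)) x = transport ?k (slit_frame (branch x (before p)))"
    using b cs by (intro subframe_crossing_frame_after avoid_slit_image(1)) auto
  also have "slit_frame (branch x (before p)) = crossing_frame r (branch x (before p))"
    using seg[of "before p"] assms(2) by (intro crossing_frame_before[symmetric]) auto
  also have "transport ?k \<dots> = crossing_frame r (branch x (after p))"
    using transport_crossing_frame[of ?k r] b cs seg by auto
  also have "\<dots> = slit_frame (branch x (after p)) \<circ> crossing r"
    using seg[of "after p"] assms(3) by (intro crossing_frame_after) auto
  finally show "subframe (crossing_frame p (after p)) x = slit_frame (branch x (after p)) \<circ> crossing r" .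
qed

lemma crossing_section_trivial:
  assumes seg: "\<And>w. w \<in> closed_segment (before p) (after p) \<Longrightarrow>
      \<not> critical_slit w \<and> branch x w \<in> slit_plane"
  shows "crossing p (x # v) = x # v"
proof -
  note b = path_branch_linepath[of "before p" "after p" x]
  let ?k = "branch x \<circ> linepath (before p) (after p)"
  have cs: "\<not> critical_slit w" if "w \<in> closed_segment (before p) (after p)" for w using seg that by blast
  have "subframe (crossing_frame p (after p)) x = transport ?k (slit_frame (branch x (before p)))"
    using b cs by (intro subframe_crossing_frame_after avoid_slit_image(1)) auto
  also have "\<dots> = slit_frame (branch x (after p)) \<circ> id"
    using transport_slit_frame[of ?k] b cs seg by auto
  finally show ?thesis
    using crossing_section[of p x x id v, OF _ _ avoid_slit_image(2)] by simp
qed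

lemma Re_Im_branch:
  "(Re (branch x z))\<^sup>2 - (Im (branch x z))\<^sup>2 = Re z" "2 * Re (branch x z) * Im (branch x z) + 1 = Im z"
  using Re_Im_fi[of "branch x z"] by (simp_all only: fi_branch)

lemma branch_Rgt: "branch Rgt z = - branch Lft z"
  by (simp add: branch_def)

text \<open>
  The points of the vertical line \<open>Re w = -2\<close> lift to the hyperbola \<open>x\<^sup>2 - y\<^sup>2 = -2\<close>, whose two branches
  cross the slits on the imaginary axis, at the lifts of \<open>-2+i\<close>.
\<close>

lemma branch_Ga:
  assumes "Re w = -2"
  shows "branch Lft w \<in> crossing_region Gs" "branch Rgt w \<in> crossing_region Gb"
    "sgn (side Gs (branch Lft w)) = sgn (Im w - 1)" "sgn (side Gb (branch Rgt w)) = sgn (Im w - 1)"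
proof -
  define x y where "x = Re (branch Lft w)" and "y = Im (branch Lft w)"
  have xy: "x\<^sup>2 - y\<^sup>2 = -2" "2 * x * y + 1 = Im w"
    using Re_Im_branch[of Lft w] assms by (simp_all add: x_def y_def)
  have lt: "x < y" using branch_Lft_side[of w] assms by (simp add: x_def y_def critical_slit_def)
  have sq: "x\<^sup>2 < y\<^sup>2" "1\<^sup>2 < y\<^sup>2" unfolding one_power2 using xy(1) zero_le_power2[of x] by linarith+
  then have abs: "\<bar>x\<bar> < \<bar>y\<bar>" "1 < \<bar>y\<bar>" using power2_less_imp_less[of "\<bar>x\<bar>" "\<bar>y\<bar>"] power2_less_imp_less[of 1 "\<bar>y\<bar>"] by auto
  then have y: "1 < y" "0 < y + x" using lt by auto
  then show "branch Lft w \<in> crossing_region Gs" "branch Rgt w \<in> crossing_region Gb"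
    by (auto simp: branch_Rgt x_def y_def)
  have "Im w - 1 = 2 * y * x" using xy(2) by (simp add: mult.commute mult.left_commute)
  then have "sgn (Im w - 1) = sgn x" using y by (simp add: sgn_mult)
  then show "sgn (side Gs (branch Lft w)) = sgn (Im w - 1)" "sgn (side Gb (branch Rgt w)) = sgn (Im w - 1)"
    by (simp_all add: branch_Rgt x_def)
qed

text \<open>
  The slit \<open>-i[1,\<infinity>)\<close> has the two half-lines from \<open>-1+i\<close> and from \<open>1-i\<close> as preimage; only the first
  of them is a slit, so one lift crosses it and the other one crosses nothing.
\<close>

lemma branch_Gb:
  assumes "Im w = -3" "\<bar>Re w\<bar> \<le> 1"
  shows "branch Lft w \<in> crossing_region Ga" "branch Rgt w \<in> slit_plane"
    "sgn (side Ga (branch Lft w)) = - sgn (Re w)"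
proof -
  define x y where "x = Re (branch Lft w)" and "y = Im (branch Lft w)"
  have xy: "x\<^sup>2 - y\<^sup>2 = Re w" "x * y = -2"
    using Re_Im_branch[of Lft w] assms by (simp_all add: x_def y_def)
  have lt: "x < y" using branch_Lft_side[of w] assms by (simp add: x_def y_def critical_slit_def)
  have xn: "x < 0" and yp: "0 < y"
  proof -
    have "x * y < 0" using xy by simp
    then show "x < 0" "0 < y" using lt by (auto simp: mult_less_0_iff)
  qed
  have "x < -1"
  proof (rule ccontr)
    assume "\<not> x < -1"
    then have x1: "- x \<le> 1" by simp
    have "2 = (- x) * y" using xy(2) by simp
    also have "\<dots> \<le> 1 * y" using x1 yp by (intro mult_right_mono) auto
    finally have "2 \<le> y" by simp
    then have "2\<^sup>2 \<le> y\<^sup>2" by (intro power_mono) auto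
    moreover have "(- x)\<^sup>2 \<le> 1\<^sup>2" using x1 xn by (intro power_mono) auto
    ultimately show False using xy(1) assms(2) by simp
  qed
  then show "branch Lft w \<in> crossing_region Ga" "branch Rgt w \<in> slit_plane"
    by (auto simp: branch_Rgt x_def slit_plane_def slit_def y_def)
  have "Re w = (x - y) * (y + x)" using xy(1) by (simp add: power2_eq_square algebra_simps)
  then show "sgn (side Ga (branch Lft w)) = - sgn (Re w)"
    using lt by (simp add: sgn_mult x_def y_def)
qed

lemma sgn_pos_iff: "sgn a = 1 \<longleftrightarrow> 0 < a" and sgn_neg_iff: "sgn a = -1 \<longleftrightarrow> a < 0" for a :: real
  by (auto simp: sgn_if)

lemma crossing_Ga: "crossing Ga (Lft # v) = Lft # crossing Gs v" "crossing Ga (Rgt # v) = Rgt # crossing Gb v"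
proof -
  have w: "Re w = -2" if "w \<in> closed_segment (before Ga) (after Ga)" for w
    using that by (auto simp: in_segment_Complex algebra_simps)
  have s: "side Gs (branch Lft (before Ga)) > 0" "side Gs (branch Lft (after Ga)) < 0"
    "side Gb (branch Rgt (before Ga)) > 0" "side Gb (branch Rgt (after Ga)) < 0"
    using branch_Ga(3,4)[OF w, of "before Ga"] branch_Ga(3,4)[OF w, of "after Ga"]
    by (auto simp: sgn_pos_iff sgn_neg_iff simp del: side.simps)
  show "crossing Ga (Lft # v) = Lft # crossing Gs v"
    using w branch_Ga(1)[OF w] s by (intro crossing_section_through) (auto simp: critical_slit_def)
  show "crossing Ga (Rgt # v) = Rgt # crossing Gb v"
    using w branch_Ga(2)[OF w] s by (intro crossing_section_through) (auto simp: critical_slit_def)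
qed

lemma crossing_Gb: "crossing Gb (Lft # v) = Lft # crossing Ga v" "crossing Gb (Rgt # v) = Rgt # v"
proof -
  have w: "Im w = -3" "\<bar>Re w\<bar> \<le> 1" if "w \<in> closed_segment (before Gb) (after Gb)" for w
    using that by (auto simp: in_segment_Complex algebra_simps)
  have s: "side Ga (branch Lft (before Gb)) > 0" "side Ga (branch Lft (after Gb)) < 0"
    using branch_Gb(3)[OF w, of "before Gb"] branch_Gb(3)[OF w, of "after Gb"]
    by (auto simp: sgn_pos_iff sgn_neg_iff simp del: side.simps)
  show "crossing Gb (Lft # v) = Lft # crossing Ga v"
    using w branch_Gb(1)[OF w] s by (intro crossing_section_through) (auto simp: critical_slit_def)
  show "crossing Gb (Rgt # v) = Rgt # v"
    using w branch_Gb(2)[OF w] by (intro crossing_section_trivial) (auto simp: critical_slit_def)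
qed

lemma crossing_Nil: "crossing p [] = []"
  using length_crossing[of p "[]"] by simp

text \<open>
  The recursion has a unique solution.
\<close>

theorem crossing_eq_gen_aut: "crossing p = gen_aut p"
proof -
  have s: "crossing Gs = swap_aut"
  proof
    show "crossing Gs w = swap_aut w" for w
      by (cases w rule: swap_aut.cases) (simp_all add: crossing_Nil crossing_Gs)
  qed
  have "crossing Ga = pair_aut swap_aut (crossing Gb)"
  proof
    show "crossing Ga w = pair_aut swap_aut (crossing Gb) w" for w
      by (cases w rule: swap_aut.cases) (simp_all add: crossing_Nil crossing_Ga s)
  qed
  moreover have "crossing Gb = pair_aut (crossing Ga) id"
  proof
    show "crossing Gb w = pair_aut (crossing Ga) id w" for w
      by (cases w rule: swap_aut.cases) (simp_all add: crossing_Nil crossing_Gb)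
  qed
  ultimately have "crossing Ga = alpha_aut" "crossing Gb = beta_aut" by (rule alpha_beta_unique)+
  with s show ?thesis by (cases p) simp_all
qed

section \<open>The iterated monodromy group\<close>

lemma I_explicit_subset_Aut_T: "I_explicit \<subseteq> carrier Aut_T"
  unfolding I_explicit_eq_range using eval_word_in_Aut_T by blast

lemma id_in_I_explicit: "id \<in> I_explicit"
  using eval_word_in_I_explicit[of "[]"] by simp

lemma comp_in_I_explicit: "g \<in> I_explicit \<Longrightarrow> h \<in> I_explicit \<Longrightarrow> g \<circ> h \<in> I_explicit"
  unfolding I_explicit_eq_range by (auto simp flip: eval_word_append)

lemma gen_aut_in_I_explicit: "gen_aut p \<in> I_explicit"
  using eval_word_in_I_explicit[of "[p]"] by simp

text \<open>
  The slit plane and the three crossing regions cover \<open>X\<close>. Each carries an invariant frame field, and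
  on overlaps the fields differ by elements of the explicit group.
\<close>

fun patch :: "gen option \<Rightarrow> complex set" where
  "patch None = slit_plane"
| "patch (Some p) = crossing_region p"

fun patch_frame :: "gen option \<Rightarrow> complex \<Rightarrow> letter list \<Rightarrow> complex" where
  "patch_frame None = slit_frame"
| "patch_frame (Some p) = crossing_frame p"

lemma open_patch: "open (patch k)"
  by (cases k) (simp_all add: open_slit_plane open_crossing_region del: crossing_region.simps)

lemma patch_cover: "z \<in> X \<Longrightarrow> \<exists>k. z \<in> patch k"
  using slit_cases[of z] by (cases "slit z") (auto simp: slit_plane_def intro: exI[of _ None] exI[of _ "Some _"])

lemma transport_patch_frame:
  assumes "path \<gamma>" "path_image \<gamma> \<subseteq> patch k"
  shows "transport \<gamma> (patch_frame k (pathstart \<gamma>)) = patch_frame k (pathfinish \<gamma>)"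
  using assms transport_slit_frame transport_crossing_frame by (cases k) auto

lemma slit_frame_vs_crossing_frame:
  assumes "z \<in> slit_plane" "z \<in> crossing_region p"
  shows "\<exists>h\<in>I_explicit. crossing_frame p z = slit_frame z \<circ> h \<and> slit_frame z = crossing_frame p z \<circ> h"
proof -
  have "side p z \<noteq> 0" using assms slit_crossing_region by (auto simp: slit_plane_def)
  then consider "0 < side p z" | "side p z < 0" by linarith
  then show ?thesis
  proof cases
    case 1
    then show ?thesis using crossing_frame_before[OF assms(2)] id_in_I_explicit by (intro bexI[of _ id]) auto
  next
    case 2
    then have c: "crossing_frame p z = slit_frame z \<circ> gen_aut p"
      using crossing_frame_after[OF assms(2)] by (simp add: crossing_eq_gen_aut)
    then have "crossing_frame p z \<circ> gen_aut p = slit_frame z"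
      using gen_aut_involution[of p] by (simp only: comp_assoc comp_id)
    with c show ?thesis using gen_aut_in_I_explicit by (intro bexI[of _ "gen_aut p"]) auto
  qed
qed

text \<open>
  Two different crossing regions overlap only inside the slit plane, so it suffices to compare with
  the frame field there.
\<close>

lemma patch_frame_change:
  assumes "z \<in> patch k" "z \<in> patch k'"
  shows "\<exists>h\<in>I_explicit. patch_frame k z = patch_frame k' z \<circ> h"
proof (cases "z \<in> slit_plane")
  case True
  have "\<exists>h\<in>I_explicit. patch_frame k z = slit_frame z \<circ> h"
    using slit_frame_vs_crossing_frame[OF True] assms(1) id_in_I_explicit
    by (cases k) (auto intro: bexI[of _ id])
  then obtain h where h: "h \<in> I_explicit" "patch_frame k z = slit_frame z \<circ> h" by blast
  have "\<exists>h\<in>I_explicit. slit_frame z = patch_frame k' z \<circ> h"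
    using slit_frame_vs_crossing_frame[OF True] assms(2) id_in_I_explicit
    by (cases k') (auto intro: bexI[of _ id])
  then obtain h' where h': "h' \<in> I_explicit" "slit_frame z = patch_frame k' z \<circ> h'" by blast
  have "patch_frame k z = patch_frame k' z \<circ> (h' \<circ> h)" by (simp only: h(2) h'(2) comp_assoc)
  then show ?thesis using comp_in_I_explicit[OF h'(1) h(1)] by blast
next
  case False
  then have "slit z" by (simp add: slit_plane_def)
  then have "k = k'"
    using False assms slit_unique_crossing_region by (cases k; cases k') auto
  then show ?thesis using id_in_I_explicit by (intro bexI[of _ id]) auto
qed

lemma length_I_explicit: "g \<in> I_explicit \<Longrightarrow> length (g w) = length w"
  using I_explicit_subset_Aut_T tree_automorphismD(2) by blast

lemma X_path_subpath:
  assumes "X_path \<gamma>" "u \<in> {0..1}" "v \<in> {0..1}" shows "X_path (subpath u v \<gamma>)"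
  using assms path_image_subpath_subset[of u v \<gamma>] by (auto simp: X_path_def)

lemma transport_subpath:
  assumes "X_path \<gamma>" "frame (pathstart \<gamma>) q" "u \<in> {0..1}" "v \<in> {0..1}"
  shows "transport (subpath 0 v \<gamma>) q = transport (subpath u v \<gamma>) (transport (subpath 0 u \<gamma>) q)"
proof -
  have "homotopic_paths X (subpath 0 u \<gamma> +++ subpath u v \<gamma>) (subpath 0 v \<gamma>)"
    using assms by (intro homotopic_join_subpaths) (auto simp: X_path_def)
  from transport_homotopic[OF assms(2) this]
  have "transport (subpath 0 u \<gamma> +++ subpath u v \<gamma>) q = transport (subpath 0 v \<gamma>) q"
    by (simp only: pathstart_join pathstart_subpath) (simp only: pathstart_def)
  moreover have "transport (subpath 0 u \<gamma> +++ subpath u v \<gamma>) q = transport (subpath u v \<gamma>) (transport (subpath 0 u \<gamma>) q)"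
  proof (rule transport_join[OF assms(2)])
    show "pathstart (subpath 0 u \<gamma>) = pathstart \<gamma>" unfolding pathstart_subpath by (simp only: pathstart_def)
  qed (use assms in \<open>auto intro: X_path_subpath\<close>)
  ultimately show ?thesis by simp
qed

text \<open>
  Along a path, the transported base frame differs from the frame field of any patch that contains the
  current point by an element of the explicit group: this property is locally constant in time,
  because locally the path stays in one patch.
\<close>

theorem loop_transport_in_I_explicit:
  assumes \<gamma>: "X_path \<gamma>" "pathstart \<gamma> = 0" "pathfinish \<gamma> = 0"
  shows "\<exists>g\<in>I_explicit. transport \<gamma> base_frame = base_frame \<circ> g"
proof -
  define P where "P t \<longleftrightarrow> (\<exists>k. \<gamma> t \<in> patch k \<and>
    (\<exists>g\<in>I_explicit. transport (subpath 0 t \<gamma>) base_frame = patch_frame k (\<gamma> t) \<circ> g))" for t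
  have move: "\<exists>g\<in>I_explicit. transport (subpath 0 t \<gamma>) base_frame = patch_frame k (\<gamma> t) \<circ> g"
    if Pt: "P t" and mem: "\<gamma> t \<in> patch k" for t k
  proof -
    obtain k' g where k': "\<gamma> t \<in> patch k'" "g \<in> I_explicit"
      "transport (subpath 0 t \<gamma>) base_frame = patch_frame k' (\<gamma> t) \<circ> g"
      using Pt unfolding P_def by blast
    obtain h where h: "h \<in> I_explicit" "patch_frame k' (\<gamma> t) = patch_frame k (\<gamma> t) \<circ> h"
      using patch_frame_change[OF k'(1) mem] by blast
    have "transport (subpath 0 t \<gamma>) base_frame = patch_frame k (\<gamma> t) \<circ> (h \<circ> g)"
      by (simp only: k'(3) h(2) comp_assoc)
    then show ?thesis using comp_in_I_explicit[OF h(1) k'(2)] by blast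
  qed
  have fr: "frame (pathstart \<gamma>) base_frame" using frame_base_frame \<gamma>(2) by simp
  have g0: "\<gamma> 0 = 0" "\<gamma> 1 = 0" using \<gamma> by (auto simp: pathstart_def pathfinish_def)
  have "P 1"
  proof (rule connected_induction_simple[of "{0..1::real}" 0 1 P])
    have "transport (subpath 0 0 \<gamma>) base_frame = patch_frame None (\<gamma> 0) \<circ> id"
      using transport_const[OF frame_base_frame] slit_plane_subset_X zero_in_slit_plane
      by (auto simp: subpath_refl g0 slit_frame_0)
    moreover have "\<gamma> 0 \<in> patch None" using zero_in_slit_plane g0 by simp
    ultimately show "P 0" unfolding P_def using id_in_I_explicit by blast
    fix a :: real assume a: "a \<in> {0..1}"
    have "\<gamma> a \<in> X" using \<gamma>(1) a by (auto simp: X_path_def path_image_def simp del: Compl_iff)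
    then obtain k where k: "\<gamma> a \<in> patch k" using patch_cover by blast
    have "openin (top_of_set {0..1}) ({0..1} \<inter> \<gamma> -` patch k)"
      using \<gamma>(1) open_patch by (intro continuous_openin_preimage_gen) (auto simp: X_path_def path_def)
    then obtain e where e: "e > 0" "ball a e \<inter> {0..1} \<subseteq> {0..1} \<inter> \<gamma> -` patch k"
      using a k unfolding openin_contains_ball by blast
    let ?T = "ball a e \<inter> {0..1}"
    have "P y" if x: "x \<in> ?T" and y: "y \<in> ?T" and "P x" for x y
    proof -
      have "closed_segment x y \<subseteq> ?T" using x y by (intro closed_segment_subset convex_Int) auto
      then have im: "path_image (subpath x y \<gamma>) \<subseteq> patch k"
        using e(2) by (auto simp: path_image_subpath_gen)
      have p: "path (subpath x y \<gamma>)" using x y \<gamma>(1) by (auto simp: X_path_def)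
      obtain g where g: "g \<in> I_explicit" "transport (subpath 0 x \<gamma>) base_frame = patch_frame k (\<gamma> x) \<circ> g"
        using move[OF \<open>P x\<close>] x e by blast
      have "transport (subpath 0 y \<gamma>) base_frame = transport (subpath x y \<gamma>) (patch_frame k (\<gamma> x) \<circ> g)"
        using transport_subpath[OF \<gamma>(1) fr, of x y] x y g(2) by simp
      also have "\<dots> = transport (subpath x y \<gamma>) (patch_frame k (\<gamma> x)) \<circ> g"
        by (rule transport_comp) (rule length_I_explicit[OF g(1)])
      also have "transport (subpath x y \<gamma>) (patch_frame k (\<gamma> x)) = patch_frame k (\<gamma> y)"
        using transport_patch_frame[OF p im] by simp
      finally show ?thesis unfolding P_def using g(1) y e by blast
    qed
    moreover have "openin (top_of_set {0..1}) ?T" unfolding openin_open by (intro exI[of _ "ball a e"]) auto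
    moreover have "a \<in> ?T" using a e by auto
    ultimately show "\<exists>T. openin (top_of_set {0..1}) T \<and> a \<in> T \<and> (\<forall>x\<in>T. \<forall>y\<in>T. P x \<longrightarrow> P y)" by blast
  qed auto
  from move[OF this, of None] show ?thesis
    using zero_in_slit_plane by (simp add: g0 slit_frame_0)
qed

definition crossing_loop :: "gen \<Rightarrow> real \<Rightarrow> complex" where
  "crossing_loop p = linepath 0 (before p) +++ linepath (before p) (after p) +++ linepath (after p) 0"

lemma segment_before_after: "closed_segment (before p) (after p) \<subseteq> crossing_region p"
  using convex_crossing_region by (intro closed_segment_subset) auto

lemma crossing_loop_legs:
  "X_path (linepath 0 (before p))" "X_path (linepath (before p) (after p))" "X_path (linepath (after p) 0)"
proof -
  show "X_path (linepath 0 (before p))" by (rule X_path_linepath_0) simp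
  show "X_path (linepath (before p) (after p))"
    using segment_before_after crossing_region_subset_X by (intro X_path_linepath) blast
  show "X_path (linepath (after p) 0)"
    using segment_0_slit_plane[of "after p"] slit_plane_subset_X
    by (intro X_path_linepath) (auto simp: closed_segment_commute)
qed

lemma transport_crossing_loop:
  "transport (crossing_loop p) base_frame = base_frame \<circ> gen_aut p"
proof -
  note L = crossing_loop_legs[of p]
  have J: "X_path (linepath (before p) (after p) +++ linepath (after p) 0)"
    using L(2,3) by (auto simp: X_path_def path_image_join)
  have "transport (crossing_loop p) base_frame =
    transport (linepath (before p) (after p) +++ linepath (after p) 0) (slit_frame (before p))"
    unfolding crossing_loop_def slit_frame_def
    by (rule transport_join[OF frame_base_frame L(1) J]) auto
  also have "\<dots> = transport (linepath (after p) 0) (transport (linepath (before p) (after p)) (slit_frame (before p)))"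
    by (rule transport_join[OF frame_slit_frame L(2,3)]) auto
  also have "transport (linepath (before p) (after p)) (slit_frame (before p)) = slit_frame (after p) \<circ> gen_aut p"
    using crossing_props(2)[of p] by (simp only: crossing_frame_def crossing_eq_gen_aut)
  also have "transport (linepath (after p) 0) \<dots> = transport (linepath (after p) 0) (slit_frame (after p)) \<circ> gen_aut p"
    by (rule transport_comp) (rule length_I_explicit[OF gen_aut_in_I_explicit])
  also have "transport (linepath (after p) 0) (slit_frame (after p)) = base_frame"
    using transport_slit_frame[of "linepath (after p) 0"] segment_0_slit_plane[of "after p"]
    by (simp add: closed_segment_commute slit_frame_0)
  finally show ?thesis .
qed

lemma X_path_crossing_loop:
  "X_path (crossing_loop p)" "pathstart (crossing_loop p) = 0" "pathfinish (crossing_loop p) = 0"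
  using crossing_loop_legs[of p] by (auto simp: crossing_loop_def X_path_def path_image_join)

text \<open>
  Transport along a concatenation composes the automorphisms in the reverse order, so a word is
  realized by performing its crossings from the right end on.
\<close>

theorem I_explicit_realized:
  assumes "g \<in> I_explicit"
  shows "\<exists>\<gamma>. X_path \<gamma> \<and> pathstart \<gamma> = 0 \<and> pathfinish \<gamma> = 0 \<and> transport \<gamma> base_frame = base_frame \<circ> g"
proof -
  have "\<exists>\<gamma>. X_path \<gamma> \<and> pathstart \<gamma> = 0 \<and> pathfinish \<gamma> = 0 \<and> transport \<gamma> base_frame = base_frame \<circ> eval_word w" for w
  proof (induction w)
    case Nil
    have "0 \<in> X" using slit_plane_subset_X zero_in_slit_plane by blast
    then show ?case
      using transport_const[OF frame_base_frame] X_path_linepath[of 0 0]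
      by (intro exI[of _ "linepath 0 0"] conjI)
        (simp_all only: closed_segment_idem pathstart_linepath pathfinish_linepath eval_word_simps comp_id
          insert_subset empty_subsetI simp_thms)
  next
    case (Cons p w)
    then obtain \<gamma> where \<gamma>: "X_path \<gamma>" "pathstart \<gamma> = 0" "pathfinish \<gamma> = 0"
      "transport \<gamma> base_frame = base_frame \<circ> eval_word w" by blast
    note c = X_path_crossing_loop[of p]
    have "transport (\<gamma> +++ crossing_loop p) base_frame = transport (crossing_loop p) (base_frame \<circ> eval_word w)"
      using transport_join[OF frame_base_frame \<gamma>(1) c(1)] \<gamma> c by simp
    also have "\<dots> = transport (crossing_loop p) base_frame \<circ> eval_word w"
      by (rule transport_comp) (rule length_I_explicit[OF eval_word_in_I_explicit])
    also have "\<dots> = base_frame \<circ> eval_word (p # w)"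
      by (simp only: transport_crossing_loop eval_word_simps comp_assoc)
    finally have "transport (\<gamma> +++ crossing_loop p) base_frame = base_frame \<circ> eval_word (p # w)" .
    moreover have "X_path (\<gamma> +++ crossing_loop p)" using \<gamma> c by (auto simp: X_path_def path_image_join)
    ultimately show ?case using \<gamma> c by (intro exI[of _ "\<gamma> +++ crossing_loop p"]) auto
  qed
  then show ?thesis using assms by (auto simp: I_explicit_eq_range simp del: eval_word_simps)
qed

lemma tree_identification_frame:
  assumes "tree_identification \<i> b \<phi>"
  shows "frame b (snd \<circ> \<phi>)" "\<phi> w = (length w, (snd \<circ> \<phi>) w)" "inj \<phi>"
proof -
  have bij: "bij_betw \<phi> UNIV (preimage_tree \<i> b)" and len: "\<And>w. fst (\<phi> w) = length w"
    and par: "\<And>w x. snd (\<phi> w) = fi (snd (\<phi> (w @ [x])))"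
    using assms by (auto simp: tree_identification_def)
  show \<phi>: "\<phi> w = (length w, (snd \<circ> \<phi>) w)" for w using len[of w] by (cases "\<phi> w") auto
  show inj: "inj \<phi>" using bij by (simp add: bij_betw_def)
  have "\<phi> [] \<in> preimage_tree \<i> b" using bij by (auto simp: bij_betw_def)
  then have "snd (\<phi> []) = b" using len[of "[]"] by (auto simp: preimage_tree_def)
  moreover have "snd (\<phi> (w @ [Lft])) \<noteq> snd (\<phi> (w @ [Rgt]))" for w
  proof
    assume "snd (\<phi> (w @ [Lft])) = snd (\<phi> (w @ [Rgt]))"
    then have "\<phi> (w @ [Lft]) = \<phi> (w @ [Rgt])" by (intro prod_eqI) (simp_all add: len)
    then show False using inj by (auto dest: injD)
  qed
  ultimately show "frame b (snd \<circ> \<phi>)" using par by (simp add: frame_def)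
qed

lemma path_connected_X: "path_connected X"
  unfolding img_space_i by (rule path_connected_complement_countable) auto

text \<open>
  A path from 0 to the base point carries the base frame to a frame \<open>q'\<close> at the base point, for which
  the monodromy is the explicit group itself; \<open>\<tau>\<close> compares \<open>q'\<close> with the given labelling.
\<close>

theorem IMG_conjugate_I_explicit:
  assumes b: "b \<in> X" and \<phi>: "tree_identification \<i> b \<phi>"
  shows "\<exists>\<tau>\<in>carrier Aut_T. IMG \<i> b \<phi> = (\<lambda>g. \<tau> \<circ> g \<circ> inv_into UNIV \<tau>) ` I_explicit"
proof -
  note q = tree_identification_frame[OF \<phi>]
  let ?q = "snd \<circ> \<phi>"
  have "0 \<in> X" using slit_plane_subset_X zero_in_slit_plane by blast
  then obtain c where c: "path c" "path_image c \<subseteq> X" "pathstart c = 0" "pathfinish c = b"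
    using path_connected_X b unfolding path_connected_def by blast
  then have cX: "X_path c" "X_path (reversepath c)" by (auto simp: X_path_def)
  define q' where "q' = transport c base_frame"
  have q': "frame b q'" unfolding q'_def using frame_transport[OF frame_base_frame cX(1)] c by simp
  have returned: "transport (reversepath c) q' = base_frame"
    unfolding q'_def by (rule transport_reversepath[OF frame_base_frame cX(1) c(3)])
  obtain \<tau> where \<tau>: "\<tau> \<in> carrier Aut_T" "q' = ?q \<circ> \<tau>"
    using frames_differ_by_automorphism[OF q(1) q'] by blast
  let ?i = "inv_into UNIV \<tau>"
  have bt: "bij \<tau>" by (rule tree_automorphismD(1)[OF \<tau>(1)])
  have iT: "?i \<in> carrier Aut_T"
    using group.inv_closed[OF group_Aut_T \<tau>(1)] inv_Aut_T[OF \<tau>(1)] by simp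
  have qq': "?q = q' \<circ> ?i"
    using bt by (simp only: \<tau>(2) comp_assoc surj_iff[THEN iffD1] bij_is_surj comp_id)
  have act: "monodromy_action \<i> \<phi> \<gamma> = \<tau> \<circ> g \<circ> ?i"
    if tr: "transport \<gamma> q' = q' \<circ> g" and g: "g \<in> carrier Aut_T" for \<gamma> g
  proof
    fix w
    have "transport \<gamma> ?q = transport \<gamma> q' \<circ> ?i"
      unfolding qq' by (rule transport_comp) (rule tree_automorphismD(2)[OF iT])
    also have "\<dots> = ?q \<circ> (\<tau> \<circ> g \<circ> ?i)" unfolding tr by (simp only: \<tau>(2) comp_assoc)
    finally have t: "lift_endpoint \<i> (length w) \<gamma> (snd (\<phi> w)) = ?q ((\<tau> \<circ> g \<circ> ?i) w)"
      by (auto simp: transport_def fun_eq_iff)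
    have "length ((\<tau> \<circ> g \<circ> ?i) w) = length w"
      using tree_automorphismD(2)[OF \<tau>(1)] tree_automorphismD(2)[OF g] tree_automorphismD(2)[OF iT] by simp
    then have "(length w, lift_endpoint \<i> (length w) \<gamma> (snd (\<phi> w))) = \<phi> ((\<tau> \<circ> g \<circ> ?i) w)"
      using q(2)[of "(\<tau> \<circ> g \<circ> ?i) w"] t by simp
    then show "monodromy_action \<i> \<phi> \<gamma> w = (\<tau> \<circ> g \<circ> ?i) w"
      unfolding monodromy_action_def by (simp only: inv_into_f_f[OF q(3) UNIV_I])
  qed
  have "IMG \<i> b \<phi> = (\<lambda>g. \<tau> \<circ> g \<circ> ?i) ` I_explicit"
  proof (intro equalityI subsetI)
    fix m assume "m \<in> IMG \<i> b \<phi>"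
    then obtain \<gamma> where \<gamma>: "m = monodromy_action \<i> \<phi> \<gamma>" "X_path \<gamma>" "pathstart \<gamma> = b" "pathfinish \<gamma> = b"
      by (auto simp: IMG_def X_path_def)
    let ?r = "reversepath c"
    have gr: "X_path (\<gamma> +++ ?r)" using \<gamma> cX c by (auto simp: X_path_def path_image_join)
    have loop: "X_path (c +++ \<gamma> +++ ?r)" using gr \<gamma> cX c by (auto simp: X_path_def path_image_join)
    obtain g where g: "g \<in> I_explicit" "transport (c +++ \<gamma> +++ ?r) base_frame = base_frame \<circ> g"
      using loop_transport_in_I_explicit[OF loop] c by auto
    have "transport (c +++ \<gamma> +++ ?r) base_frame = transport (\<gamma> +++ ?r) q'"
      unfolding q'_def by (rule transport_join[OF frame_base_frame cX(1) gr]) (use c \<gamma> in auto)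
    also have "\<dots> = transport ?r (transport \<gamma> q')"
      by (rule transport_join[OF q' \<gamma>(2) cX(2)]) (use c \<gamma> in auto)
    finally have r: "transport ?r (transport \<gamma> q') = base_frame \<circ> g" using g(2) by simp
    have "frame b (transport \<gamma> q')" using frame_transport[OF q' \<gamma>(2,3)] \<gamma>(4) by simp
    from transport_reversepath[OF this cX(2)] have "transport \<gamma> q' = transport c (base_frame \<circ> g)"
      using r c by simp
    also have "\<dots> = q' \<circ> g" unfolding q'_def by (rule transport_comp) (rule length_I_explicit[OF g(1)])
    finally have "m = \<tau> \<circ> g \<circ> ?i" using act g(1) I_explicit_subset_Aut_T \<gamma>(1) by blast
    then show "m \<in> (\<lambda>g. \<tau> \<circ> g \<circ> ?i) ` I_explicit" using g(1) by blast
  next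
    fix m assume "m \<in> (\<lambda>g. \<tau> \<circ> g \<circ> ?i) ` I_explicit"
    then obtain g where g: "g \<in> I_explicit" "m = \<tau> \<circ> g \<circ> ?i" by blast
    obtain \<delta> where \<delta>: "X_path \<delta>" "pathstart \<delta> = 0" "pathfinish \<delta> = 0" "transport \<delta> base_frame = base_frame \<circ> g"
      using I_explicit_realized[OF g(1)] by blast
    have dc: "X_path (\<delta> +++ c)" using \<delta> cX c by (auto simp: X_path_def path_image_join)
    have loop: "X_path (reversepath c +++ \<delta> +++ c)" using dc \<delta> cX c by (auto simp: X_path_def path_image_join)
    have "transport (reversepath c +++ \<delta> +++ c) q' = transport (\<delta> +++ c) base_frame"
      unfolding returned[symmetric] by (rule transport_join[OF q' cX(2) dc]) (use c \<delta> in auto)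
    also have "\<dots> = transport c (base_frame \<circ> g)"
      unfolding \<delta>(4)[symmetric] by (rule transport_join[OF frame_base_frame \<delta>(1) cX(1)]) (use c \<delta> in auto)
    also have "\<dots> = q' \<circ> g" unfolding q'_def by (rule transport_comp) (rule length_I_explicit[OF g(1)])
    finally have "m = monodromy_action \<i> \<phi> (reversepath c +++ \<delta> +++ c)"
      unfolding g(2) using g(1) I_explicit_subset_Aut_T by (intro act[symmetric]) auto
    then show "m \<in> IMG \<i> b \<phi>"
      unfolding IMG_def using loop c \<delta> by (auto simp: X_path_def)
  qed
  then show ?thesis using \<tau>(1) by blast
qed

theorem theorem25:
  fixes b :: complex and \<phi> :: "letter list \<Rightarrow> nat \<times> complex"
  assumes "b \<in> img_space \<i>" and "tree_identification \<i> b \<phi>"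
  shows "subexponential_growth (Aut_T\<lparr>carrier := IMG \<i> b \<phi>\<rparr>) \<and>
         (\<exists>\<tau>\<in>carrier Aut_T. IMG \<i> b \<phi> = (\<lambda>g. \<tau> \<circ> g \<circ> inv_into UNIV \<tau>) ` I_explicit) \<and>
         subexponential_growth (Aut_T\<lparr>carrier := I_explicit\<rparr>)"
proof -
  obtain \<tau> where \<tau>: "\<tau> \<in> carrier Aut_T" "IMG \<i> b \<phi> = (\<lambda>g. \<tau> \<circ> g \<circ> inv_into UNIV \<tau>) ` I_explicit"
    using IMG_conjugate_I_explicit[OF assms] by blast
  then show ?thesis
    using conjugate_subexponential_growth[OF \<tau>(1)] I_explicit_subexponential_growth by auto
qed

end
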